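(* Let $\mathcal{M}=(T,N,M,U,\alpha,\beta)$ be a Morita context such that ${}_UM$, $M_T$, ${}_TN$, $N_U$ are projective modules and $M\otimes_TN=N\otimes_UM=0$. Then the algebra $\Lambda_{\mathcal{M}}=\begin{pmatrix} T & N \\ M & U \end{pmatrix}$ is special GLIT if and only if $T$ and $U$ are special GLIT.
   Context: Morita context: $T,U$ are Artin algebras, ${}_UM_T$ and ${}_TN_U$ are bimodules, $\alpha:M\otimes_TN\to U$ and $\beta:N\otimes_UM\to T$ are bimodule homomorphisms with $\alpha(m\otimes n)m'=m\beta(n\otimes m')$ and $\beta(n\otimes m)n'=n\alpha(m\otimes n')$. The associated Morita ring $\Lambda_{\mathcal{M}}$ is the ring of formal matrices $\begin{pmatrix} t & n \\ m & u \end{pmatrix}$ with product $\begin{pmatrix} t & n \\ m & u \end{pmatrix}\begin{pmatrix} t' & n' \\ m' & u' \end{pmatrix}=\begin{pmatrix} tt'+\beta(n\otimes m') & tn'+nu' \\ mt'+um' & \alpha(m\otimes n')+uu' \end{pmatrix}$. Standing assumption: $\Lambda_{\mathcal{M}}$ is an Artin algebra (equivalently there is a commutative Artin ring $R$ such that $T,U$ are Artin $R$-algebras and $M,N$ are finitely generated over $R$, which acts centrally on both). Special GLIT algebras: All modules are finitely generated left modules over an Artin algebra $\Lambda$. Subcategories of $\mathrm{mod}\,\Lambda$ are regarded as classes of modules, membership being understood up to isomorphism. $\Omega$ is the syzygy operator (kernel of a projective cover), $\Omega^0X=X$. For a class $\mathcal{C}$, $\Omega^t\mathcal{C}=\{\Omega^tX: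 X\in\mathcal{C}\}$, and $\mathrm{add}\,\mathcal{C}$ is the class of direct summands of finite direct sums of modules in $\mathcal{C}$ (for a module $V$, $\mathrm{add}\,V=\mathrm{add}\{V\}$). $\mathrm{fin.dim}(\mathcal{C})=\sup\{\mathrm{pd}(X): X\in\mathcal{C},\ \mathrm{pd}(X)<\infty\}$, and $\mathcal{P}^{<\infty}(\mathcal{C})$ is the class of modules in $\mathcal{C}$ of finite projective dimension. Let $K$ be the free abelian group on the isoclasses $[X]$ of indecomposable non-projective modules; for arbitrary $Y$ let $[Y]\in K$ be the sum (with multiplicities) of the classes of the non-projective indecomposable summands of $Y$. Let $L:K\to K$ be the endomorphism with $L([X])=[\Omega X]$. For a module $X$ let $\langle X\rangle\subseteq K$ be the subgroup generated by the classes of the indecomposable non-projective direct summands of $X$. Then $\Phi(X)=\min\{n\ge 0: \mathrm{rk}\,L^k(\langle X\rangle)=\mathrm{rk}\,L^{k+1}(\langle X\rangle)\ \forall k\ge n\}$ and $\Psi(X)=\Phi(X)+\mathrm{fin.dim}(\mathrm{add}\,\Omega^{\Phi(X)}(X))$. $\Phi\,\mathrm{dim}(\mathcal{C})$ and $\Psi\,\mathrm{dim}(\mathcal{C})$ are the suprema of $\Phi$ and $\Psi$ over $\mathcal{C}$. A class $\mathcal{C}$ is an $n$-GLIT class ($n\ge0$) if there are $t\ge1$, $V\in\mathrm{mod}\,\Lambda$, $\mathcal{D}\subseteq\mathrm{mod}\,\Lambda$ with: (a) $\mathrm{add}\,\mathcal{D}=\mathcal{D}$, $\Omega^t\mathcal{D}\subseteq\mathcal{D}$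 and $\Phi\,\mathrm{dim}(\mathcal{D})<\infty$; (b) for each $C\in\mathcal{C}$ there is an exact sequence $0\to V_1\oplus D_1\to V_0\oplus D_0\to\Omega^nC\to0$ with $V_0,V_1\in\mathrm{add}\,V$ and $D_0,D_1\in\mathcal{D}$. The algebra $\Lambda$ is special GLIT if $\mathcal{C}=\mathrm{mod}\,\Lambda$ satisfies one of the following equivalent conditions: (i) $\mathrm{fin.dim}(\mathcal{C})<\infty$; (ii) $\mathcal{P}^{<\infty}(\mathcal{C})$ is a $0$-GLIT class; (iii) $\mathcal{P}^{<\infty}(\mathcal{C})$ is an $n$-GLIT class for every $n\ge0$; (iv) there are $m\ge0$ and a class $\mathcal{E}\subseteq\mathrm{mod}\,\Lambda$ closed under direct sums with $\Psi\,\mathrm{dim}(\mathcal{E})<\infty$ such that each $C\in\mathcal{P}^{<\infty}(\mathcal{C})$ admits a short exact sequence $0\to E_1\to E_0\to\Omega^mC\to0$ with $E_0,E_1\in\mathcal{E}$. *)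

theory Defs
  imports "HOL-Algebra.Module" "HOL-Algebra.Subrings" "HOL-Algebra.Ideal"
    "HOL-Algebra.Free_Abelian_Groups" "HOL-Library.Extended_Nat"
begin

section \<open>Modules over noncommutative rings\<close>

text \<open>
  The locale \<^locale>\<open>module\<close> of HOL-Algebra requires a commutative ring of scalars. Its record type
  is reused here; the fields \<^const>\<open>mult\<close> and \<^const>\<open>one\<close> of that record play no role.
\<close>

locale left_module = R?: ring R + M?: abelian_group M
  for R :: "('a, 'c) ring_scheme" (structure) and M :: "('a, 'b, 'd) module_scheme" (structure) +
  assumes smult_closed [simp, intro]:
      "\<lbrakk>a \<in> carrier R; x \<in> carrier M\<rbrakk> \<Longrightarrow> a \<odot>\<^bsub>M\<^esub> x \<in> carrier M"
    and smult_l_distr: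
      "\<lbrakk>a \<in> carrier R; b \<in> carrier R; x \<in> carrier M\<rbrakk> \<Longrightarrow>
        (a \<oplus> b) \<odot>\<^bsub>M\<^esub> x = a \<odot>\<^bsub>M\<^esub> x \<oplus>\<^bsub>M\<^esub> b \<odot>\<^bsub>M\<^esub> x"
    and smult_r_distr:
      "\<lbrakk>a \<in> carrier R; x \<in> carrier M; y \<in> carrier M\<rbrakk> \<Longrightarrow>
        a \<odot>\<^bsub>M\<^esub> (x \<oplus>\<^bsub>M\<^esub> y) = a \<odot>\<^bsub>M\<^esub> x \<oplus>\<^bsub>M\<^esub> a \<odot>\<^bsub>M\<^esub> y"
    and smult_assoc:
      "\<lbrakk>a \<in> carrier R; b \<in> carrier R; x \<in> carrier M\<rbrakk> \<Longrightarrow>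
        (a \<otimes> b) \<odot>\<^bsub>M\<^esub> x = a \<odot>\<^bsub>M\<^esub> (b \<odot>\<^bsub>M\<^esub> x)"
    and smult_one [simp]:
      "x \<in> carrier M \<Longrightarrow> \<one> \<odot>\<^bsub>M\<^esub> x = x"

definition fin_gen :: "('a, 'c) ring_scheme \<Rightarrow> ('a, 'b, 'd) module_scheme \<Rightarrow> bool" where
  "fin_gen R M \<longleftrightarrow>
     (\<exists>S. finite S \<and> S \<subseteq> carrier M \<and>
        (\<forall>x\<in>carrier M. \<exists>c\<in>S \<rightarrow> carrier R. x = (\<Oplus>\<^bsub>M\<^esub>s\<in>S. c s \<odot>\<^bsub>M\<^esub> s)))"

definition lin_hom ::
  "('a, 'c) ring_scheme \<Rightarrow> ('a, 'b, 'd) module_scheme \<Rightarrow> ('a, 'e, 'f) module_scheme \<Rightarrow> ('b \<Rightarrow> 'e) set"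
  where
  "lin_hom R M N =
     {f \<in> carrier M \<rightarrow> carrier N.
        (\<forall>x\<in>carrier M. \<forall>y\<in>carrier M. f (x \<oplus>\<^bsub>M\<^esub> y) = f x \<oplus>\<^bsub>N\<^esub> f y) \<and>
        (\<forall>a\<in>carrier R. \<forall>x\<in>carrier M. f (a \<odot>\<^bsub>M\<^esub> x) = a \<odot>\<^bsub>N\<^esub> f x)}"

definition lin_ker :: "('a, 'b, 'd) module_scheme \<Rightarrow> ('a, 'e, 'f) module_scheme \<Rightarrow> ('b \<Rightarrow> 'e) \<Rightarrow> 'b set"
  where "lin_ker M N f = {x \<in> carrier M. f x = \<zero>\<^bsub>N\<^esub>}"

text \<open>
  HOL cannot quantify over all carrier types inside a formula, so the modules over a ring with
  elements of type \<open>'a\<close> that are quantified over live on the type \<open>(nat \<Rightarrow> 'a) set\<close>. This loses no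
  finitely generated module: each is isomorphic to some \<open>R\<^sup>n / K\<close>, whose elements are cosets in
  \<open>R\<^sup>n\<close>, that is, sets of functions \<open>nat \<Rightarrow> 'a\<close> vanishing from \<open>n\<close> on.
\<close>

type_synonym 'a std_module = "('a, (nat \<Rightarrow> 'a) set) module"

definition fg_modules :: "('a, 'c) ring_scheme \<Rightarrow> 'a std_module set" where
  "fg_modules R = {X. left_module R X \<and> fin_gen R X}"

text \<open>
  Projectivity is the lifting property. The test modules \<open>A\<close>, \<open>B\<close> range over the type above. For
  finitely generated \<open>P\<close> (the only case used) this is projectivity in the category of all modules:
  a surjection from \<open>R\<^sup>n\<close> onto \<open>P\<close> can be tested there, and makes \<open>P\<close> a summand of \<open>R\<^sup>n\<close>.
\<close>

definition projective_module :: "('a, 'c) ring_scheme \<Rightarrow> ('a, 'b, 'd) module_scheme \<Rightarrow> bool" where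
  "projective_module R P \<longleftrightarrow>
     left_module R P \<and>
     (\<forall>(A :: 'a std_module) (B :: 'a std_module) f g.
        left_module R A \<and> left_module R B \<and>
        f \<in> lin_hom R A B \<and> f ` carrier A = carrier B \<and> g \<in> lin_hom R P B \<longrightarrow>
        (\<exists>h\<in>lin_hom R P A. \<forall>x\<in>carrier P. f (h x) = g x))"


section \<open>Projective and finitistic dimension\<close>

text \<open>
  A resolution \<open>0 \<rightarrow> P n \<rightarrow> \<dots> \<rightarrow> P 0 \<rightarrow> X \<rightarrow> 0\<close> with augmentation \<open>d 0 : P 0 \<rightarrow> X\<close> and differentials
  \<open>d (Suc i) : P (Suc i) \<rightarrow> P i\<close>. Entries beyond \<open>n\<close> are irrelevant.
\<close>

definition projective_resolution ::
  "('a, 'c) ring_scheme \<Rightarrow> 'a std_module \<Rightarrow> nat \<Rightarrow> (nat \<Rightarrow> 'a std_module) \<Rightarrow>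
     (nat \<Rightarrow> (nat \<Rightarrow> 'a) set \<Rightarrow> (nat \<Rightarrow> 'a) set) \<Rightarrow> bool"
  where
  "projective_resolution R X n P d \<longleftrightarrow>
     (\<forall>i\<le>n. P i \<in> fg_modules R \<and> projective_module R (P i)) \<and>
     (\<forall>i\<le>n. d i \<in> lin_hom R (P i) (case i of 0 \<Rightarrow> X | Suc j \<Rightarrow> P j)) \<and>
     d 0 ` carrier (P 0) = carrier X \<and>
     (\<forall>i<n. d (Suc i) ` carrier (P (Suc i)) =
              lin_ker (P i) (case i of 0 \<Rightarrow> X | Suc j \<Rightarrow> P j) (d i)) \<and>
     inj_on (d n) (carrier (P n))"

text \<open>The infimum of the empty set in \<^typ>\<open>enat\<close> is \<open>\<infinity>\<close>; the zero module gets dimension \<open>0\<close>.\<close>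

definition proj_dim :: "('a, 'c) ring_scheme \<Rightarrow> 'a std_module \<Rightarrow> enat" where
  "proj_dim R X = Inf {enat n | n. \<exists>P d. projective_resolution R X n P d}"

definition fin_dim :: "('a, 'c) ring_scheme \<Rightarrow> 'a std_module set \<Rightarrow> enat" where
  "fin_dim R C = Sup {proj_dim R X | X. X \<in> C \<and> proj_dim R X < \<infinity>}"

text \<open>
  Special GLIT algebras are defined by any one of several equivalent conditions on the class of all
  finitely generated modules; the one used here is finiteness of its finitistic dimension.
\<close>

definition special_GLIT :: "('a, 'c) ring_scheme \<Rightarrow> bool" where
  "special_GLIT R \<longleftrightarrow> fin_dim R (fg_modules R) < \<infinity>"


section \<open>Artin algebras\<close>

definition artinian_cring :: "('a, 'c) ring_scheme \<Rightarrow> bool" where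
  "artinian_cring R \<longleftrightarrow>
     cring R \<and>
     (\<forall>I :: nat \<Rightarrow> 'a set. (\<forall>i. ideal (I i) R \<and> I (Suc i) \<subseteq> I i) \<longrightarrow> (\<exists>n. \<forall>i\<ge>n. I i = I n))"

definition regular_module :: "('a, 'c) ring_scheme \<Rightarrow> ('a, 'a) module" where
  "regular_module A =
     \<lparr>carrier = carrier A, mult = mult A, one = one A,
      ring.zero = ring.zero A, add = add A, smult = mult A\<rparr>"

text \<open>
  An Artin algebra is finitely generated as a module over a commutative Artinian ring mapping to its
  centre. Passing to the image of that ring, the base ring may be taken to be a central subring.
\<close>

definition artin_algebra :: "('a, 'c) ring_scheme \<Rightarrow> bool" where
  "artin_algebra A \<longleftrightarrow>
     ring A \<and>
     (\<exists>C. subcring C A \<and>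
          (\<forall>c\<in>C. \<forall>a\<in>carrier A. c \<otimes>\<^bsub>A\<^esub> a = a \<otimes>\<^bsub>A\<^esub> c) \<and>
          artinian_cring (A\<lparr>carrier := C\<rparr>) \<and>
          fin_gen (A\<lparr>carrier := C\<rparr>) (regular_module A))"


section \<open>Bimodules and tensor products\<close>

record ('l, 'm, 'r) bimodule = "('l, 'm) module" +
  rsmult :: "'m \<Rightarrow> 'r \<Rightarrow> 'm"  (infixl \<open>\<odot>\<^sub>r\<index>\<close> 70)

text \<open>Right modules are left modules over the opposite ring.\<close>

definition op_ring :: "('a, 'c) ring_scheme \<Rightarrow> ('a, 'c) ring_scheme" where
  "op_ring R = R\<lparr>mult := (\<lambda>a b. b \<otimes>\<^bsub>R\<^esub> a)\<rparr>"

definition right_part :: "('l, 'm, 'r, 'x) bimodule_scheme \<Rightarrow> ('r, 'm) module" where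
  "right_part M =
     \<lparr>carrier = carrier M, mult = mult M, one = one M, ring.zero = ring.zero M,
      add = add M,
      smult = (\<lambda>b x. x \<odot>\<^sub>r\<^bsub>M\<^esub> b)\<rparr>"

locale bimodule =
  fixes L :: "('l, 'c) ring_scheme" and R :: "('r, 'd) ring_scheme"
    and M :: "('l, 'm, 'r, 'x) bimodule_scheme"
  assumes left: "left_module L M"
    and right: "left_module (op_ring R) (right_part M)"
    and assoc: "\<lbrakk>a \<in> carrier L; x \<in> carrier M; b \<in> carrier R\<rbrakk> \<Longrightarrow>
      (a \<odot>\<^bsub>M\<^esub> x) \<odot>\<^sub>r\<^bsub>M\<^esub> b = a \<odot>\<^bsub>M\<^esub> (x \<odot>\<^sub>r\<^bsub>M\<^esub> b)"

text \<open>
  The tensor product \<open>M \<otimes>\<^sub>R N\<close> as an abelian group (written multiplicatively, as groups are in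
  HOL-Algebra): the free abelian group on \<open>M \<times> N\<close> modulo biadditivity and \<open>R\<close>-balancedness.
\<close>

definition tensor_relations ::
  "('r, 'c) ring_scheme \<Rightarrow> ('l, 'm, 'r, 'x) bimodule_scheme \<Rightarrow> ('r, 'n, 's, 'y) bimodule_scheme \<Rightarrow>
     (('m \<times> 'n) \<Rightarrow>\<^sub>0 int) set"
  where
  "tensor_relations R M N =
     {frag_of (x \<oplus>\<^bsub>M\<^esub> x', y) - frag_of (x, y) - frag_of (x', y) | x x' y.
        x \<in> carrier M \<and> x' \<in> carrier M \<and> y \<in> carrier N} \<union>
     {frag_of (x, y \<oplus>\<^bsub>N\<^esub> y') - frag_of (x, y) - frag_of (x, y') | x y y'.
        x \<in> carrier M \<and> y \<in> carrier N \<and> y' \<in> carrier N} \<union>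
     {frag_of (x \<odot>\<^sub>r\<^bsub>M\<^esub> r, y) - frag_of (x, r \<odot>\<^bsub>N\<^esub> y) | x r y.
        x \<in> carrier M \<and> r \<in> carrier R \<and> y \<in> carrier N}"

definition tensor_kernel ::
  "('r, 'c) ring_scheme \<Rightarrow> ('l, 'm, 'r, 'x) bimodule_scheme \<Rightarrow> ('r, 'n, 's, 'y) bimodule_scheme \<Rightarrow>
     (('m \<times> 'n) \<Rightarrow>\<^sub>0 int) set"
  where
  "tensor_kernel R M N =
     generate (free_Abelian_group (carrier M \<times> carrier N)) (tensor_relations R M N)"

definition tensor_product ::
  "('r, 'c) ring_scheme \<Rightarrow> ('l, 'm, 'r, 'x) bimodule_scheme \<Rightarrow> ('r, 'n, 's, 'y) bimodule_scheme \<Rightarrow>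
     (('m \<times> 'n) \<Rightarrow>\<^sub>0 int) set monoid"
  where
  "tensor_product R M N =
     free_Abelian_group (carrier M \<times> carrier N) Mod tensor_kernel R M N"

definition pure_tensor ::
  "('r, 'c) ring_scheme \<Rightarrow> ('l, 'm, 'r, 'x) bimodule_scheme \<Rightarrow> ('r, 'n, 's, 'y) bimodule_scheme \<Rightarrow>
     'm \<Rightarrow> 'n \<Rightarrow> (('m \<times> 'n) \<Rightarrow>\<^sub>0 int) set"
  where
  "pure_tensor R M N x y =
     tensor_kernel R M N #>\<^bsub>free_Abelian_group (carrier M \<times> carrier N)\<^esub> frag_of (x, y)"

text \<open>
  Homomorphisms of \<open>L\<close>-\<open>L\<close>-bimodules \<open>M \<otimes>\<^sub>R N \<rightarrow> L\<close>. As the pure tensors generate, linearity over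
  \<open>L\<close> on both sides need only be required on them.
\<close>

definition tensor_bimodule_hom ::
  "('l, 'c) ring_scheme \<Rightarrow> ('r, 'd) ring_scheme \<Rightarrow>
     ('l, 'm, 'r, 'x) bimodule_scheme \<Rightarrow> ('r, 'n, 'l, 'y) bimodule_scheme \<Rightarrow>
     ((('m \<times> 'n) \<Rightarrow>\<^sub>0 int) set \<Rightarrow> 'l) set"
  where
  "tensor_bimodule_hom L R M N =
     {f \<in> hom (tensor_product R M N) (add_monoid L).
        (\<forall>a\<in>carrier L. \<forall>x\<in>carrier M. \<forall>y\<in>carrier N.
           f (pure_tensor R M N (a \<odot>\<^bsub>M\<^esub> x) y) = a \<otimes>\<^bsub>L\<^esub> f (pure_tensor R M N x y) \<and>
           f (pure_tensor R M N x (y \<odot>\<^sub>r\<^bsub>N\<^esub> a)) = f (pure_tensor R M N x y) \<otimes>\<^bsub>L\<^esub> a)}"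


section \<open>Morita contexts\<close>

locale morita_context =
  fixes T :: "('t, 'c) ring_scheme"
    and N :: "('t, 'n, 'u) bimodule"
    and M :: "('u, 'm, 't) bimodule"
    and U :: "('u, 'd) ring_scheme"
    and \<alpha> :: "(('m \<times> 'n) \<Rightarrow>\<^sub>0 int) set \<Rightarrow> 'u"
    and \<beta> :: "(('n \<times> 'm) \<Rightarrow>\<^sub>0 int) set \<Rightarrow> 't"
  assumes artin_T: "artin_algebra T"
    and artin_U: "artin_algebra U"
    and bimodule_M: "bimodule U T M"
    and bimodule_N: "bimodule T U N"
    and alpha: "\<alpha> \<in> tensor_bimodule_hom U T M N"
    and beta: "\<beta> \<in> tensor_bimodule_hom T U N M"
    and alpha_beta: "\<lbrakk>m \<in> carrier M; n \<in> carrier N; m' \<in> carrier M\<rbrakk> \<Longrightarrow>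
      \<alpha> (pure_tensor T M N m n) \<odot>\<^bsub>M\<^esub> m' = m \<odot>\<^sub>r\<^bsub>M\<^esub> \<beta> (pure_tensor U N M n m')"
    and beta_alpha: "\<lbrakk>n \<in> carrier N; m \<in> carrier M; n' \<in> carrier N\<rbrakk> \<Longrightarrow>
      \<beta> (pure_tensor U N M n m) \<odot>\<^bsub>N\<^esub> n' = n \<odot>\<^sub>r\<^bsub>N\<^esub> \<alpha> (pure_tensor T M N m n')"

text \<open>The matrix with rows \<open>(t, n)\<close> and \<open>(m, u)\<close> is encoded as the quadruple \<open>(t, n, m, u)\<close>.\<close>

definition morita_ring ::
  "('t, 'c) ring_scheme \<Rightarrow> ('t, 'n, 'u) bimodule \<Rightarrow> ('u, 'm, 't) bimodule \<Rightarrow> ('u, 'd) ring_scheme \<Rightarrow>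
     ((('m \<times> 'n) \<Rightarrow>\<^sub>0 int) set \<Rightarrow> 'u) \<Rightarrow> ((('n \<times> 'm) \<Rightarrow>\<^sub>0 int) set \<Rightarrow> 't) \<Rightarrow>
     ('t \<times> 'n \<times> 'm \<times> 'u) ring"
  where
  "morita_ring T N M U \<alpha> \<beta> =
     \<lparr>carrier = carrier T \<times> carrier N \<times> carrier M \<times> carrier U,
      mult = (\<lambda>(t, n, m, u) (t', n', m', u').
        (t \<otimes>\<^bsub>T\<^esub> t' \<oplus>\<^bsub>T\<^esub> \<beta> (pure_tensor U N M n m'),
         t \<odot>\<^bsub>N\<^esub> n' \<oplus>\<^bsub>N\<^esub> n \<odot>\<^sub>r\<^bsub>N\<^esub> u',
         m \<odot>\<^sub>r\<^bsub>M\<^esub> t' \<oplus>\<^bsub>M\<^esub> u \<odot>\<^bsub>M\<^esub> m',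
         \<alpha> (pure_tensor T M N m n') \<oplus>\<^bsub>U\<^esub> u \<otimes>\<^bsub>U\<^esub> u')),
      one = (\<one>\<^bsub>T\<^esub>, \<zero>\<^bsub>N\<^esub>, \<zero>\<^bsub>M\<^esub>, \<one>\<^bsub>U\<^esub>),
      ring.zero = (\<zero>\<^bsub>T\<^esub>, \<zero>\<^bsub>N\<^esub>, \<zero>\<^bsub>M\<^esub>, \<zero>\<^bsub>U\<^esub>),
      add = (\<lambda>(t, n, m, u) (t', n', m', u').
        (t \<oplus>\<^bsub>T\<^esub> t', n \<oplus>\<^bsub>N\<^esub> n', m \<oplus>\<^bsub>M\<^esub> m', u \<oplus>\<^bsub>U\<^esub> u'))\<rparr>"

end

theory Submission
  imports Defs "HOL-Algebra.Chinese_Remainder"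
begin

text \<open>
  As both tensor products vanish, \<open>\<alpha>\<close> and \<open>\<beta>\<close> are zero and \<open>\<Lambda> = S \<oplus> J\<close> with \<open>S = T \<times> U\<close> and the
  ideal \<open>J = N \<oplus> M\<close>. Since \<open>\<Lambda>\<close> is projective as a left \<open>S\<close>-module, \<open>pd S X \<le> pd \<Lambda> X\<close> for every
  \<open>\<Lambda>\<close>-module \<open>X\<close>. Conversely \<open>pd \<Lambda> X \<le> pd S X + 1\<close>. By dimension shifting it suffices to treat
  an \<open>S\<close>-projective \<open>X\<close>; then \<open>\<Lambda> \<otimes>\<^sub>S X\<close> is \<open>\<Lambda>\<close>-projective, and the kernel \<open>J \<otimes>\<^sub>S X\<close> of its
  surjection onto \<open>X\<close> is \<open>S\<close>-projective and killed by every \<open>s \<in> S\<close> with \<open>s J = 0\<close>. As \<open>J\<close> is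
  generated by products \<open>a s\<close> with \<open>s J = 0\<close>, such a module is \<open>\<Lambda>\<close>-projective. In the proof
  \<open>\<Lambda> \<otimes>\<^sub>S X\<close> appears as the image of an idempotent endomorphism \<open>E\<close> of a free \<open>\<Lambda>\<close>-module. Letting
  \<open>J\<close> act by zero makes every \<open>S\<close>-module a \<open>\<Lambda>\<close>-module, so the finitistic dimensions of \<open>\<Lambda>\<close> and
  \<open>S\<close> are finite together, and the case of \<open>T \<times> U\<close> is settled factorwise.
\<close>

section \<open>Linear maps, submodules and free modules\<close>

text \<open>A module \<open>Y\<close> killed by all \<open>s\<close> with \<open>s J = 0\<close>
  satisfies \<open>J \<otimes>\<^sub>S Y = 0\<close>, since
  \<open>a s \<otimes> y = a \<otimes> s y\<close>. Hence \<open>Y\<close> is its own scalar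
  extension, and S-projectivity becomes \<open>\<Lambda>\<close>-projectivity. The products
  \<open>a s\<close> come from a dual basis, \<open>j = \<Sum> a\<^sub>i \<phi>\<^sub>i(j)\<close>;
  here \<open>\<phi>\<^sub>i(j) k = 0\<close> because it is the value of a balanced map at
  \<open>j \<otimes> k = 0\<close>. As \<open>J\<close> need not act by zero on \<open>X\<close>,
  the kernel of the multiplication \<open>\<mu>\<close> from
  \<open>\<Lambda> \<otimes>\<^sub>S X\<close> to \<open>X\<close> is not the subgroup
  \<open>J \<otimes>\<^sub>S X\<close> itself but its twisted copy, the set of all
  \<open>y - 1 \<otimes> \<mu>(y)\<close>. Dual bases and the reduction to free modules need
  finitely generated bimodules. This is extracted from the Artin algebra \<open>\<Lambda>\<close>,
  whose central elements are diagonal. The form of the proof is dictated by carrier types: syzygies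
  are submodules of free modules, while the given modules live elsewhere. Inductions therefore run
  at the type of free modules, and a separate first step admits any carrier.\<close>

lemma left_moduleI:
  assumes "ring R"
    and "\<And>x y. x \<in> carrier X \<Longrightarrow> y \<in> carrier X \<Longrightarrow> x \<oplus>\<^bsub>X\<^esub> y \<in> carrier X"
    and "\<zero>\<^bsub>X\<^esub> \<in> carrier X"
    and "\<And>x y z. x \<in> carrier X \<Longrightarrow> y \<in> carrier X \<Longrightarrow> z \<in> carrier X \<Longrightarrow>
          (x \<oplus>\<^bsub>X\<^esub> y) \<oplus>\<^bsub>X\<^esub> z = x \<oplus>\<^bsub>X\<^esub> (y \<oplus>\<^bsub>X\<^esub> z)"
    and "\<And>x y. x \<in> carrier X \<Longrightarrow> y \<in> carrier X \<Longrightarrow> x \<oplus>\<^bsub>X\<^esub> y = y \<oplus>\<^bsub>X\<^esub> x"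
    and "\<And>x. x \<in> carrier X \<Longrightarrow> \<zero>\<^bsub>X\<^esub> \<oplus>\<^bsub>X\<^esub> x = x"
    and "\<And>x. x \<in> carrier X \<Longrightarrow> \<exists>y\<in>carrier X. y \<oplus>\<^bsub>X\<^esub> x = \<zero>\<^bsub>X\<^esub>"
    and "\<And>a x. a \<in> carrier R \<Longrightarrow> x \<in> carrier X \<Longrightarrow> a \<odot>\<^bsub>X\<^esub> x \<in> carrier X"
    and "\<And>a b x. a \<in> carrier R \<Longrightarrow> b \<in> carrier R \<Longrightarrow> x \<in> carrier X \<Longrightarrow>
          (a \<oplus>\<^bsub>R\<^esub> b) \<odot>\<^bsub>X\<^esub> x = a \<odot>\<^bsub>X\<^esub> x \<oplus>\<^bsub>X\<^esub> b \<odot>\<^bsub>X\<^esub> x"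
    and "\<And>a x y. a \<in> carrier R \<Longrightarrow> x \<in> carrier X \<Longrightarrow> y \<in> carrier X \<Longrightarrow>
          a \<odot>\<^bsub>X\<^esub> (x \<oplus>\<^bsub>X\<^esub> y) = a \<odot>\<^bsub>X\<^esub> x \<oplus>\<^bsub>X\<^esub> a \<odot>\<^bsub>X\<^esub> y"
    and "\<And>a b x. a \<in> carrier R \<Longrightarrow> b \<in> carrier R \<Longrightarrow> x \<in> carrier X \<Longrightarrow>
          (a \<otimes>\<^bsub>R\<^esub> b) \<odot>\<^bsub>X\<^esub> x = a \<odot>\<^bsub>X\<^esub> (b \<odot>\<^bsub>X\<^esub> x)"
    and "\<And>x. x \<in> carrier X \<Longrightarrow> \<one>\<^bsub>R\<^esub> \<odot>\<^bsub>X\<^esub> x = x"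
  shows "left_module R X"
  by (intro left_module.intro left_module_axioms.intro abelian_groupI) (use assms in auto)

context left_module
begin

lemma smult_zero_left [simp]:
  assumes x: "x \<in> carrier M" shows "\<zero> \<odot>\<^bsub>M\<^esub> x = \<zero>\<^bsub>M\<^esub>"
proof -
  have "\<zero> \<odot>\<^bsub>M\<^esub> x \<oplus>\<^bsub>M\<^esub> \<zero> \<odot>\<^bsub>M\<^esub> x = \<zero> \<odot>\<^bsub>M\<^esub> x"
    using smult_l_distr[OF R.zero_closed R.zero_closed x] by simp
  then show ?thesis using x M.add.l_cancel_one'[of "\<zero> \<odot>\<^bsub>M\<^esub> x" "\<zero> \<odot>\<^bsub>M\<^esub> x"] by simp
qed

lemma smult_zero_right [simp]:
  assumes a: "a \<in> carrier R" shows "a \<odot>\<^bsub>M\<^esub> \<zero>\<^bsub>M\<^esub> = \<zero>\<^bsub>M\<^esub>"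
proof -
  have "a \<odot>\<^bsub>M\<^esub> \<zero>\<^bsub>M\<^esub> \<oplus>\<^bsub>M\<^esub> a \<odot>\<^bsub>M\<^esub> \<zero>\<^bsub>M\<^esub> = a \<odot>\<^bsub>M\<^esub> \<zero>\<^bsub>M\<^esub>"
    using smult_r_distr[OF a M.zero_closed M.zero_closed] by simp
  then show ?thesis using a M.add.l_cancel_one'[of "a \<odot>\<^bsub>M\<^esub> \<zero>\<^bsub>M\<^esub>" "a \<odot>\<^bsub>M\<^esub> \<zero>\<^bsub>M\<^esub>"] by simp
qed

lemma smult_minus_one:
  assumes x: "x \<in> carrier M" shows "(\<ominus> \<one>) \<odot>\<^bsub>M\<^esub> x = \<ominus>\<^bsub>M\<^esub> x"
proof -
  have "(\<ominus> \<one>) \<odot>\<^bsub>M\<^esub> x \<oplus>\<^bsub>M\<^esub> x = \<zero>\<^bsub>M\<^esub>"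
    using smult_l_distr[of "\<ominus> \<one>" "\<one>" x] x by (simp add: R.l_neg)
  then show ?thesis using x M.minus_equality by (metis smult_closed R.a_inv_closed R.one_closed)
qed

lemma smult_minus:
  assumes a: "a \<in> carrier R" and x: "x \<in> carrier M" shows "a \<odot>\<^bsub>M\<^esub> (\<ominus>\<^bsub>M\<^esub> x) = \<ominus>\<^bsub>M\<^esub> (a \<odot>\<^bsub>M\<^esub> x)"
proof -
  have "a \<odot>\<^bsub>M\<^esub> (\<ominus>\<^bsub>M\<^esub> x) \<oplus>\<^bsub>M\<^esub> a \<odot>\<^bsub>M\<^esub> x = \<zero>\<^bsub>M\<^esub>"
    using smult_r_distr[of a "\<ominus>\<^bsub>M\<^esub> x" x] x a by (simp add: M.l_neg)
  then show ?thesis using x a M.minus_equality by (metis smult_closed M.a_inv_closed)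
qed

lemma minus_eq_zero_iff:
  assumes "x \<in> carrier M" "y \<in> carrier M" shows "x \<ominus>\<^bsub>M\<^esub> y = \<zero>\<^bsub>M\<^esub> \<longleftrightarrow> x = y"
  using assms by (metis M.minus_eq M.minus_equality M.minus_minus M.a_inv_closed M.r_neg)

lemma diff_add_cancel:
  assumes "x \<in> carrier M" "y \<in> carrier M"
  shows "(x \<ominus>\<^bsub>M\<^esub> y) \<oplus>\<^bsub>M\<^esub> y = x" "y \<oplus>\<^bsub>M\<^esub> (x \<ominus>\<^bsub>M\<^esub> y) = x"
proof -
  show 1: "(x \<ominus>\<^bsub>M\<^esub> y) \<oplus>\<^bsub>M\<^esub> y = x" using assms by (simp add: M.minus_eq M.a_assoc M.l_neg)
  show "y \<oplus>\<^bsub>M\<^esub> (x \<ominus>\<^bsub>M\<^esub> y) = x" using 1 assms by (simp add: M.a_comm)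
qed

end

section \<open>Linear maps and their kernels\<close>

lemma lin_hom_closed: "f \<in> lin_hom R X Y \<Longrightarrow> x \<in> carrier X \<Longrightarrow> f x \<in> carrier Y"
  by (auto simp: lin_hom_def)

lemma lin_hom_add:
  "f \<in> lin_hom R X Y \<Longrightarrow> x \<in> carrier X \<Longrightarrow> y \<in> carrier X \<Longrightarrow> f (x \<oplus>\<^bsub>X\<^esub> y) = f x \<oplus>\<^bsub>Y\<^esub> f y"
  by (auto simp: lin_hom_def)

lemma lin_hom_smult:
  "f \<in> lin_hom R X Y \<Longrightarrow> a \<in> carrier R \<Longrightarrow> x \<in> carrier X \<Longrightarrow> f (a \<odot>\<^bsub>X\<^esub> x) = a \<odot>\<^bsub>Y\<^esub> f x"
  by (auto simp: lin_hom_def)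

lemma lin_homI:
  assumes "\<And>x. x \<in> carrier X \<Longrightarrow> f x \<in> carrier Y"
    and "\<And>x y. x \<in> carrier X \<Longrightarrow> y \<in> carrier X \<Longrightarrow> f (x \<oplus>\<^bsub>X\<^esub> y) = f x \<oplus>\<^bsub>Y\<^esub> f y"
    and "\<And>a x. a \<in> carrier R \<Longrightarrow> x \<in> carrier X \<Longrightarrow> f (a \<odot>\<^bsub>X\<^esub> x) = a \<odot>\<^bsub>Y\<^esub> f x"
  shows "f \<in> lin_hom R X Y"
  using assms by (auto simp: lin_hom_def)

lemma lin_hom_zero:
  assumes X: "left_module R X" and Y: "left_module R Y" and f: "f \<in> lin_hom R X Y"
  shows "f \<zero>\<^bsub>X\<^esub> = \<zero>\<^bsub>Y\<^esub>"
proof -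
  interpret X: left_module R X by fact
  interpret Y: left_module R Y by fact
  have "f (\<zero>\<^bsub>R\<^esub> \<odot>\<^bsub>X\<^esub> \<zero>\<^bsub>X\<^esub>) = \<zero>\<^bsub>R\<^esub> \<odot>\<^bsub>Y\<^esub> f \<zero>\<^bsub>X\<^esub>"
    using f by (intro lin_hom_smult) auto
  then show ?thesis using lin_hom_closed[OF f] by simp
qed

lemma lin_hom_minus:
  assumes X: "left_module R X" and Y: "left_module R Y" and f: "f \<in> lin_hom R X Y"
    and x: "x \<in> carrier X" and y: "y \<in> carrier X"
  shows "f (x \<ominus>\<^bsub>X\<^esub> y) = f x \<ominus>\<^bsub>Y\<^esub> f y"
proof -
  interpret X: left_module R X by fact
  interpret Y: left_module R Y by fact
  have "f (x \<oplus>\<^bsub>X\<^esub> (\<ominus>\<^bsub>R\<^esub> \<one>\<^bsub>R\<^esub>) \<odot>\<^bsub>X\<^esub> y) = f x \<oplus>\<^bsub>Y\<^esub> (\<ominus>\<^bsub>R\<^esub> \<one>\<^bsub>R\<^esub>) \<odot>\<^bsub>Y\<^esub> f y"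
    using x y by (simp add: lin_hom_add[OF f] lin_hom_smult[OF f])
  then show ?thesis
    using x y lin_hom_closed[OF f] by (simp add: X.smult_minus_one Y.smult_minus_one X.M.minus_eq Y.M.minus_eq)
qed

lemma lin_hom_comp:
  "f \<in> lin_hom R X Y \<Longrightarrow> g \<in> lin_hom R Y Z \<Longrightarrow> (\<lambda>x. g (f x)) \<in> lin_hom R X Z"
  by (auto simp: lin_hom_def Pi_iff)

lemma lin_hom_plus:
  assumes "left_module R Y" "f \<in> lin_hom R X Y" "g \<in> lin_hom R X Y"
  shows "(\<lambda>x. f x \<oplus>\<^bsub>Y\<^esub> g x) \<in> lin_hom R X Y"
proof -
  interpret Y: left_module R Y by fact
  show ?thesis
    by (rule lin_homI)
      (use assms in \<open>auto simp: lin_hom_closed lin_hom_add lin_hom_smult Y.M.a_ac Y.smult_r_distr\<close>)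
qed

lemma lin_hom_diff:
  assumes "left_module R Y" "f \<in> lin_hom R X Y" "g \<in> lin_hom R X Y"
  shows "(\<lambda>x. f x \<ominus>\<^bsub>Y\<^esub> g x) \<in> lin_hom R X Y"
proof -
  interpret Y: left_module R Y by fact
  show ?thesis
    by (rule lin_homI)
      (use assms in \<open>auto simp: lin_hom_closed lin_hom_add lin_hom_smult Y.M.a_ac Y.smult_r_distr
        Y.M.minus_eq Y.smult_minus Y.M.minus_add\<close>)
qed

lemma lin_hom_id: "(\<lambda>x. x) \<in> lin_hom R X X"
  by (auto simp: lin_hom_def)

definition ker_module ::
  "('a, 'b, 'd) module_scheme \<Rightarrow> ('a, 'e, 'f) module_scheme \<Rightarrow> ('b \<Rightarrow> 'e) \<Rightarrow> ('a, 'b, 'd) module_scheme"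
  where "ker_module X Y f = X\<lparr>carrier := lin_ker X Y f\<rparr>"

lemma ker_module_simps [simp]:
  "carrier (ker_module X Y f) = {x \<in> carrier X. f x = \<zero>\<^bsub>Y\<^esub>}"
  "add (ker_module X Y f) = add X"
  "\<zero>\<^bsub>ker_module X Y f\<^esub> = \<zero>\<^bsub>X\<^esub>"
  "smult (ker_module X Y f) = smult X"
  by (auto simp: ker_module_def lin_ker_def)

lemma left_module_submodule:
  assumes X: "left_module R X" and K: "K \<subseteq> carrier X" "\<zero>\<^bsub>X\<^esub> \<in> K"
    and add: "\<And>x y. x \<in> K \<Longrightarrow> y \<in> K \<Longrightarrow> x \<oplus>\<^bsub>X\<^esub> y \<in> K"
    and smult: "\<And>a x. a \<in> carrier R \<Longrightarrow> x \<in> K \<Longrightarrow> a \<odot>\<^bsub>X\<^esub> x \<in> K"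
  shows "left_module R (X\<lparr>carrier := K\<rparr>)"
proof -
  interpret X: left_module R X by fact
  have sub: "\<And>x. x \<in> K \<Longrightarrow> x \<in> carrier X" using K by auto
  \<comment> \<open>Negatives are multiples by the scalar -1, so closure under sums and scalars
    suffices.\<close>
  have inv: "\<exists>y\<in>K. y \<oplus>\<^bsub>X\<^esub> x = \<zero>\<^bsub>X\<^esub>" if "x \<in> K" for x
    using smult[of "\<ominus>\<^bsub>R\<^esub> \<one>\<^bsub>R\<^esub>" x] that sub[OF that]
    by (auto simp: X.smult_minus_one intro!: bexI[of _ "\<ominus>\<^bsub>X\<^esub> x"] X.M.l_neg)
  show ?thesis
    by (rule left_moduleI)
      (use assms sub inv in \<open>auto simp: X.M.a_ac X.smult_l_distr X.smult_r_distr X.smult_assoc X.R.ring_axioms\<close>)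
qed

lemma left_module_ker:
  assumes X: "left_module R X" and Y: "left_module R Y" and f: "f \<in> lin_hom R X Y"
  shows "left_module R (ker_module X Y f)"
proof -
  interpret X: left_module R X by fact
  interpret Y: left_module R Y by fact
  show ?thesis unfolding ker_module_def
    by (rule left_module_submodule[OF X])
      (auto simp: lin_ker_def lin_hom_zero[OF X Y f] lin_hom_add[OF f] lin_hom_smult[OF f])
qed

text \<open>Vectors are infinite sequences supported below \<open>r\<close>. All ranks thus share
  one carrier type, the identity embeds a smaller rank into a larger one, and sets of vectors have
  the type of the standard modules.\<close>

definition free_module :: "('a, 'c) ring_scheme \<Rightarrow> nat \<Rightarrow> ('a, nat \<Rightarrow> 'a) module" where
  "free_module R r =
     \<lparr>carrier = {x. (\<forall>i. x i \<in> carrier R) \<and> (\<forall>i\<ge>r. x i = \<zero>\<^bsub>R\<^esub>)},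
      mult = (\<lambda>x y. x), one = (\<lambda>i. \<zero>\<^bsub>R\<^esub>), ring.zero = (\<lambda>i. \<zero>\<^bsub>R\<^esub>),
      add = (\<lambda>x y i. x i \<oplus>\<^bsub>R\<^esub> y i), smult = (\<lambda>a x i. a \<otimes>\<^bsub>R\<^esub> x i)\<rparr>"

lemma free_module_simps [simp]:
  "x \<in> carrier (free_module R r) \<longleftrightarrow> (\<forall>i. x i \<in> carrier R) \<and> (\<forall>i\<ge>r. x i = \<zero>\<^bsub>R\<^esub>)"
  "add (free_module R r) = (\<lambda>x y i. x i \<oplus>\<^bsub>R\<^esub> y i)"
  "\<zero>\<^bsub>free_module R r\<^esub> = (\<lambda>i. \<zero>\<^bsub>R\<^esub>)"
  "smult (free_module R r) = (\<lambda>a x i. a \<otimes>\<^bsub>R\<^esub> x i)"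
  by (auto simp: free_module_def)

lemma left_module_free: assumes "ring R" shows "left_module R (free_module R r)"
proof -
  interpret ring R by fact
  have inv: "\<exists>y\<in>carrier (free_module R r). y \<oplus>\<^bsub>free_module R r\<^esub> x = \<zero>\<^bsub>free_module R r\<^esub>"
    if "x \<in> carrier (free_module R r)" for x
    by (rule bexI[of _ "\<lambda>i. \<ominus>\<^bsub>R\<^esub> (x i)"]) (use that in \<open>auto simp: l_neg\<close>)
  show ?thesis
    by (rule left_moduleI[OF assms _ _ _ _ _ inv])
      (auto simp: a_ac l_distr r_distr m_assoc fun_eq_iff)
qed

text \<open>An indexed family allows repeated vectors, which a finite sum over a set of vectors does
  not. Only the operations of \<open>X\<close> enter, so combinations in modules with different
  scalars can be compared term by term.\<close>

primrec lin_comb :: "('a, 'b, 'd) module_scheme \<Rightarrow> nat \<Rightarrow> (nat \<Rightarrow> 'a) \<Rightarrow> (nat \<Rightarrow> 'b) \<Rightarrow> 'b" where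
  "lin_comb X 0 c v = \<zero>\<^bsub>X\<^esub>"
| "lin_comb X (Suc r) c v = lin_comb X r c v \<oplus>\<^bsub>X\<^esub> c r \<odot>\<^bsub>X\<^esub> v r"

definition unit_vec :: "('a, 'c) ring_scheme \<Rightarrow> nat \<Rightarrow> nat \<Rightarrow> 'a" where
  "unit_vec R i = (\<lambda>j. if j = i then \<one>\<^bsub>R\<^esub> else \<zero>\<^bsub>R\<^esub>)"

lemma unit_vec_closed: "ring R \<Longrightarrow> i < r \<Longrightarrow> unit_vec R i \<in> carrier (free_module R r)"
  by (auto simp: unit_vec_def ring.ring_simprules)

context left_module
begin

lemma lin_comb_closed:
  "(\<And>i. i < r \<Longrightarrow> c i \<in> carrier R) \<Longrightarrow> (\<And>i. i < r \<Longrightarrow> v i \<in> carrier M) \<Longrightarrow>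
    lin_comb M r c v \<in> carrier M"
  by (induction r) auto

lemma lin_comb_add:
  "(\<And>i. i < r \<Longrightarrow> c i \<in> carrier R) \<Longrightarrow> (\<And>i. i < r \<Longrightarrow> d i \<in> carrier R) \<Longrightarrow>
    (\<And>i. i < r \<Longrightarrow> v i \<in> carrier M) \<Longrightarrow>
    lin_comb M r (\<lambda>i. c i \<oplus> d i) v = lin_comb M r c v \<oplus>\<^bsub>M\<^esub> lin_comb M r d v"
  by (induction r) (auto simp: smult_l_distr M.a_ac lin_comb_closed)

lemma lin_comb_smult:
  "a \<in> carrier R \<Longrightarrow> (\<And>i. i < r \<Longrightarrow> c i \<in> carrier R) \<Longrightarrow> (\<And>i. i < r \<Longrightarrow> v i \<in> carrier M) \<Longrightarrow>
    lin_comb M r (\<lambda>i. a \<otimes> c i) v = a \<odot>\<^bsub>M\<^esub> lin_comb M r c v"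
  by (induction r) (auto simp: smult_assoc smult_r_distr lin_comb_closed)

lemma lin_comb_hom:
  assumes Y: "left_module R Y" and f: "f \<in> lin_hom R M Y"
  shows "(\<And>i. i < r \<Longrightarrow> c i \<in> carrier R) \<Longrightarrow> (\<And>i. i < r \<Longrightarrow> v i \<in> carrier M) \<Longrightarrow>
    f (lin_comb M r c v) = lin_comb Y r c (\<lambda>i. f (v i))"
  by (induction r)
    (auto simp: lin_hom_zero[OF left_module_axioms Y f] lin_hom_add[OF f] lin_hom_smult[OF f] lin_comb_closed)

lemma lin_comb_unit:
  assumes "\<And>i. i < r \<Longrightarrow> v i \<in> carrier M"
  shows "lin_comb M r (unit_vec R k) v = (if k < r then v k else \<zero>\<^bsub>M\<^esub>)"
  using assms by (induction r) (auto simp: unit_vec_def less_Suc_eq)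

lemma lin_comb_lin_hom:
  "(\<And>i. i < r \<Longrightarrow> v i \<in> carrier M) \<Longrightarrow> (\<lambda>c. lin_comb M r c v) \<in> lin_hom R (free_module R r) M"
  by (rule lin_homI) (auto simp: lin_comb_closed lin_comb_add lin_comb_smult)

end

lemma lin_comb_cong:
  "(\<And>i. i < r \<Longrightarrow> c i = d i) \<Longrightarrow> (\<And>i. i < r \<Longrightarrow> v i = w i) \<Longrightarrow> lin_comb X r c v = lin_comb X r d w"
  by (induction r) auto

lemma lin_comb_basis:
  assumes R: "ring R" and x: "x \<in> carrier (free_module R r)"
  shows "lin_comb (free_module R r) r x (unit_vec R) = x"
proof -
  interpret ring R by fact
  \<comment> \<open>Generalised to partial sums: the first \<open>k\<close> terms give the
    truncation of \<open>x\<close> at \<open>k\<close>.\<close>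
  have *: "lin_comb (free_module R r) k x (unit_vec R) = (\<lambda>i. if i < k then x i else \<zero>\<^bsub>R\<^esub>)" if "k \<le> r" for k
    using that
  proof (induction k)
    case (Suc k)
    then show ?case using x
      by (auto simp: fun_eq_iff unit_vec_def less_Suc_eq)
  qed simp
  show ?thesis using *[of r] x by (auto simp: fun_eq_iff)
qed

lemma free_module_hom_eq:
  assumes X: "left_module R X" and f: "f \<in> lin_hom R (free_module R r) X"
    and c: "c \<in> carrier (free_module R r)"
  shows "f c = lin_comb X r c (\<lambda>i. f (unit_vec R i))"
proof -
  interpret X: left_module R X by fact
  interpret F: left_module R "free_module R r" by (rule left_module_free) (rule X.R.ring_axioms)
  have "f (lin_comb (free_module R r) r c (unit_vec R)) = lin_comb X r c (\<lambda>i. f (unit_vec R i))"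
    by (rule F.lin_comb_hom[OF X f]) (use c unit_vec_closed[OF X.R.ring_axioms] in auto)
  then show ?thesis using lin_comb_basis[OF X.R.ring_axioms c] by simp
qed

lemma free_module_lift:
  assumes A: "left_module R A" and B: "left_module R B"
    and g: "g \<in> lin_hom R A B" "g ` carrier A = carrier B"
    and f: "f \<in> lin_hom R (free_module R r) B"
  obtains t where "t \<in> lin_hom R (free_module R r) A"
    "\<And>c. c \<in> carrier (free_module R r) \<Longrightarrow> g (t c) = f c"
proof -
  interpret A: left_module R A by fact
  have "\<exists>a\<in>carrier A. g a = f (unit_vec R i)" if "i < r" for i
    using lin_hom_closed[OF f unit_vec_closed[OF A.R.ring_axioms that]] g(2) by (metis imageE)
  then obtain v where v: "\<And>i. i < r \<Longrightarrow> v i \<in> carrier A \<and> g (v i) = f (unit_vec R i)" by metis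
  show ?thesis
  proof
    show "(\<lambda>c. lin_comb A r c v) \<in> lin_hom R (free_module R r) A"
      using v by (intro A.lin_comb_lin_hom) auto
    fix c assume c: "c \<in> carrier (free_module R r)"
    have "g (lin_comb A r c v) = lin_comb B r c (\<lambda>i. g (v i))"
      using c v by (intro A.lin_comb_hom[OF B g(1)]) auto
    also have "\<dots> = f c" unfolding free_module_hom_eq[OF B f c] using v by (intro lin_comb_cong) auto
    finally show "g (lin_comb A r c v) = f c" .
  qed
qed

section \<open>Projective dimension via kernels of free covers\<close>

text \<open>Retracts of free modules of finite rank are the finitely generated projectives. In this
  form no test modules occur, so projectivity does not depend on a choice of carrier types.\<close>

definition retract_of ::
  "('a, 'c) ring_scheme \<Rightarrow> ('a, 'b, 'd) module_scheme \<Rightarrow> ('a, 'e, 'f) module_scheme \<Rightarrow> bool" where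
  "retract_of R X Y \<longleftrightarrow>
     (\<exists>i\<in>lin_hom R X Y. \<exists>q\<in>lin_hom R Y X. \<forall>x\<in>carrier X. q (i x) = x)"

definition free_cover ::
  "('a, 'c) ring_scheme \<Rightarrow> nat \<Rightarrow> ('a, 'b, 'd) module_scheme \<Rightarrow> ((nat \<Rightarrow> 'a) \<Rightarrow> 'b) \<Rightarrow> bool" where
  "free_cover R r X p \<longleftrightarrow>
     p \<in> lin_hom R (free_module R r) X \<and> p ` carrier (free_module R r) = carrier X"

primrec syzygy_le :: "('a, 'c) ring_scheme \<Rightarrow> nat \<Rightarrow> ('a, nat \<Rightarrow> 'a) module \<Rightarrow> bool" where
  "syzygy_le R 0 K \<longleftrightarrow> (\<exists>r. retract_of R K (free_module R r))"
| "syzygy_le R (Suc n) K \<longleftrightarrow>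
     (\<exists>r p. free_cover R r K p \<and> syzygy_le R n (ker_module (free_module R r) K p))"

text \<open>
  The recursion changes the carrier type in its first step only,
  so it is carried out by \<^const>\<open>syzygy_le\<close> on submodules of free modules.
\<close>

definition pd_le :: "('a, 'c) ring_scheme \<Rightarrow> nat \<Rightarrow> ('a, 'b, 'd) module_scheme \<Rightarrow> bool" where
  "pd_le R n X \<longleftrightarrow> left_module R X \<and>
     (case n of
        0 \<Rightarrow> \<exists>r. retract_of R X (free_module R r)
      | Suc m \<Rightarrow> \<exists>r p. free_cover R r X p \<and> syzygy_le R m (ker_module (free_module R r) X p))"

lemma syzygy_le_iff: "left_module R K \<Longrightarrow> syzygy_le R n K \<longleftrightarrow> pd_le R n K"
  by (cases n) (auto simp: pd_le_def)

lemma pd_le_left_module: "pd_le R n X \<Longrightarrow> left_module R X"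
  by (simp add: pd_le_def)

lemma left_module_ring: "left_module R X \<Longrightarrow> ring R"
  by (simp add: left_module_def)

lemma left_module_ker_cover:
  "left_module R X \<Longrightarrow> free_cover R r X p \<Longrightarrow> left_module R (ker_module (free_module R r) X p)"
  by (metis free_cover_def left_module_free left_module_ker left_module_ring)

lemma pd_le_0: "pd_le R 0 X \<longleftrightarrow> left_module R X \<and> (\<exists>r. retract_of R X (free_module R r))"
  by (simp add: pd_le_def)

text \<open>Hides the change of carrier type: the recursion now reads the same at every type,
  although the kernel always lives on \<open>nat \<Rightarrow> 'a\<close>.\<close>

lemma pd_le_Suc:
  "pd_le R (Suc n) X \<longleftrightarrow> left_module R X \<and>
     (\<exists>r p. free_cover R r X p \<and> pd_le R n (ker_module (free_module R r) X p))"
proof (cases "left_module R X")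
  case True
  then have "free_cover R r X p \<and> syzygy_le R n (ker_module (free_module R r) X p) \<longleftrightarrow>
      free_cover R r X p \<and> pd_le R n (ker_module (free_module R r) X p)" for r p
    using syzygy_le_iff left_module_ker_cover by blast
  then show ?thesis unfolding pd_le_def[of R "Suc n" X] by simp
qed (simp add: pd_le_def)

lemma retract_of_trans:
  assumes "retract_of R X Y" "retract_of R Y Z" shows "retract_of R X Z"
proof -
  obtain i q where 1: "i \<in> lin_hom R X Y" "q \<in> lin_hom R Y X" "\<forall>x\<in>carrier X. q (i x) = x"
    using assms(1) by (auto simp: retract_of_def)
  obtain j t where 2: "j \<in> lin_hom R Y Z" "t \<in> lin_hom R Z Y" "\<forall>x\<in>carrier Y. t (j x) = x"
    using assms(2) by (auto simp: retract_of_def)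
  show ?thesis unfolding retract_of_def
    by (rule bexI[OF _ lin_hom_comp[OF 1(1) 2(1)]], rule bexI[OF _ lin_hom_comp[OF 2(2) 1(2)]])
      (use 1(3) 2(3) lin_hom_closed[OF 1(1)] in auto)
qed

lemma retract_of_refl: "retract_of R X X"
  unfolding retract_of_def
  by (rule bexI[OF _ lin_hom_id], rule bexI[OF _ lin_hom_id]) simp

lemma pd_le_0_free: "ring R \<Longrightarrow> pd_le R 0 (free_module R r)"
  unfolding pd_le_0 by (intro conjI exI[of _ r] left_module_free retract_of_refl)

lemma pd_le_0_retract: "pd_le R 0 Y \<Longrightarrow> left_module R X \<Longrightarrow> retract_of R X Y \<Longrightarrow> pd_le R 0 X"
  unfolding pd_le_0 using retract_of_trans by blast

text \<open>The lifting property at arbitrary carrier types: \<open>f q\<close> lifts from the free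
  module by choosing preimages on the basis, and the lift is composed with the inclusion
  \<open>i\<close>.\<close>

lemma pd_le_0_lift:
  assumes P: "pd_le R 0 P" and A: "left_module R A" and B: "left_module R B"
    and g: "g \<in> lin_hom R A B" "g ` carrier A = carrier B" and f: "f \<in> lin_hom R P B"
  obtains t where "t \<in> lin_hom R P A" "\<And>x. x \<in> carrier P \<Longrightarrow> g (t x) = f x"
proof -
  obtain r i q where 1: "i \<in> lin_hom R P (free_module R r)" "q \<in> lin_hom R (free_module R r) P"
      "\<forall>x\<in>carrier P. q (i x) = x"
    using P by (auto simp: pd_le_0 retract_of_def)
  obtain t where t: "t \<in> lin_hom R (free_module R r) A"
      "\<And>c. c \<in> carrier (free_module R r) \<Longrightarrow> g (t c) = f (q c)"
    using free_module_lift[OF A B g lin_hom_comp[OF 1(2) f]] by metis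
  show ?thesis
    by (rule that[OF lin_hom_comp[OF 1(1) t(1)]]) (metis t(2) 1(1,3) lin_hom_closed)
qed

section \<open>Isomorphism invariance and sums of two free modules\<close>

definition lin_iso ::
  "('a, 'c) ring_scheme \<Rightarrow> ('a, 'b, 'd) module_scheme \<Rightarrow> ('a, 'e, 'f) module_scheme \<Rightarrow>
    ('b \<Rightarrow> 'e) \<Rightarrow> ('e \<Rightarrow> 'b) \<Rightarrow> bool" where
  "lin_iso R X Y f g \<longleftrightarrow> f \<in> lin_hom R X Y \<and> g \<in> lin_hom R Y X \<and>
     (\<forall>x\<in>carrier X. g (f x) = x) \<and> (\<forall>y\<in>carrier Y. f (g y) = y)"

lemma lin_iso_sym: "lin_iso R X Y f g \<Longrightarrow> lin_iso R Y X g f"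
  by (auto simp: lin_iso_def)

lemma free_cover_comp:
  "free_cover R r X p \<Longrightarrow> f \<in> lin_hom R X Y \<Longrightarrow> f ` carrier X = carrier Y \<Longrightarrow>
    free_cover R r Y (\<lambda>x. f (p x))"
  unfolding free_cover_def by (auto intro: lin_hom_comp simp: image_image[symmetric])

lemma ker_module_cong:
  "(\<And>x. x \<in> carrier X \<Longrightarrow> f x = \<zero>\<^bsub>Y\<^esub> \<longleftrightarrow> g x = \<zero>\<^bsub>Z\<^esub>) \<Longrightarrow> ker_module X Y f = ker_module X Z g"
  unfolding ker_module_def lin_ker_def by (rule arg_cong[where f = "\<lambda>K. X\<lparr>carrier := K\<rparr>"]) auto

lemma pd_le_iso:
  assumes X: "pd_le R n X" and Y: "left_module R Y" and iso: "lin_iso R X Y f g"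
  shows "pd_le R n Y"
proof (cases n)
  case 0
  have "retract_of R Y X" using iso unfolding retract_of_def lin_iso_def by (intro bexI[of _ g] bexI[of _ f]) auto
  then show ?thesis using X Y pd_le_0_retract 0 by blast
next
  case (Suc m)
  have mX: "left_module R X" using X pd_le_left_module by blast
  obtain r p where p: "free_cover R r X p" "pd_le R m (ker_module (free_module R r) X p)"
    using X Suc by (auto simp: pd_le_Suc)
  have "f ` carrier X = carrier Y" using iso unfolding lin_iso_def
    by (metis image_eqI lin_hom_closed subsetI subset_antisym image_subsetI)
  moreover have fh: "f \<in> lin_hom R X Y" using iso by (simp add: lin_iso_def)
  ultimately have c: "free_cover R r Y (\<lambda>x. f (p x))" using p free_cover_comp by blast
  have "ker_module (free_module R r) Y (\<lambda>x. f (p x)) = ker_module (free_module R r) X p"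
  proof (rule ker_module_cong)
    fix x assume "x \<in> carrier (free_module R r)"
    then have "p x \<in> carrier X" using p(1) lin_hom_closed unfolding free_cover_def by blast
    then show "f (p x) = \<zero>\<^bsub>Y\<^esub> \<longleftrightarrow> p x = \<zero>\<^bsub>X\<^esub>"
      using iso lin_hom_zero[OF mX Y fh] unfolding lin_iso_def
      by (metis lin_hom_zero[OF Y mX])
  qed
  then show ?thesis using c p(2) Y Suc by (auto simp: pd_le_Suc intro!: exI)
qed

text \<open>The decomposition of rank \<open>a + b\<close> into ranks \<open>a\<close> and
  \<open>b\<close>: \<open>fst_block\<close> and \<open>snd_block\<close> are the projections,
  \<open>shift_block\<close> is the second inclusion, and the first inclusion is the identity.
  Direct sums of free modules thus stay free modules on the same type.\<close>

definition fst_block :: "('a, 'c) ring_scheme \<Rightarrow> nat \<Rightarrow> (nat \<Rightarrow> 'a) \<Rightarrow> nat \<Rightarrow> 'a" where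
  "fst_block R a z = (\<lambda>i. if i < a then z i else \<zero>\<^bsub>R\<^esub>)"

definition snd_block :: "nat \<Rightarrow> (nat \<Rightarrow> 'a) \<Rightarrow> nat \<Rightarrow> 'a" where
  "snd_block a z = (\<lambda>i. z (i + a))"

definition shift_block :: "('a, 'c) ring_scheme \<Rightarrow> nat \<Rightarrow> (nat \<Rightarrow> 'a) \<Rightarrow> nat \<Rightarrow> 'a" where
  "shift_block R a y = (\<lambda>i. if i < a then \<zero>\<^bsub>R\<^esub> else y (i - a))"

context
  fixes R :: "('a, 'c) ring_scheme" (structure)
  assumes R: "ring R"
begin

interpretation ring R by (fact R)

lemma block_hom:
  "fst_block R a \<in> lin_hom R (free_module R (a + b)) (free_module R a)"
  "snd_block a \<in> lin_hom R (free_module R (a + b)) (free_module R b)"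
  "(\<lambda>x. x) \<in> lin_hom R (free_module R a) (free_module R (a + b))"
  "shift_block R a \<in> lin_hom R (free_module R b) (free_module R (a + b))"
  by (auto intro!: lin_homI simp: fst_block_def snd_block_def shift_block_def fun_eq_iff)

lemma block_simps:
  "x \<in> carrier (free_module R a) \<Longrightarrow> fst_block R a x = x"
  "x \<in> carrier (free_module R a) \<Longrightarrow> snd_block a x = \<zero>\<^bsub>free_module R b\<^esub>"
  "y \<in> carrier (free_module R b) \<Longrightarrow> fst_block R a (shift_block R a y) = \<zero>\<^bsub>free_module R a\<^esub>"
  "y \<in> carrier (free_module R b) \<Longrightarrow> snd_block a (shift_block R a y) = y"
  by (auto simp: fst_block_def snd_block_def shift_block_def fun_eq_iff)

end

definition block_map ::
  "('a, 'c) ring_scheme \<Rightarrow> nat \<Rightarrow> ('a, 'b, 'd) module_scheme \<Rightarrow> ((nat \<Rightarrow> 'a) \<Rightarrow> 'b) \<Rightarrow>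
    ((nat \<Rightarrow> 'a) \<Rightarrow> 'b) \<Rightarrow> (nat \<Rightarrow> 'a) \<Rightarrow> 'b" where
  "block_map R a X p q z = p (fst_block R a z) \<oplus>\<^bsub>X\<^esub> q (snd_block a z)"

lemma block_map_hom:
  assumes X: "left_module R X" and p: "p \<in> lin_hom R (free_module R a) X"
    and q: "q \<in> lin_hom R (free_module R b) X"
  shows "block_map R a X p q \<in> lin_hom R (free_module R (a + b)) X"
  unfolding block_map_def
  using X lin_hom_comp[OF block_hom(1)[OF left_module_ring[OF X]] p]
    lin_hom_comp[OF block_hom(2)[OF left_module_ring[OF X]] q]
  by (rule lin_hom_plus)

lemma block_map_pair:
  assumes X: "left_module R X" and p: "p \<in> lin_hom R (free_module R a) X"
    and q: "q \<in> lin_hom R (free_module R b) X"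
    and x: "x \<in> carrier (free_module R a)" and y: "y \<in> carrier (free_module R b)"
  obtains z where "z \<in> carrier (free_module R (a + b))" "fst_block R a z = x" "snd_block a z = y"
    "block_map R a X p q z = p x \<oplus>\<^bsub>X\<^esub> q y"
proof -
  have R: "ring R" using X by (rule left_module_ring)
  interpret ring R by fact
  define z where "z = (\<lambda>i. if i < a then x i else y (i - a))"
  have "z \<in> carrier (free_module R (a + b))" "fst_block R a z = x" "snd_block a z = y"
    using x y by (auto simp: z_def fst_block_def snd_block_def fun_eq_iff)
  then show ?thesis by (intro that) (auto simp: block_map_def)
qed

text \<open>A vector with zero second block lies in the kernel of the combined map iff its first
  block lies in the kernel of \<open>p\<close>. Only the zero of \<open>Z\<close> matters, because
  the target of \<open>snd_block\<close> is a syzygy in the horseshoe lemma and a whole free module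
  in Schanuel's lemma.\<close>

lemma block_map_ker_snd:
  assumes X: "left_module R X" and p: "p \<in> lin_hom R (free_module R a) X"
    and q: "q \<in> lin_hom R (free_module R b) X"
    and Z: "\<zero>\<^bsub>Z\<^esub> = \<zero>\<^bsub>free_module R b\<^esub>"
  shows "lin_iso R (ker_module (free_module R a) X p)
    (ker_module (ker_module (free_module R (a + b)) X (block_map R a X p q)) Z (snd_block a))
    (\<lambda>x. x) (fst_block R a)"
proof -
  have R: "ring R" using X by (rule left_module_ring)
  interpret X: left_module R X by fact
  have q0: "q (\<lambda>i. \<zero>\<^bsub>R\<^esub>) = \<zero>\<^bsub>X\<^esub>" using lin_hom_zero[OF left_module_free[OF R] X q] by simp
  have c: "p x \<in> carrier X" if "x \<in> carrier (free_module R a)" for x using lin_hom_closed[OF p that] .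
  note b = block_hom[OF R, of a b]
  have 1: "block_map R a X p q x = p x" if "x \<in> carrier (free_module R a)" for x
    using that q0 c[OF that] block_simps(1,2)[OF R that] by (simp add: block_map_def)
  have 2: "z \<in> carrier (free_module R a) \<and> fst_block R a z = z"
    if "z \<in> carrier (free_module R (a + b))" "snd_block a z = (\<lambda>i. \<zero>\<^bsub>R\<^esub>)" for z
  proof -
    have "z i = \<zero>\<^bsub>R\<^esub>" if "i \<ge> a" for i
      using fun_cong[OF \<open>snd_block a z = _\<close>, of "i - a"] that by (simp add: snd_block_def)
    then show ?thesis using that(1) by (auto simp: fst_block_def fun_eq_iff)
  qed
  have fb: "x \<in> carrier (free_module R (a + b)) \<and> snd_block a x = (\<lambda>i. \<zero>\<^bsub>R\<^esub>) \<and> fst_block R a x = x"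
    if "x \<in> carrier (free_module R a)" for x
    using lin_hom_closed[OF b(3) that] block_simps(2)[OF R that] block_simps(1)[OF R that] by simp
  define A where "A = ker_module (free_module R a) X p"
  define B where "B = ker_module (ker_module (free_module R (a + b)) X (block_map R a X p q)) Z (snd_block a)"
  have AB: "x \<in> carrier B" if "x \<in> carrier A" for x
    using that 1[of x] fb[of x] Z by (simp add: A_def B_def del: free_module_simps(1))
  have BA: "z \<in> carrier A \<and> fst_block R a z = z" if "z \<in> carrier B" for z
    using that 1[of z] 2[of z] Z by (simp add: A_def B_def del: free_module_simps(1))
  have ops: "add A = add (free_module R 0)" "add B = add A" "smult A = smult (free_module R 0)" "smult B = smult A"
    by (simp_all add: A_def B_def)
  have "lin_iso R A B (\<lambda>x. x) (fst_block R a)"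
    unfolding lin_iso_def
  proof (intro conjI lin_homI ballI)
    fix x y r assume x: "x \<in> carrier A" and y: "y \<in> carrier A"
    then show "x \<in> carrier B" "x \<oplus>\<^bsub>A\<^esub> y = x \<oplus>\<^bsub>B\<^esub> y" "r \<odot>\<^bsub>A\<^esub> x = r \<odot>\<^bsub>B\<^esub> x" "fst_block R a x = x"
      using AB BA by (auto simp: ops)
  next
    fix x y assume x: "x \<in> carrier B" and y: "y \<in> carrier B"
    show "fst_block R a x \<in> carrier A" "fst_block R a x = x" using BA[OF x] by auto
    show "fst_block R a (x \<oplus>\<^bsub>B\<^esub> y) = fst_block R a x \<oplus>\<^bsub>A\<^esub> fst_block R a y"
      by (auto simp: fst_block_def ops fun_eq_iff)
  next
    fix x r assume "r \<in> carrier R"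
    then show "fst_block R a (r \<odot>\<^bsub>B\<^esub> x) = r \<odot>\<^bsub>A\<^esub> fst_block R a x"
      by (auto simp: fst_block_def ops fun_eq_iff)
  qed
  then show ?thesis by (simp add: A_def B_def)
qed

lemma lin_hom_ker_incl: "p \<in> lin_hom R X (ker_module Y Z f) \<Longrightarrow> p \<in> lin_hom R X Y"
  by (auto simp: lin_hom_def)

lemma lin_hom_into_ker:
  "p \<in> lin_hom R X Y \<Longrightarrow> (\<And>x. x \<in> carrier X \<Longrightarrow> f (p x) = \<zero>\<^bsub>Z\<^esub>) \<Longrightarrow> p \<in> lin_hom R X (ker_module Y Z f)"
  by (auto simp: lin_hom_def)

lemma lin_hom_from_ker: "p \<in> lin_hom R X Y \<Longrightarrow> p \<in> lin_hom R (ker_module X Z f) Y"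
  by (auto simp: lin_hom_def)

declare free_module_simps [simp del]

lemma block_map_sum:
  assumes X: "left_module R X" and x: "x \<in> carrier (free_module R a)" and y: "y \<in> carrier (free_module R b)"
  shows "block_map R a X p q (x \<oplus>\<^bsub>free_module R (a + b)\<^esub> shift_block R a y) = p x \<oplus>\<^bsub>X\<^esub> q y"
proof -
  interpret X: left_module R X by fact
  have "fst_block R a (x \<oplus>\<^bsub>free_module R (a + b)\<^esub> shift_block R a y) = x"
    "snd_block a (x \<oplus>\<^bsub>free_module R (a + b)\<^esub> shift_block R a y) = y"
    using x y by (auto simp: fst_block_def snd_block_def shift_block_def free_module_simps fun_eq_iff)
  then show ?thesis by (simp add: block_map_def)
qed

section \<open>Extensions and the horseshoe lemma\<close>

lemma surjE:
  assumes "f ` A = B" "y \<in> B" obtains x where "x \<in> A" "f x = y"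
  using assms by blast

lemma surjI:
  assumes "\<And>x. x \<in> A \<Longrightarrow> f x \<in> B" "\<And>y. y \<in> B \<Longrightarrow> \<exists>x\<in>A. f x = y"
  shows "f ` A = B"
  using assms by force

text \<open>A section \<open>s\<close> of \<open>f\<close> exists because the quotient is
  projective, and \<open>k\<close> is the resulting projection onto the kernel. The pair of
  \<open>i k\<close> and \<open>j f\<close> embeds \<open>B\<close> into the sum of the two free
  modules.\<close>

lemma pd_le_ext_0:
  assumes B: "left_module R B" and f: "f \<in> lin_hom R B C" and surj: "f ` carrier B = carrier C"
    and C0: "pd_le R 0 C" and A0: "pd_le R 0 (ker_module B C f)"
  shows "pd_le R 0 B"
proof -
  have C: "left_module R C" using C0 by (rule pd_le_left_module)
  interpret B: left_module R B by fact
  interpret C: left_module R C by fact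
  have R: "ring R" by (rule B.R.ring_axioms)
  obtain a i q where 1: "i \<in> lin_hom R (ker_module B C f) (free_module R a)"
      "q \<in> lin_hom R (free_module R a) (ker_module B C f)"
      "\<forall>x\<in>carrier (ker_module B C f). q (i x) = x"
    using A0 by (auto simp: pd_le_0 retract_of_def)
  obtain b j t where 2: "j \<in> lin_hom R C (free_module R b)" "t \<in> lin_hom R (free_module R b) C"
      "\<forall>x\<in>carrier C. t (j x) = x"
    using C0 by (auto simp: pd_le_0 retract_of_def)
  obtain s where s: "s \<in> lin_hom R C B" "\<And>x. x \<in> carrier C \<Longrightarrow> f (s x) = x"
    using pd_le_0_lift[OF C0 B C f surj lin_hom_id] by blast
  note fc = lin_hom_closed[OF f] and sc = lin_hom_closed[OF s(1)] and jc = lin_hom_closed[OF 2(1)]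
  define k where "k = (\<lambda>x. x \<ominus>\<^bsub>B\<^esub> s (f x))"
  have kB: "k \<in> lin_hom R B B" unfolding k_def
    by (rule lin_hom_diff[OF B lin_hom_id lin_hom_comp[OF f s(1)]])
  have k: "k \<in> lin_hom R B (ker_module B C f)"
    by (rule lin_hom_into_ker[OF kB])
      (simp add: k_def lin_hom_minus[OF B C f] fc sc s(2) C.minus_eq_zero_iff)
  note kc = lin_hom_closed[OF k] and ic = lin_hom_closed[OF 1(1)]
  let ?F = "free_module R (a + b)"
  note bh = block_hom[OF R, of a b]
  have J: "(\<lambda>x. i (k x) \<oplus>\<^bsub>?F\<^esub> shift_block R a (j (f x))) \<in> lin_hom R B ?F"
    by (rule lin_hom_plus[OF left_module_free[OF R] lin_hom_comp[OF lin_hom_comp[OF k 1(1)] bh(3)]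
          lin_hom_comp[OF lin_hom_comp[OF f 2(1)] bh(4)]])
  have T: "block_map R a B q (\<lambda>y. s (t y)) \<in> lin_hom R ?F B"
    by (rule block_map_hom[OF B lin_hom_ker_incl[OF 1(2)] lin_hom_comp[OF 2(2) s(1)]])
  have TJ: "block_map R a B q (\<lambda>y. s (t y)) (i (k x) \<oplus>\<^bsub>?F\<^esub> shift_block R a (j (f x))) = x"
    if x: "x \<in> carrier B" for x
  proof -
    have "block_map R a B q (\<lambda>y. s (t y)) (i (k x) \<oplus>\<^bsub>?F\<^esub> shift_block R a (j (f x))) =
        q (i (k x)) \<oplus>\<^bsub>B\<^esub> s (t (j (f x)))"
      by (rule block_map_sum[OF B ic[OF kc[OF x]] jc[OF fc[OF x]]])
    also have "\<dots> = k x \<oplus>\<^bsub>B\<^esub> s (f x)" using bspec[OF 1(3) kc[OF x]] bspec[OF 2(3) fc[OF x]] by simp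
    also have "\<dots> = x" using x sc[OF fc[OF x]] by (simp add: k_def B.diff_add_cancel)
    finally show ?thesis .
  qed
  show ?thesis unfolding pd_le_0 retract_of_def
    by (intro conjI exI[of _ "a + b"] B bexI[OF _ J] bexI[OF _ T] ballI TJ)
qed

text \<open>The horseshoe lemma. The induction hypothesis is a premise at the type of submodules of
  free modules, whereas \<open>B\<close> and \<open>C\<close> are unrestricted: the new exact
  sequence consists of syzygies and lies at that type, so one step serves both the induction and the
  passage to other types.\<close>

lemma pd_le_ext_step:
  assumes IH: "\<And>(B :: ('a, nat \<Rightarrow> 'a) module) (C :: ('a, nat \<Rightarrow> 'a) module) f.
      left_module R B \<Longrightarrow> f \<in> lin_hom R B C \<Longrightarrow> f ` carrier B = carrier C \<Longrightarrow>
      pd_le R n C \<Longrightarrow> pd_le R n (ker_module B C f) \<Longrightarrow> pd_le R n B"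
    and B: "left_module R B" and f: "f \<in> lin_hom R B C" and surj: "f ` carrier B = carrier C"
    and C1: "pd_le R (Suc n) C" and A1: "pd_le R (Suc n) (ker_module B C f)"
  shows "pd_le (R :: ('a, 'c) ring_scheme) (Suc n) B"
proof -
  have C: "left_module R C" using C1 by (rule pd_le_left_module)
  interpret B: left_module R B by fact
  interpret C: left_module R C by fact
  have R: "ring R" by (rule B.R.ring_axioms)
  obtain a p where p: "free_cover R a (ker_module B C f) p"
      "pd_le R n (ker_module (free_module R a) (ker_module B C f) p)"
    using A1 by (auto simp: pd_le_Suc)
  obtain b q where q: "free_cover R b C q" "pd_le R n (ker_module (free_module R b) C q)"
    using C1 by (auto simp: pd_le_Suc)
  have qh: "q \<in> lin_hom R (free_module R b) C" and qs: "q ` carrier (free_module R b) = carrier C"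
    using q(1) by (auto simp: free_cover_def)
  have ph': "p \<in> lin_hom R (free_module R a) (ker_module B C f)"
    and ps: "p ` carrier (free_module R a) = carrier (ker_module B C f)"
    using p(1) by (auto simp: free_cover_def)
  note ph = lin_hom_ker_incl[OF ph']
  \<comment> \<open>The cover of \<open>B\<close> is built from that of the kernel and a lift
    \<open>g\<close> of the cover of \<open>C\<close>.\<close>
  obtain g where g: "g \<in> lin_hom R (free_module R b) B"
      "\<And>y. y \<in> carrier (free_module R b) \<Longrightarrow> f (g y) = q y"
    using free_module_lift[OF B C f surj qh] by blast
  let ?Fa = "free_module R a" and ?Fb = "free_module R b" and ?F = "free_module R (a + b)"
  define P where "P = block_map R a B p g"
  define E where "E = ker_module ?F B P"
  define C' where "C' = ker_module ?Fb C q"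
  have P: "P \<in> lin_hom R ?F B" unfolding P_def by (rule block_map_hom[OF B ph g(1)])
  note bh = block_hom[OF R, of a b]
  have f0: "f (p x) = \<zero>\<^bsub>C\<^esub>" if "x \<in> carrier ?Fa" for x
    using lin_hom_closed[OF ph' that] by simp
  note pc = lin_hom_closed[OF ph] and gc = lin_hom_closed[OF g(1)] and qc = lin_hom_closed[OF qh]
  have psurj: "\<exists>x\<in>carrier ?Fa. p x = y" if "y \<in> carrier B" "f y = \<zero>\<^bsub>C\<^esub>" for y
  proof -
    have "y \<in> p ` carrier ?Fa" unfolding ps using that by simp
    then show ?thesis by auto
  qed
  have Psum: "\<exists>z\<in>carrier ?F. P z = p x \<oplus>\<^bsub>B\<^esub> g y \<and> snd_block a z = y"
    if "x \<in> carrier ?Fa" "y \<in> carrier ?Fb" for x y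
    using block_map_pair[OF B ph g(1) that] unfolding P_def by blast
  have Psurj: "P ` carrier ?F = carrier B"
  proof (rule surjI)
    fix x assume x: "x \<in> carrier B"
    obtain y where y: "y \<in> carrier ?Fb" "q y = f x" using surjE[OF qs lin_hom_closed[OF f x]] by blast
    \<comment> \<open>\<open>x\<close> and \<open>g y\<close> agree in \<open>C\<close>, so their
      difference is reached by the cover \<open>p\<close> of the kernel.\<close>
    have "f (x \<ominus>\<^bsub>B\<^esub> g y) = \<zero>\<^bsub>C\<^esub>"
      using x y gc[OF y(1)] by (simp add: lin_hom_minus[OF B C f] g(2) lin_hom_closed[OF f] C.minus_eq_zero_iff)
    then obtain w where w: "w \<in> carrier ?Fa" "p w = x \<ominus>\<^bsub>B\<^esub> g y"
      using psurj[of "x \<ominus>\<^bsub>B\<^esub> g y"] x gc[OF y(1)] by auto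
    show "\<exists>z\<in>carrier ?F. P z = x"
      using Psum[OF w(1) y(1)] w(2) x gc[OF y(1)] by (auto simp: B.diff_add_cancel)
  qed (rule lin_hom_closed[OF P])
  have E: "left_module R E" unfolding E_def by (rule left_module_ker[OF left_module_free[OF R] B P])
  have fP: "f (P z) = q (snd_block a z)" if z: "z \<in> carrier ?F" for z
  proof -
    have z1: "fst_block R a z \<in> carrier ?Fa" and z2: "snd_block a z \<in> carrier ?Fb"
      using lin_hom_closed[OF bh(1) z] lin_hom_closed[OF bh(2) z] by auto
    show ?thesis unfolding P_def block_map_def
      using pc[OF z1] gc[OF z2] qc[OF z2] by (simp add: lin_hom_add[OF f] f0[OF z1] g(2)[OF z2])
  qed
  have snd: "snd_block a \<in> lin_hom R E C'"
    unfolding E_def C'_def ker_module_def[of ?F]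
  proof (rule lin_hom_into_ker)
    show "snd_block a \<in> lin_hom R (?F\<lparr>carrier := lin_ker ?F B P\<rparr>) ?Fb"
      using lin_hom_from_ker[OF bh(2)] by (simp add: ker_module_def)
    fix z assume "z \<in> carrier (?F\<lparr>carrier := lin_ker ?F B P\<rparr>)"
    then have "z \<in> carrier ?F" "P z = \<zero>\<^bsub>B\<^esub>" by (auto simp: lin_ker_def)
    then show "q (snd_block a z) = \<zero>\<^bsub>C\<^esub>" using fP[of z] lin_hom_zero[OF B C f] by auto
  qed
  have snds: "snd_block a ` carrier E = carrier C'"
  proof (rule surjI)
    fix y assume "y \<in> carrier C'"
    then have y: "y \<in> carrier ?Fb" "q y = \<zero>\<^bsub>C\<^esub>" by (auto simp: C'_def)
    have "f (\<zero>\<^bsub>B\<^esub> \<ominus>\<^bsub>B\<^esub> g y) = \<zero>\<^bsub>C\<^esub>"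
      using y gc[OF y(1)] by (simp add: lin_hom_minus[OF B C f] g(2) lin_hom_zero[OF B C f] C.minus_eq_zero_iff)
    then obtain w where w: "w \<in> carrier ?Fa" "p w = \<zero>\<^bsub>B\<^esub> \<ominus>\<^bsub>B\<^esub> g y"
      using psurj[of "\<zero>\<^bsub>B\<^esub> \<ominus>\<^bsub>B\<^esub> g y"] gc[OF y(1)] by auto
    show "\<exists>z\<in>carrier E. snd_block a z = y"
      using Psum[OF w(1) y(1)] w(2) gc[OF y(1)] by (auto simp: E_def B.diff_add_cancel)
  qed (rule lin_hom_closed[OF snd])
  have C'n: "pd_le R n C'" using q(2) by (simp add: C'_def)
  have kp: "ker_module ?Fa (ker_module B C f) p = ker_module ?Fa B p"
    by (rule ker_module_cong) simp
  \<comment> \<open>The syzygies again form an exact sequence: \<open>snd_block\<close> maps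
    \<open>E\<close> onto \<open>C'\<close>, with kernel isomorphic to that of
    \<open>p\<close>.\<close>
  have "pd_le R n (ker_module E C' (snd_block a))"
  proof (rule pd_le_iso)
    show "pd_le R n (ker_module ?Fa B p)" using p(2) kp by simp
    show "left_module R (ker_module E C' (snd_block a))"
      by (rule left_module_ker[OF E pd_le_left_module[OF C'n] snd])
    show "lin_iso R (ker_module ?Fa B p) (ker_module E C' (snd_block a)) (\<lambda>x. x) (fst_block R a)"
      unfolding E_def P_def by (rule block_map_ker_snd[OF B ph g(1)]) (simp add: C'_def)
  qed
  then have "pd_le R n E" by (rule IH[OF E snd snds C'n])
  then show ?thesis unfolding pd_le_Suc using B P Psurj by (auto simp: free_cover_def E_def)
qed

lemma pd_le_ext_free:
  fixes R :: "('a, 'c) ring_scheme" and B C :: "('a, nat \<Rightarrow> 'a) module"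
  shows "left_module R B \<Longrightarrow> f \<in> lin_hom R B C \<Longrightarrow> f ` carrier B = carrier C \<Longrightarrow>
      pd_le R n C \<Longrightarrow> pd_le R n (ker_module B C f) \<Longrightarrow> pd_le R n B"
proof (induction n arbitrary: B C f)
  case 0 then show ?case by (rule pd_le_ext_0)
next
  case (Suc n) then show ?case by (rule pd_le_ext_step)
qed

lemma pd_le_ext:
  assumes "left_module R B" "f \<in> lin_hom R B C" "f ` carrier B = carrier C"
      "pd_le R n C" "pd_le R n (ker_module B C f)"
  shows "pd_le R n B"
proof (cases n)
  case 0 then show ?thesis using assms pd_le_ext_0 by metis
next
  case (Suc m)
  show ?thesis unfolding Suc
    by (rule pd_le_ext_step[OF pd_le_ext_free assms(1-3)]) (use assms(4,5) Suc in auto)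
qed

lemma pd_le_cover:
  assumes "pd_le R n X" obtains r p where "free_cover R r X p"
proof (cases n)
  case 0
  then obtain r i q where q: "i \<in> lin_hom R X (free_module R r)" "q \<in> lin_hom R (free_module R r) X"
      "\<forall>x\<in>carrier X. q (i x) = x"
    using assms by (auto simp: pd_le_0 retract_of_def)
  have "q ` carrier (free_module R r) = carrier X"
    by (rule surjI) (use lin_hom_closed[OF q(2)] lin_hom_closed[OF q(1)] q(3) in auto)
  then show ?thesis using that q(2) by (auto simp: free_cover_def)
next
  case (Suc m) then show ?thesis using assms that by (auto simp: pd_le_Suc)
qed

text \<open>The kernel of a split surjection is the complementary summand, with projection
  \<open>x - i (q x)\<close>.\<close>

lemma ker_split:
  assumes X: "left_module R X" and P: "left_module R P" and i: "i \<in> lin_hom R X P"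
    and q: "q \<in> lin_hom R P X" and qi: "\<And>x. x \<in> carrier X \<Longrightarrow> q (i x) = x"
  shows "retract_of R (ker_module P X q) P"
proof -
  interpret X: left_module R X by fact
  interpret P: left_module R P by fact
  have h: "(\<lambda>x. x \<ominus>\<^bsub>P\<^esub> i (q x)) \<in> lin_hom R P P"
    by (rule lin_hom_diff[OF P lin_hom_id lin_hom_comp[OF q i]])
  have h': "(\<lambda>x. x \<ominus>\<^bsub>P\<^esub> i (q x)) \<in> lin_hom R P (ker_module P X q)"
    by (rule lin_hom_into_ker[OF h])
      (simp add: lin_hom_minus[OF P X q] lin_hom_closed[OF q] lin_hom_closed[OF i] qi X.minus_eq_zero_iff)
  show ?thesis unfolding retract_of_def
    by (rule bexI[OF _ lin_hom_from_ker[OF lin_hom_id]], rule bexI[OF _ h'])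
      (auto simp: lin_hom_zero[OF X P i] P.M.minus_eq)
qed

section \<open>Monotonicity of the bound and independence of the cover\<close>

lemma pd_le_0_Suc: assumes X: "pd_le R 0 X" shows "pd_le R (Suc 0) X"
proof -
  have L: "left_module R X" using X by (rule pd_le_left_module)
  have R: "ring R" using L by (rule left_module_ring)
  obtain r i q where q: "i \<in> lin_hom R X (free_module R r)" "q \<in> lin_hom R (free_module R r) X"
      "\<forall>x\<in>carrier X. q (i x) = x"
    using X by (auto simp: pd_le_0 retract_of_def)
  have s: "q ` carrier (free_module R r) = carrier X"
    by (rule surjI) (use lin_hom_closed[OF q(2)] lin_hom_closed[OF q(1)] q(3) in auto)
  have "pd_le R 0 (ker_module (free_module R r) X q)"
    by (rule pd_le_0_retract[OF pd_le_0_free[OF R] left_module_ker[OF left_module_free[OF R] L q(2)]])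
      (rule ker_split[OF L left_module_free[OF R] q(1,2)], use q(3) in auto)
  then show ?thesis using L q s by (auto simp: pd_le_Suc free_cover_def)
qed

lemma syzygy_mono: "left_module R K \<Longrightarrow> syzygy_le R n K \<Longrightarrow> syzygy_le R (Suc n) K"
proof (induction n arbitrary: K)
  case 0 then show ?case using pd_le_0_Suc syzygy_le_iff by metis
next
  case (Suc n)
  then obtain r p where p: "free_cover R r K p" "syzygy_le R n (ker_module (free_module R r) K p)"
    by auto
  then have "syzygy_le R (Suc n) (ker_module (free_module R r) K p)"
    using Suc left_module_ker_cover by blast
  then show ?case using p(1) unfolding syzygy_le.simps(2)[of _ "Suc n"] by (intro exI conjI)
qed

lemma pd_le_Suc_mono: assumes "pd_le R n X" shows "pd_le R (Suc n) X"
proof (cases n)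
  case 0 then show ?thesis using assms pd_le_0_Suc by metis
next
  case (Suc m)
  obtain r p where p: "free_cover R r X p" "pd_le R m (ker_module (free_module R r) X p)"
    using assms Suc by (auto simp: pd_le_Suc)
  then have "pd_le R (Suc m) (ker_module (free_module R r) X p)"
    using syzygy_mono syzygy_le_iff pd_le_left_module by metis
  then show ?thesis using p(1) pd_le_left_module[OF assms] Suc by (auto simp: pd_le_Suc[of R "Suc m"])
qed

lemma pd_le_mono: assumes "pd_le R n X" "n \<le> m" shows "pd_le R m X"
  using assms(2,1) by (induction rule: dec_induct) (auto intro: pd_le_Suc_mono)

text \<open>Schanuel's lemma. The kernel \<open>E\<close> of the combined map is an extension of a
  free module by the kernel of \<open>p\<close>, so it inherits the bound; it also has the kernel of
  \<open>q\<close> as a retract. Closure under retracts is a premise because its own proof at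
  \<open>Suc n\<close> uses this lemma at \<open>n\<close>.\<close>

lemma pd_le_ker_cover_step:
  fixes R :: "('a, 'c) ring_scheme"
  assumes retr: "\<And>(K :: ('a, nat \<Rightarrow> 'a) module) (E :: ('a, nat \<Rightarrow> 'a) module).
      pd_le R n E \<Longrightarrow> left_module R K \<Longrightarrow> retract_of R K E \<Longrightarrow> pd_le R n K"
    and X: "left_module R X" and p: "free_cover R a X p" and q: "free_cover R b X q"
    and kp: "pd_le R n (ker_module (free_module R a) X p)"
  shows "pd_le R n (ker_module (free_module R b) X q)"
proof -
  interpret X: left_module R X by fact
  have R: "ring R" by (rule X.R.ring_axioms)
  let ?Fa = "free_module R a" and ?Fb = "free_module R b" and ?F = "free_module R (a + b)"
  have ph: "p \<in> lin_hom R ?Fa X" and ps: "p ` carrier ?Fa = carrier X"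
    and qh: "q \<in> lin_hom R ?Fb X" and qs: "q ` carrier ?Fb = carrier X"
    using p q by (auto simp: free_cover_def)
  note pc = lin_hom_closed[OF ph] and qc = lin_hom_closed[OF qh]
  note bh = block_hom[OF R, of a b]
  define P where "P = block_map R a X p q"
  define E where "E = ker_module ?F X P"
  have P: "P \<in> lin_hom R ?F X" unfolding P_def by (rule block_map_hom[OF X ph qh])
  have E: "left_module R E" unfolding E_def by (rule left_module_ker[OF left_module_free[OF R] X P])
  have snd: "snd_block a \<in> lin_hom R E ?Fb" unfolding E_def by (rule lin_hom_from_ker[OF bh(2)])
  have snds: "snd_block a ` carrier E = carrier ?Fb"
  proof (rule surjI)
    fix y assume y: "y \<in> carrier ?Fb"
    have "\<zero>\<^bsub>X\<^esub> \<ominus>\<^bsub>X\<^esub> q y \<in> p ` carrier ?Fa" unfolding ps using qc[OF y] by simp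
    then obtain x where x: "x \<in> carrier ?Fa" "p x = \<zero>\<^bsub>X\<^esub> \<ominus>\<^bsub>X\<^esub> q y" by auto
    show "\<exists>z\<in>carrier E. snd_block a z = y"
      using block_map_pair[OF X ph qh x(1) y] x(2) qc[OF y]
      by (auto simp: E_def P_def X.diff_add_cancel)
  qed (rule lin_hom_closed[OF snd])
  have "pd_le R n (ker_module E ?Fb (snd_block a))"
  proof (rule pd_le_iso[OF kp])
    show "left_module R (ker_module E ?Fb (snd_block a))"
      by (rule left_module_ker[OF E left_module_free[OF R] snd])
    show "lin_iso R (ker_module ?Fa X p) (ker_module E ?Fb (snd_block a)) (\<lambda>x. x) (fst_block R a)"
      unfolding E_def P_def by (rule block_map_ker_snd[OF X ph qh]) simp
  qed
  then have nE: "pd_le R n E"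
    using pd_le_ext[OF E snd snds pd_le_mono[OF pd_le_0_free[OF R] le0]] by blast
  \<comment> \<open>Since \<open>q t = p\<close>, adding \<open>t\<close> of the first block to the
    second block turns the combined map into \<open>q\<close>; this \<open>g\<close> splits
    \<open>shift_block\<close>.\<close>
  obtain t where t: "t \<in> lin_hom R ?Fa ?Fb" "\<And>x. x \<in> carrier ?Fa \<Longrightarrow> q (t x) = p x"
    using free_module_lift[OF left_module_free[OF R] X qh qs ph] by blast
  have shift: "shift_block R a \<in> lin_hom R (ker_module ?Fb X q) E" unfolding E_def
  proof (rule lin_hom_into_ker[OF lin_hom_from_ker[OF bh(4)]])
    fix y assume "y \<in> carrier (ker_module ?Fb X q)"
    then have y: "y \<in> carrier ?Fb" "q y = \<zero>\<^bsub>X\<^esub>" by auto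
    then show "P (shift_block R a y) = \<zero>\<^bsub>X\<^esub>"
      using block_simps(3,4)[OF R y(1), of a] lin_hom_zero[OF left_module_free[OF R] X ph]
      by (simp add: P_def block_map_def)
  qed
  interpret Fb: left_module R ?Fb by (rule left_module_free[OF R])
  define g where "g = (\<lambda>z. snd_block a z \<oplus>\<^bsub>?Fb\<^esub> t (fst_block R a z))"
  have gF: "g \<in> lin_hom R ?F ?Fb"
    unfolding g_def by (rule lin_hom_plus[OF left_module_free[OF R] bh(2) lin_hom_comp[OF bh(1) t(1)]])
  have g: "g \<in> lin_hom R E (ker_module ?Fb X q)" unfolding E_def
  proof (rule lin_hom_into_ker[OF lin_hom_from_ker[OF gF]])
    fix z assume "z \<in> carrier (ker_module ?F X P)"
    then have z: "z \<in> carrier ?F" "P z = \<zero>\<^bsub>X\<^esub>" by auto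
    have z1: "fst_block R a z \<in> carrier ?Fa" and z2: "snd_block a z \<in> carrier ?Fb"
      using lin_hom_closed[OF bh(1) z(1)] lin_hom_closed[OF bh(2) z(1)] by auto
    have "q (g z) = P z" unfolding P_def block_map_def g_def
      using lin_hom_closed[OF t(1) z1] pc[OF z1] qc[OF z2]
      by (simp add: lin_hom_add[OF qh z2] t(2)[OF z1] X.M.a_comm)
    then show "q (g z) = \<zero>\<^bsub>X\<^esub>" using z(2) by simp
  qed
  have gs: "g (shift_block R a y) = y" if y: "y \<in> carrier (ker_module ?Fb X q)" for y
  proof -
    have y: "y \<in> carrier ?Fb" using y by simp
    show ?thesis unfolding g_def
      using block_simps(3,4)[OF R y, of a] lin_hom_zero[OF left_module_free[OF R] left_module_free[OF R] t(1)] y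
      by simp
  qed
  have "retract_of R (ker_module ?Fb X q) E" unfolding retract_of_def
    by (intro bexI[OF _ shift] bexI[OF _ g] ballI gs)
  then show ?thesis by (rule retr[OF nE left_module_ker[OF left_module_free[OF R] X qh]])
qed

text \<open>The kernel of a cover of \<open>Y\<close> need not split along the retract. Doubling the
  cover repairs this: \<open>u\<close> and \<open>v\<close> are the components of \<open>q\<close>
  in \<open>X\<close> and in its complement, and the kernel of the map \<open>P\<close> on the
  doubled module is the sum of their kernels. The first of these is the kernel of the cover
  \<open>w\<close> of \<open>X\<close>.\<close>

lemma pd_le_retract_step:
  fixes R :: "('a, 'c) ring_scheme"
  assumes retr: "\<And>(K :: ('a, nat \<Rightarrow> 'a) module) (E :: ('a, nat \<Rightarrow> 'a) module).
      pd_le R n E \<Longrightarrow> left_module R K \<Longrightarrow> retract_of R K E \<Longrightarrow> pd_le R n K"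
    and Yn: "pd_le R (Suc n) Y" and X: "left_module R X" and XY: "retract_of R X Y"
  shows "pd_le R (Suc n) X"
proof -
  have Y: "left_module R Y" using Yn by (rule pd_le_left_module)
  interpret X: left_module R X by fact
  interpret Y: left_module R Y by fact
  have R: "ring R" by (rule X.R.ring_axioms)
  obtain a q where q: "free_cover R a Y q" "pd_le R n (ker_module (free_module R a) Y q)"
    using Yn by (auto simp: pd_le_Suc)
  obtain i \<pi> where i: "i \<in> lin_hom R X Y" "\<pi> \<in> lin_hom R Y X" "\<forall>x\<in>carrier X. \<pi> (i x) = x"
    using XY by (auto simp: retract_of_def)
  let ?Fa = "free_module R a" and ?F = "free_module R (a + a)"
  have qh: "q \<in> lin_hom R ?Fa Y" and qs: "q ` carrier ?Fa = carrier Y" using q by (auto simp: free_cover_def)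
  note qc = lin_hom_closed[OF qh] and ic = lin_hom_closed[OF i(1)] and pc = lin_hom_closed[OF i(2)]
  define u where "u = (\<lambda>x. i (\<pi> (q x)))"
  define v where "v = (\<lambda>x. q x \<ominus>\<^bsub>Y\<^esub> u x)"
  have u: "u \<in> lin_hom R ?Fa Y" unfolding u_def by (rule lin_hom_comp[OF lin_hom_comp[OF qh i(2)] i(1)])
  have v: "v \<in> lin_hom R ?Fa Y" unfolding v_def by (rule lin_hom_diff[OF Y qh u])
  define P where "P = block_map R a Y u v"
  have P: "P \<in> lin_hom R ?F Y" unfolding P_def by (rule block_map_hom[OF Y u v])
  have "P ` carrier ?F = carrier Y"
  proof (rule surjI)
    fix y assume "y \<in> carrier Y"
    then obtain x where x: "x \<in> carrier ?Fa" "q x = y" using surjE[OF qs] by blast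
    \<comment> \<open>The diagonal vector with both blocks equal to \<open>x\<close> is a preimage
      of \<open>y\<close>.\<close>
    have "u x \<oplus>\<^bsub>Y\<^esub> v x = y"
      using lin_hom_closed[OF u x(1)] qc[OF x(1)] x(2) by (simp add: v_def Y.diff_add_cancel)
    then show "\<exists>z\<in>carrier ?F. P z = y"
      using block_map_pair[OF Y u v x(1) x(1)] unfolding P_def by metis
  qed (rule lin_hom_closed[OF P])
  then have cP: "free_cover R (a + a) Y P" using P by (simp add: free_cover_def)
  have nP: "pd_le R n (ker_module ?F Y P)"
    by (rule pd_le_ker_cover_step[OF _ Y q(1) cP q(2)]) (rule retr)
  define w where "w = (\<lambda>x. \<pi> (q x))"
  have w: "free_cover R a X w" unfolding w_def
  proof (rule free_cover_comp[OF q(1) i(2)])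
    show "\<pi> ` carrier Y = carrier X" by (rule surjI) (use pc ic i(3) in auto)
  qed
  have wh: "w \<in> lin_hom R ?Fa X" using w by (simp add: free_cover_def)
  note bh = block_hom[OF R, of a a]
  have incl: "(\<lambda>x. x) \<in> lin_hom R (ker_module ?Fa X w) (ker_module ?F Y P)"
  proof (rule lin_hom_into_ker[OF lin_hom_from_ker[OF bh(3)]])
    fix x assume "x \<in> carrier (ker_module ?Fa X w)"
    then have x: "x \<in> carrier ?Fa" "w x = \<zero>\<^bsub>X\<^esub>" by auto
    show "P x = \<zero>\<^bsub>Y\<^esub>"
      using block_simps(1,2)[OF R x(1)] x(2) lin_hom_zero[OF X Y i(1)]
        lin_hom_zero[OF left_module_free[OF R] Y v]
      by (simp add: P_def block_map_def u_def w_def)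
  qed
  have retr_map: "fst_block R a \<in> lin_hom R (ker_module ?F Y P) (ker_module ?Fa X w)"
  proof (rule lin_hom_into_ker[OF lin_hom_from_ker[OF bh(1)]])
    fix z assume "z \<in> carrier (ker_module ?F Y P)"
    then have z: "z \<in> carrier ?F" "P z = \<zero>\<^bsub>Y\<^esub>" by auto
    have z1: "fst_block R a z \<in> carrier ?Fa" and z2: "snd_block a z \<in> carrier ?Fa"
      using lin_hom_closed[OF bh(1) z(1)] lin_hom_closed[OF bh(2) z(1)] by auto
    note c = qc[OF z1] qc[OF z2] lin_hom_closed[OF u z1] lin_hom_closed[OF u z2] lin_hom_closed[OF v z2]
    have vu: "\<pi> (v (snd_block a z)) = \<zero>\<^bsub>X\<^esub>"
      unfolding v_def using c pc[OF c(2)] i(3)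
      by (simp add: lin_hom_minus[OF Y X i(2)] u_def X.minus_eq_zero_iff)
    have "\<pi> (P z) = \<pi> (u (fst_block R a z)) \<oplus>\<^bsub>X\<^esub> \<pi> (v (snd_block a z))"
      unfolding P_def block_map_def by (rule lin_hom_add[OF i(2) c(3,5)])
    also have "\<dots> = w (fst_block R a z)"
      using i(3) pc[OF c(1)] vu by (simp add: u_def w_def)
    finally show "w (fst_block R a z) = \<zero>\<^bsub>X\<^esub>" using z(2) lin_hom_zero[OF Y X i(2)] by simp
  qed
  have "retract_of R (ker_module ?Fa X w) (ker_module ?F Y P)" unfolding retract_of_def
    by (intro bexI[OF _ incl] bexI[OF _ retr_map] ballI) (use block_simps(1)[OF R] in auto)
  then have "pd_le R n (ker_module ?Fa X w)"
    by (rule retr[OF nP left_module_ker[OF left_module_free[OF R] X wh]])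
  then show ?thesis using X w by (auto simp: pd_le_Suc)
qed

lemma pd_le_retract_free:
  fixes R :: "('a, 'c) ring_scheme" and X Y :: "('a, nat \<Rightarrow> 'a) module"
  shows "pd_le R n Y \<Longrightarrow> left_module R X \<Longrightarrow> retract_of R X Y \<Longrightarrow> pd_le R n X"
proof (induction n arbitrary: X Y)
  case 0 then show ?case by (rule pd_le_0_retract)
next
  case (Suc n) then show ?case by (rule pd_le_retract_step)
qed

lemma pd_le_retract:
  assumes "pd_le R n Y" "left_module R X" "retract_of R X Y"
  shows "pd_le R n X"
proof (cases n)
  case 0 then show ?thesis using assms pd_le_0_retract by metis
next
  case (Suc m)
  show ?thesis unfolding Suc
    by (rule pd_le_retract_step[OF pd_le_retract_free]) (use assms Suc in auto)
qed

lemma pd_le_ker_cover: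
  assumes X: "pd_le R (Suc n) X" and p: "free_cover R r X p"
  shows "pd_le R n (ker_module (free_module R r) X p)"
proof -
  obtain a q where q: "free_cover R a X q" "pd_le R n (ker_module (free_module R a) X q)"
    using X by (auto simp: pd_le_Suc)
  show ?thesis
    by (rule pd_le_ker_cover_step[OF _ pd_le_left_module[OF X] q(1) p q(2)]) (rule pd_le_retract_free)
qed

text \<open>Dimension shifting along a projective rather than free module. Composing with a free
  cover \<open>p\<close> of \<open>B\<close>, the kernel \<open>W\<close> is an extension of the
  kernel of \<open>f\<close> by the kernel of \<open>p\<close>, and the latter is
  projective.\<close>

lemma pd_le_Suc_if_ker:
  assumes B0: "pd_le R 0 B" and C: "left_module R C" and f: "f \<in> lin_hom R B C"
    and surj: "f ` carrier B = carrier C" and K: "pd_le R n (ker_module B C f)"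
  shows "pd_le R (Suc n) C"
proof -
  have B: "left_module R B" using B0 by (rule pd_le_left_module)
  have R: "ring R" using B by (rule left_module_ring)
  obtain r p where p: "free_cover R r B p" using pd_le_cover[OF B0] by blast
  have fp: "free_cover R r C (\<lambda>x. f (p x))" by (rule free_cover_comp[OF p f surj])
  let ?F = "free_module R r"
  have ph: "p \<in> lin_hom R ?F B" and ps: "p ` carrier ?F = carrier B" using p by (auto simp: free_cover_def)
  define W where "W = ker_module ?F C (\<lambda>x. f (p x))"
  have W: "left_module R W" unfolding W_def
    by (rule left_module_ker[OF left_module_free[OF R] C lin_hom_comp[OF ph f]])
  have pW: "p \<in> lin_hom R W (ker_module B C f)" unfolding W_def
    by (rule lin_hom_into_ker[OF lin_hom_from_ker[OF ph]]) simp
  have pWs: "p ` carrier W = carrier (ker_module B C f)"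
  proof (rule surjI)
    fix y assume y: "y \<in> carrier (ker_module B C f)"
    then obtain x where "x \<in> carrier ?F" "p x = y" using surjE[OF ps, of y] by auto
    then show "\<exists>x\<in>carrier W. p x = y" using y by (auto simp: W_def)
  qed (rule lin_hom_closed[OF pW])
  have "ker_module W (ker_module B C f) p = ker_module ?F B p"
    using lin_hom_zero[OF B C f] by (auto simp: W_def ker_module_def lin_ker_def intro!: arg_cong[where f = "\<lambda>K. ?F\<lparr>carrier := K\<rparr>"])
  then have "pd_le R n (ker_module W (ker_module B C f) p)"
    using pd_le_mono[OF pd_le_ker_cover[OF pd_le_0_Suc[OF B0] p], of n] by simp
  then have "pd_le R n W" by (rule pd_le_ext[OF W pW pWs K])
  then show ?thesis using C fp by (auto simp: pd_le_Suc W_def)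
qed

text \<open>With \<open>B\<close> a retract of a free module, the kernel of \<open>f\<close> is a
  retract of the kernel of the free cover \<open>f q\<close>, to which Schanuel's lemma
  applies.\<close>

lemma pd_le_ker_if_Suc:
  assumes B0: "pd_le R 0 B" and f: "f \<in> lin_hom R B C"
    and surj: "f ` carrier B = carrier C" and Cn: "pd_le R (Suc n) C"
  shows "pd_le R n (ker_module B C f)"
proof -
  have B: "left_module R B" and C: "left_module R C" using B0 Cn by (auto dest: pd_le_left_module)
  obtain r i q where q: "i \<in> lin_hom R B (free_module R r)" "q \<in> lin_hom R (free_module R r) B"
      "\<forall>x\<in>carrier B. q (i x) = x"
    using B0 by (auto simp: pd_le_0 retract_of_def)
  let ?F = "free_module R r"
  have "q ` carrier ?F = carrier B"
    by (rule surjI) (use lin_hom_closed[OF q(2)] lin_hom_closed[OF q(1)] q(3) in auto)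
  then have "free_cover R r C (\<lambda>x. f (q x))"
    using free_cover_comp[OF _ f surj] q(2) by (auto simp: free_cover_def)
  note kn = pd_le_ker_cover[OF Cn this]
  have 1: "i \<in> lin_hom R (ker_module B C f) (ker_module ?F C (\<lambda>x. f (q x)))"
    by (rule lin_hom_into_ker[OF lin_hom_from_ker[OF q(1)]]) (use q(3) in auto)
  have 2: "q \<in> lin_hom R (ker_module ?F C (\<lambda>x. f (q x))) (ker_module B C f)"
    by (rule lin_hom_into_ker[OF lin_hom_from_ker[OF q(2)]]) auto
  have "retract_of R (ker_module B C f) (ker_module ?F C (\<lambda>x. f (q x)))"
    unfolding retract_of_def by (intro bexI[OF _ 1] bexI[OF _ 2] ballI) (use q(3) in auto)
  then show ?thesis by (rule pd_le_retract[OF kn left_module_ker[OF B C f]])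
qed

section \<open>Resolutions and special GLIT algebras\<close>

lemma free_cover_imp_fin_gen:
  assumes X: "left_module R X" and p: "free_cover R r X p"
  shows "fin_gen R X"
proof -
  interpret X: left_module R X by fact
  have R: "ring R" by (rule X.R.ring_axioms)
  have ph: "p \<in> lin_hom R (free_module R r) X" and ps: "p ` carrier (free_module R r) = carrier X"
    using p by (auto simp: free_cover_def)
  define v where "v i = p (unit_vec R i)" for i
  have v: "v i \<in> carrier X" if "i < r" for i
    unfolding v_def by (rule lin_hom_closed[OF ph unit_vec_closed[OF R that]])
  define S where "S = v ` {..<r}"
  have S: "finite S" "S \<subseteq> carrier X" using v by (auto simp: S_def)
  \<comment> \<open>\<open>fin_gen\<close> sums over a set, in which equal generators collapse, so
    the coefficients of a combination cannot be copied. Instead the set \<open>Z\<close> of all such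
    sums is shown to contain the multiples of each \<open>v i\<close> and to be closed under
    addition.\<close>
  define Z where "Z = {(\<Oplus>\<^bsub>X\<^esub>s\<in>S. c s \<odot>\<^bsub>X\<^esub> s) | c. c \<in> S \<rightarrow> carrier R}"
  have fs: "(\<lambda>s. c s \<odot>\<^bsub>X\<^esub> s) \<in> S \<rightarrow> carrier X" if "c \<in> S \<rightarrow> carrier R" for c
    using that S by (auto simp: Pi_iff)
  have Zadd: "x \<oplus>\<^bsub>X\<^esub> y \<in> Z" if xy: "x \<in> Z" "y \<in> Z" for x y
  proof -
    obtain c d where c: "x = (\<Oplus>\<^bsub>X\<^esub>s\<in>S. c s \<odot>\<^bsub>X\<^esub> s)" "c \<in> S \<rightarrow> carrier R"
      and d: "y = (\<Oplus>\<^bsub>X\<^esub>s\<in>S. d s \<odot>\<^bsub>X\<^esub> s)" "d \<in> S \<rightarrow> carrier R" using xy by (auto simp: Z_def)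
    have "x \<oplus>\<^bsub>X\<^esub> y = (\<Oplus>\<^bsub>X\<^esub>s\<in>S. c s \<odot>\<^bsub>X\<^esub> s \<oplus>\<^bsub>X\<^esub> d s \<odot>\<^bsub>X\<^esub> s)"
      unfolding c d by (rule X.M.finsum_addf[symmetric]) (use fs c d in auto)
    also have "\<dots> = (\<Oplus>\<^bsub>X\<^esub>s\<in>S. (c s \<oplus>\<^bsub>R\<^esub> d s) \<odot>\<^bsub>X\<^esub> s)"
      by (rule X.M.finsum_cong') (use c d S in \<open>auto simp: X.smult_l_distr Pi_iff\<close>)
    finally show ?thesis unfolding Z_def using c d by (auto simp: Pi_iff)
  qed
  have Zgen: "a \<odot>\<^bsub>X\<^esub> v i \<in> Z" if a: "a \<in> carrier R" and i: "i < r" for a i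
  proof -
    have "(\<Oplus>\<^bsub>X\<^esub>s\<in>S. (if v i = s then a \<odot>\<^bsub>X\<^esub> s else \<zero>\<^bsub>X\<^esub>)) = a \<odot>\<^bsub>X\<^esub> v i"
      by (rule X.M.add.finprod_singleton) (use i S a in \<open>auto simp: S_def Pi_iff\<close>)
    moreover have "(\<Oplus>\<^bsub>X\<^esub>s\<in>S. (if v i = s then a \<odot>\<^bsub>X\<^esub> s else \<zero>\<^bsub>X\<^esub>)) =
        (\<Oplus>\<^bsub>X\<^esub>s\<in>S. (if v i = s then a else \<zero>\<^bsub>R\<^esub>) \<odot>\<^bsub>X\<^esub> s)"
      by (rule X.M.finsum_cong') (use a S in auto)
    ultimately have "a \<odot>\<^bsub>X\<^esub> v i = (\<Oplus>\<^bsub>X\<^esub>s\<in>S. (if v i = s then a else \<zero>\<^bsub>R\<^esub>) \<odot>\<^bsub>X\<^esub> s)" by simp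
    moreover have "(\<lambda>s. if v i = s then a else \<zero>\<^bsub>R\<^esub>) \<in> S \<rightarrow> carrier R" using a by auto
    ultimately show ?thesis unfolding Z_def
      by (intro CollectI exI[of _ "\<lambda>s. if v i = s then a else \<zero>\<^bsub>R\<^esub>"] conjI)
  qed
  have "(\<Oplus>\<^bsub>X\<^esub>s\<in>S. \<zero>\<^bsub>R\<^esub> \<odot>\<^bsub>X\<^esub> s) = (\<Oplus>\<^bsub>X\<^esub>s\<in>S. \<zero>\<^bsub>X\<^esub>)"
    by (rule X.M.finsum_cong') (use S in auto)
  then have Z0: "\<zero>\<^bsub>X\<^esub> \<in> Z" unfolding Z_def by (auto intro!: exI[of _ "\<lambda>_. \<zero>\<^bsub>R\<^esub>"])
  have comb: "lin_comb X k c v \<in> Z" if "k \<le> r" "\<And>i. i < r \<Longrightarrow> c i \<in> carrier R" for k c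
    using that by (induction k) (simp_all add: Z0 Zadd Zgen)
  have "x \<in> Z" if x: "x \<in> carrier X" for x
  proof -
    obtain c where c: "c \<in> carrier (free_module R r)" "p c = x" using surjE[OF ps x] by blast
    have "p c = lin_comb X r c v" unfolding v_def by (rule free_module_hom_eq[OF X ph c(1)])
    then show ?thesis using comb[of r c] c by (auto simp: free_module_simps)
  qed
  then show ?thesis unfolding fin_gen_def Z_def using S by (intro exI[of _ S]) blast
qed

lemma fin_gen_imp_free_cover:
  assumes X: "left_module R X" and fg: "fin_gen R X"
  obtains r p where "free_cover R r X p"
proof -
  interpret X: left_module R X by fact
  obtain S where S: "finite S" "S \<subseteq> carrier X"
    "\<And>x. x \<in> carrier X \<Longrightarrow> \<exists>c\<in>S \<rightarrow> carrier R. x = (\<Oplus>\<^bsub>X\<^esub>s\<in>S. c s \<odot>\<^bsub>X\<^esub> s)"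
    using fg unfolding fin_gen_def by blast
  obtain r v where v: "S = v ` {i::nat. i < r}" using finite_imp_nat_seg_image_inj_on[OF S(1)] by metis
  have vX: "\<And>i. i < r \<Longrightarrow> v i \<in> carrier X" using S(2) v by auto
  define p where "p = (\<lambda>c. lin_comb X r c v)"
  have ph: "p \<in> lin_hom R (free_module R r) X" unfolding p_def by (rule X.lin_comb_lin_hom[OF vX])
  interpret F: left_module R "free_module R r" by (rule left_module_free) (rule X.R.ring_axioms)
  let ?I = "p ` carrier (free_module R r)"
  have add: "x \<oplus>\<^bsub>X\<^esub> y \<in> ?I" if "x \<in> ?I" "y \<in> ?I" for x y
  proof -
    obtain c d where "c \<in> carrier (free_module R r)" "d \<in> carrier (free_module R r)" "x = p c" "y = p d"
      using \<open>x \<in> ?I\<close> \<open>y \<in> ?I\<close> by blast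
    then show ?thesis using lin_hom_add[OF ph, of c d] F.M.a_closed[of c d] by (metis imageI)
  qed
  have gen: "a \<odot>\<^bsub>X\<^esub> s \<in> ?I" if a: "a \<in> carrier R" and "s \<in> S" for a s
  proof -
    obtain i where i: "i < r" "s = v i" using \<open>s \<in> S\<close> v by auto
    have u: "unit_vec R i \<in> carrier (free_module R r)" by (rule unit_vec_closed[OF X.R.ring_axioms i(1)])
    have "p (unit_vec R i) = s" unfolding p_def using X.lin_comb_unit[of r v i] vX i by simp
    then have "p (a \<odot>\<^bsub>free_module R r\<^esub> unit_vec R i) = a \<odot>\<^bsub>X\<^esub> s" using lin_hom_smult[OF ph a u] by simp
    then show ?thesis using F.smult_closed[OF a u] by (metis imageI)
  qed
  have zero: "\<zero>\<^bsub>X\<^esub> \<in> ?I"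
    using lin_hom_zero[OF F.left_module_axioms X ph] F.M.zero_closed by (metis imageI)
  have span: "(\<Oplus>\<^bsub>X\<^esub>s\<in>S'. c s \<odot>\<^bsub>X\<^esub> s) \<in> ?I" if "finite S'" "S' \<subseteq> S" "c \<in> S \<rightarrow> carrier R" for S' c
    using that
  proof (induction S')
    case (insert s S')
    have "(\<Oplus>\<^bsub>X\<^esub>s\<in>insert s S'. c s \<odot>\<^bsub>X\<^esub> s) = c s \<odot>\<^bsub>X\<^esub> s \<oplus>\<^bsub>X\<^esub> (\<Oplus>\<^bsub>X\<^esub>s\<in>S'. c s \<odot>\<^bsub>X\<^esub> s)"
      by (rule X.M.finsum_insert) (use insert S(2) in \<open>auto simp: Pi_iff subset_iff\<close>)
    then show ?case using add gen insert by (auto simp: Pi_iff)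
  qed (use zero in simp)
  have "?I = carrier X"
  proof (rule surjI)
    fix x assume "x \<in> carrier X"
    then obtain c where c: "c \<in> S \<rightarrow> carrier R" "x = (\<Oplus>\<^bsub>X\<^esub>s\<in>S. c s \<odot>\<^bsub>X\<^esub> s)" using S(3) by blast
    then have "x \<in> ?I" using span[OF S(1) subset_refl c(1)] by simp
    then show "\<exists>c\<in>carrier (free_module R r). p c = x" by auto
  qed (rule lin_hom_closed[OF ph])
  then show ?thesis using that[of r p] ph by (simp add: free_cover_def)
qed

section \<open>Copies of modules on the standard carrier type\<close>

definition transport_module ::
  "('a, 'b, 'd) module_scheme \<Rightarrow> ('b \<Rightarrow> 'e) \<Rightarrow> ('e \<Rightarrow> 'b) \<Rightarrow> ('a, 'e) module" where
  "transport_module X f g =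
     \<lparr>carrier = f ` carrier X, mult = (\<lambda>x y. x), one = f \<zero>\<^bsub>X\<^esub>, ring.zero = f \<zero>\<^bsub>X\<^esub>,
      add = (\<lambda>x y. f (g x \<oplus>\<^bsub>X\<^esub> g y)), smult = (\<lambda>a x. f (a \<odot>\<^bsub>X\<^esub> g x))\<rparr>"

lemma transport_module:
  assumes X: "left_module R X" and gf: "\<And>x. x \<in> carrier X \<Longrightarrow> g (f x) = x"
  shows "left_module R (transport_module X f g)" "lin_iso R X (transport_module X f g) f g"
proof -
  interpret X: left_module R X by fact
  have inv: "\<exists>y\<in>f ` carrier X. f (g y \<oplus>\<^bsub>X\<^esub> g x) = f \<zero>\<^bsub>X\<^esub>" if "x \<in> f ` carrier X" for x
    using that by (auto simp: gf X.M.l_neg intro!: bexI[of _ "\<ominus>\<^bsub>X\<^esub> (g x)"])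
  show "left_module R (transport_module X f g)"
    by (rule left_moduleI)
      (use inv in \<open>auto simp: transport_module_def gf X.M.a_ac X.smult_l_distr X.smult_r_distr
        X.smult_assoc X.R.ring_axioms\<close>)
  show "lin_iso R X (transport_module X f g) f g"
    by (auto simp: lin_iso_def lin_hom_def transport_module_def gf)
qed

text \<open>An element is encoded by its fibre under the cover, a coset of the kernel and hence a
  set of vectors.\<close>

lemma std_copy:
  assumes X: "left_module R X" and p: "free_cover R r X p"
  obtains Y :: "'a std_module" and f g where "left_module (R :: ('a, 'c) ring_scheme) Y" "lin_iso R X Y f g"
proof -
  define f where "f x = {c \<in> carrier (free_module R r). p c = x}" for x
  define g where "g A = p (SOME c. c \<in> A)" for A
  have "g (f x) = x" if x: "x \<in> carrier X" for x
  proof -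
    have "x \<in> p ` carrier (free_module R r)" using p x by (simp add: free_cover_def)
    then have "\<exists>c. c \<in> f x" unfolding f_def by auto
    then have "(SOME c. c \<in> f x) \<in> f x" by (rule someI_ex)
    then show ?thesis by (simp add: g_def f_def)
  qed
  then show ?thesis using that transport_module[OF X] by metis
qed

lemma std_free:
  assumes R: "ring R"
  obtains F :: "'a std_module" and f g where
    "left_module (R :: ('a, 'c) ring_scheme) F" "lin_iso R (free_module R r) F f g"
proof -
  have "left_module R (transport_module (free_module R r) (\<lambda>x. {x}) the_elem)"
    "lin_iso R (free_module R r) (transport_module (free_module R r) (\<lambda>x. {x}) the_elem) (\<lambda>x. {x}) the_elem"
    by (rule transport_module[OF left_module_free[OF R]], simp)+
  then show ?thesis by (rule that)
qed

lemma lin_iso_surj: "lin_iso R X Y f g \<Longrightarrow> f ` carrier X = carrier Y"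
  by (rule surjI) (auto simp: lin_iso_def lin_hom_def intro!: bexI[of _ "g _"])

text \<open>\<open>projective_module\<close> tests only modules of the standard type. The free cover
  of \<open>P\<close> is therefore transported to a surjection between standard copies
  \<open>A\<close> and \<open>B\<close>, and the isomorphism \<open>b\<close> onto the copy of
  \<open>P\<close> is lifted in place of the identity.\<close>

lemma projective_fg_imp_pd_le_0:
  assumes P: "projective_module R P" and fg: "fin_gen R P"
  shows "pd_le R 0 P"
proof -
  have L: "left_module R P" using P by (simp add: projective_module_def)
  have R: "ring R" using L by (rule left_module_ring)
  obtain r p where p: "free_cover R r P p" using fin_gen_imp_free_cover[OF L fg] by blast
  have ph: "p \<in> lin_hom R (free_module R r) P" and ps: "p ` carrier (free_module R r) = carrier P"
    using p by (auto simp: free_cover_def)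
  obtain B :: "'a std_module" and b b' where B: "left_module R B" "lin_iso R P B b b'"
    using std_copy[OF L p] by blast
  obtain A :: "'a std_module" and a a' where A: "left_module R A" "lin_iso R (free_module R r) A a a'"
    using std_free[OF R] by blast
  have b: "b \<in> lin_hom R P B" "b' \<in> lin_hom R B P" "\<forall>x\<in>carrier P. b' (b x) = x"
    using B(2) by (auto simp: lin_iso_def)
  have a: "a' \<in> lin_hom R A (free_module R r)" using A(2) by (auto simp: lin_iso_def)
  have f: "(\<lambda>x. b (p (a' x))) \<in> lin_hom R A B" by (rule lin_hom_comp[OF lin_hom_comp[OF a ph] b(1)])
  have "(\<lambda>x. b (p (a' x))) ` carrier A = b ` p ` a' ` carrier A" by (simp add: image_image)
  also have "\<dots> = carrier B"
    using lin_iso_surj[OF lin_iso_sym[OF A(2)]] lin_iso_surj[OF B(2)] ps by simp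
  finally have surj: "(\<lambda>x. b (p (a' x))) ` carrier A = carrier B" .
  obtain h where h: "h \<in> lin_hom R P A" "\<forall>x\<in>carrier P. b (p (a' (h x))) = b x"
    using P A(1) B(1) f surj b(1) unfolding projective_module_def by blast
  have "p (a' (h x)) = x" if x: "x \<in> carrier P" for x
    using h(2) b(3) x lin_hom_closed[OF ph lin_hom_closed[OF a lin_hom_closed[OF h(1) x]]] by metis
  then have "retract_of R P (free_module R r)"
    unfolding retract_of_def by (intro bexI[OF _ lin_hom_comp[OF h(1) a]] bexI[OF _ ph]) auto
  then show ?thesis using L by (auto simp: pd_le_0)
qed

lemma pd_le_0_imp_projective: assumes P: "pd_le R 0 P" shows "projective_module R P"
  unfolding projective_module_def
proof (intro conjI allI impI)
  show "left_module R P" using P by (rule pd_le_left_module)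
  fix A B :: "'a std_module" and f g
  assume "left_module R A \<and> left_module R B \<and> f \<in> lin_hom R A B \<and> f ` carrier A = carrier B \<and> g \<in> lin_hom R P B"
  then show "\<exists>h\<in>lin_hom R P A. \<forall>x\<in>carrier P. f (h x) = g x" using pd_le_0_lift[OF P, of A B f g] by metis
qed

lemma pd_le_fg: "pd_le R n X \<Longrightarrow> fin_gen R X"
  using pd_le_cover free_cover_imp_fin_gen pd_le_left_module by metis

section \<open>Projective resolutions and bounds by free covers\<close>

lemma bij_lin_iso:
  assumes X: "left_module R X" and f: "f \<in> lin_hom R X Y" "f ` carrier X = carrier Y" "inj_on f (carrier X)"
  shows "lin_iso R X Y f (inv_into (carrier X) f)"
proof -
  interpret X: left_module R X by fact
  let ?g = "inv_into (carrier X) f"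
  have fg: "?g y \<in> carrier X" "f (?g y) = y" if "y \<in> carrier Y" for y
    using that f(2) by (auto simp: inv_into_into f_inv_into_f)
  have gf: "?g (f x) = x" if "x \<in> carrier X" for x using that f(3) by simp
  have "?g \<in> lin_hom R Y X"
  proof (rule lin_homI)
    fix x y assume "x \<in> carrier Y" "y \<in> carrier Y"
    then show "?g (x \<oplus>\<^bsub>Y\<^esub> y) = ?g x \<oplus>\<^bsub>X\<^esub> ?g y"
      using gf[of "?g x \<oplus>\<^bsub>X\<^esub> ?g y"] lin_hom_add[OF f(1), of "?g x" "?g y"] fg by simp
  next
    fix a y assume "a \<in> carrier R" "y \<in> carrier Y"
    then show "?g (a \<odot>\<^bsub>Y\<^esub> y) = a \<odot>\<^bsub>X\<^esub> ?g y"
      using gf[of "a \<odot>\<^bsub>X\<^esub> ?g y"] lin_hom_smult[OF f(1), of a "?g y"] fg by simp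
  qed (rule fg)
  then show ?thesis using f(1) fg gf by (auto simp: lin_iso_def)
qed

text \<open>Peels off \<open>P 0\<close>: the rest of the resolution resolves the kernel of
  \<open>d 0\<close>, and this kernel keeps the standard type because only the carrier of
  \<open>P 0\<close> shrinks.\<close>

lemma resolution_imp_pd_le:
  "left_module R X \<Longrightarrow> projective_resolution R X n P d \<Longrightarrow> pd_le R n X"
proof (induction n arbitrary: X P d)
  case 0
  then have P0: "P 0 \<in> fg_modules R" "projective_module R (P 0)" and d: "d 0 \<in> lin_hom R (P 0) X"
    "d 0 ` carrier (P 0) = carrier X" "inj_on (d 0) (carrier (P 0))"
    by (auto simp: projective_resolution_def)
  have "pd_le R 0 (P 0)" using P0 by (auto simp: fg_modules_def intro: projective_fg_imp_pd_le_0)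
  then show ?case using pd_le_iso[OF _ 0(1) bij_lin_iso[OF _ d]] pd_le_left_module by blast
next
  case (Suc n)
  have P0: "P 0 \<in> fg_modules R" "projective_module R (P 0)" and d: "d 0 \<in> lin_hom R (P 0) X"
    "d 0 ` carrier (P 0) = carrier X"
    using Suc.prems(2) by (auto simp: projective_resolution_def)
  have pd0: "pd_le R 0 (P 0)" using P0 by (auto simp: fg_modules_def intro: projective_fg_imp_pd_le_0)
  define K where "K = ker_module (P 0) X (d 0)"
  have K: "left_module R K" unfolding K_def by (rule left_module_ker[OF pd_le_left_module[OF pd0] Suc.prems(1) d(1)])
  have P: "\<And>i. i \<le> Suc n \<Longrightarrow> P i \<in> fg_modules R \<and> projective_module R (P i)"
    and dh: "\<And>i. i \<le> Suc n \<Longrightarrow> d i \<in> lin_hom R (P i) (case i of 0 \<Rightarrow> X | Suc j \<Rightarrow> P j)"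
    and ex: "\<And>i. i < Suc n \<Longrightarrow> d (Suc i) ` carrier (P (Suc i)) =
              lin_ker (P i) (case i of 0 \<Rightarrow> X | Suc j \<Rightarrow> P j) (d i)"
    and inj: "inj_on (d (Suc n)) (carrier (P (Suc n)))"
    using Suc.prems(2) by (auto simp: projective_resolution_def)
  have d1s: "d (Suc 0) ` carrier (P (Suc 0)) = carrier K"
    using ex[of 0] by (simp add: K_def ker_module_def)
  have d1: "d (Suc 0) \<in> lin_hom R (P (Suc 0)) K" unfolding K_def
    using dh[of "Suc 0"] d1s by (intro lin_hom_into_ker) (auto simp: K_def)
  have "projective_resolution R K n (\<lambda>i. P (Suc i)) (\<lambda>i. d (Suc i))"
    unfolding projective_resolution_def
  proof (intro conjI allI impI)
    fix i assume "i \<le> n"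
    then show "P (Suc i) \<in> fg_modules R" "projective_module R (P (Suc i))" using P by auto
    show "d (Suc i) \<in> lin_hom R (P (Suc i)) (case i of 0 \<Rightarrow> K | Suc j \<Rightarrow> P (Suc j))"
      using dh[of "Suc i"] d1 \<open>i \<le> n\<close> by (cases i) auto
  next
    show "d (Suc 0) ` carrier (P (Suc 0)) = carrier K" by (rule d1s)
    show "inj_on (d (Suc n)) (carrier (P (Suc n)))" by (rule inj)
    fix i assume "i < n"
    then show "d (Suc (Suc i)) ` carrier (P (Suc (Suc i))) =
         lin_ker (P (Suc i)) (case i of 0 \<Rightarrow> K | Suc j \<Rightarrow> P (Suc j)) (d (Suc i))"
      using ex[of "Suc i"] by (cases i) (auto simp: K_def lin_ker_def)
  qed
  from Suc.IH[OF K this] have "pd_le R n (ker_module (P 0) X (d 0))" by (simp add: K_def)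
  then show ?case by (rule pd_le_Suc_if_ker[OF pd0 Suc.prems(1) d])
qed

text \<open>All terms of a resolution must have the standard type, unlike the kernels in
  \<open>pd_le\<close>. The free cover is replaced by its copy \<open>F\<close>, so that the kernel
  \<open>K\<close> is again a standard module and the induction continues.\<close>

lemma pd_le_imp_resolution:
  fixes R :: "('a, 'c) ring_scheme" and X :: "'a std_module"
  shows "pd_le R n X \<Longrightarrow> \<exists>P d. projective_resolution R X n P d"
proof (induction n arbitrary: X)
  case 0
  have "projective_resolution R X 0 (\<lambda>_. X) (\<lambda>_ x. x)"
    using 0 pd_le_left_module[OF 0] pd_le_fg[OF 0] pd_le_0_imp_projective[OF 0] lin_hom_id[of R X]
    by (auto simp: projective_resolution_def fg_modules_def)
  then show ?case by blast
next
  case (Suc n)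
  have X: "left_module R X" using Suc.prems by (rule pd_le_left_module)
  have R: "ring R" using X by (rule left_module_ring)
  obtain r p where p: "free_cover R r X p" "pd_le R n (ker_module (free_module R r) X p)"
    using Suc.prems by (auto simp: pd_le_Suc)
  obtain F :: "'a std_module" and f g where F: "left_module R F" "lin_iso R (free_module R r) F f g"
    using std_free[OF R] by blast
  have F0: "pd_le R 0 F" by (rule pd_le_iso[OF pd_le_0_free[OF R] F])
  have ph: "p \<in> lin_hom R (free_module R r) X" and ps: "p ` carrier (free_module R r) = carrier X"
    using p by (auto simp: free_cover_def)
  have fh: "f \<in> lin_hom R (free_module R r) F" and gh: "g \<in> lin_hom R F (free_module R r)"
    and gf: "\<forall>x\<in>carrier (free_module R r). g (f x) = x" and fg: "\<forall>x\<in>carrier F. f (g x) = x"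
    using F(2) by (auto simp: lin_iso_def)
  define e where "e = (\<lambda>x. p (g x))"
  have e: "e \<in> lin_hom R F X" unfolding e_def by (rule lin_hom_comp[OF gh ph])
  have "e ` carrier F = p ` g ` carrier F" by (simp add: e_def image_image)
  then have es: "e ` carrier F = carrier X" using lin_iso_surj[OF lin_iso_sym[OF F(2)]] ps by simp
  define K where "K = ker_module F X e"
  have "lin_iso R (ker_module (free_module R r) X p) K f g" unfolding lin_iso_def K_def
    using gf fg lin_hom_closed[OF fh] lin_hom_closed[OF gh]
    by (intro conjI lin_hom_into_ker lin_hom_from_ker fh gh) (auto simp: e_def)
  then have "pd_le R n K" using pd_le_iso[OF p(2)] left_module_ker[OF F(1) X e] by (simp add: K_def)
  then obtain P d where res: "projective_resolution R K n P d" using Suc.IH by blast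
  have P: "\<And>i. i \<le> n \<Longrightarrow> P i \<in> fg_modules R \<and> projective_module R (P i)"
    and dh: "\<And>i. i \<le> n \<Longrightarrow> d i \<in> lin_hom R (P i) (case i of 0 \<Rightarrow> K | Suc j \<Rightarrow> P j)"
    and d0: "d 0 ` carrier (P 0) = carrier K"
    and ex: "\<And>i. i < n \<Longrightarrow> d (Suc i) ` carrier (P (Suc i)) =
              lin_ker (P i) (case i of 0 \<Rightarrow> K | Suc j \<Rightarrow> P j) (d i)"
    and inj: "inj_on (d n) (carrier (P n))"
    using res by (auto simp: projective_resolution_def)
  have "projective_resolution R X (Suc n) (case_nat F P) (case_nat e d)"
    unfolding projective_resolution_def
  proof (intro conjI allI impI)
    fix i assume i: "i \<le> Suc n"
    show "case_nat F P i \<in> fg_modules R" "projective_module R (case_nat F P i)"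
      using P[of "i - 1"] i F(1) pd_le_fg[OF F0] pd_le_0_imp_projective[OF F0]
      by (cases i; simp add: fg_modules_def)+
    show "case_nat e d i \<in> lin_hom R (case_nat F P i) (case i of 0 \<Rightarrow> X | Suc j \<Rightarrow> case_nat F P j)"
    proof (cases i)
      case (Suc j)
      \<comment> \<open>The augmentation of the resolution of \<open>K\<close> becomes a
        differential into \<open>F\<close>; the later differentials keep their targets.\<close>
      have "d j \<in> lin_hom R (P j) (case_nat F P j)"
        using dh[of j] Suc i lin_hom_ker_incl[of "d 0" R "P 0" F X e] by (cases j) (auto simp: K_def)
      then show ?thesis using Suc by simp
    qed (use e in simp)
  next
    show "case_nat e d 0 ` carrier (case_nat F P 0) = carrier X" using es by simp
    show "inj_on (case_nat e d (Suc n)) (carrier (case_nat F P (Suc n)))" using inj by simp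
    fix i assume "i < Suc n"
    then show "case_nat e d (Suc i) ` carrier (case_nat F P (Suc i)) =
         lin_ker (case_nat F P i) (case i of 0 \<Rightarrow> X | Suc j \<Rightarrow> case_nat F P j) (case_nat e d i)"
      using d0 ex[of "i - 1"] by (cases i; cases "i - 1"; simp add: K_def lin_ker_def)
  qed
  then show ?case by blast
qed

lemma proj_dim_le_iff:
  assumes X: "X \<in> fg_modules R" shows "proj_dim R X \<le> enat n \<longleftrightarrow> pd_le R n X"
proof -
  have L: "left_module R X" using X by (simp add: fg_modules_def)
  define S where "S = {enat n | n. \<exists>P d. projective_resolution R X n P d}"
  have S: "S = {enat n | n. pd_le R n X}"
    unfolding S_def using resolution_imp_pd_le[OF L] pd_le_imp_resolution by blast
  have pd: "proj_dim R X = Inf S" by (simp add: proj_dim_def S_def)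
  show ?thesis
  proof
    assume le: "proj_dim R X \<le> enat n"
    then have "S \<noteq> {}" using pd by (auto simp: Inf_enat_def)
    \<comment> \<open>The infimum of a nonempty set of extended naturals is attained, so a finite
      dimension comes from an actual resolution.\<close>
    then have "Inf S \<in> S" by (metis Inf_enat_def LeastI ex_in_conv)
    then obtain m where "proj_dim R X = enat m" "pd_le R m X" using pd S by auto
    then show "pd_le R n X" using le pd_le_mono by (metis enat_ord_simps(1))
  next
    assume "pd_le R n X"
    then show "proj_dim R X \<le> enat n" unfolding pd by (intro Inf_lower) (auto simp: S)
  qed
qed

text \<open>\<open>pd_le R n X\<close> for some \<open>n\<close> says that \<open>X\<close> is
  finitely generated of finite projective dimension, so finiteness of the supremum is the existence
  of a uniform bound.\<close>

lemma special_GLIT_iff: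
  fixes R :: "('a, 'c) ring_scheme"
  shows "special_GLIT R \<longleftrightarrow> (\<exists>d. \<forall>n (X :: 'a std_module). pd_le R n X \<longrightarrow> pd_le R d X)"
proof
  assume "special_GLIT R"
  then obtain d where d: "fin_dim R (fg_modules R) = enat d" unfolding special_GLIT_def by auto
  have "pd_le R d X" if X: "pd_le R n X" for n and X :: "'a std_module"
  proof -
    have fg: "X \<in> fg_modules R" using X by (simp add: fg_modules_def pd_le_left_module pd_le_fg)
    have le: "proj_dim R X \<le> enat n" using proj_dim_le_iff[OF fg] X by simp
    then have "proj_dim R X < \<infinity>" by (metis enat_ord_code(4) order_le_less_trans)
    then have "proj_dim R X \<le> fin_dim R (fg_modules R)" unfolding fin_dim_def using fg by (intro Sup_upper) auto
    then show ?thesis using d proj_dim_le_iff[OF fg] by simp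
  qed
  then show "\<exists>d. \<forall>n (X :: 'a std_module). pd_le R n X \<longrightarrow> pd_le R d X" by blast
next
  assume "\<exists>d. \<forall>n (X :: 'a std_module). pd_le R n X \<longrightarrow> pd_le R d X"
  then obtain d where d: "\<And>n (X :: 'a std_module). pd_le R n X \<Longrightarrow> pd_le R d X" by blast
  have "fin_dim R (fg_modules R) \<le> enat d" unfolding fin_dim_def
  proof (rule Sup_least)
    fix x assume "x \<in> {proj_dim R X | X. X \<in> fg_modules R \<and> proj_dim R X < \<infinity>}"
    then obtain X where X: "x = proj_dim R X" "X \<in> fg_modules R" "proj_dim R X < \<infinity>" by auto
    then obtain n where "proj_dim R X = enat n" by auto
    then have "pd_le R n X" using proj_dim_le_iff[OF X(2), of n] by simp
    then show "x \<le> enat d" using d proj_dim_le_iff[OF X(2)] X(1) by blast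
  qed
  then show "special_GLIT R" unfolding special_GLIT_def by (metis enat_ord_code(4) order_le_less_trans)
qed

text \<open>Frees the uniform bound from the standard type by means of standard copies. Changing
  scalars keeps the carrier, so modules over one ring appear on the carrier type attached to
  another.\<close>

lemma special_GLIT_bound:
  fixes R :: "('a, 'c) ring_scheme"
  assumes "special_GLIT R"
  obtains d where "\<And>n (X :: ('a, 'b) module). pd_le R n X \<Longrightarrow> pd_le R d X"
proof -
  obtain d where d: "\<And>n (X :: 'a std_module). pd_le R n X \<Longrightarrow> pd_le R d X"
    using assms by (auto simp: special_GLIT_iff)
  have "pd_le R d X" if X: "pd_le R n X" for n and X :: "('a, 'b) module"
  proof -
    have L: "left_module R X" using X by (rule pd_le_left_module)
    obtain r p where p: "free_cover R r X p" using pd_le_cover[OF X] by blast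
    obtain Y :: "'a std_module" and f g where Y: "left_module R Y" "lin_iso R X Y f g"
      using std_copy[OF L p] by blast
    have "pd_le R d Y" using d pd_le_iso[OF X Y] by blast
    then show ?thesis using pd_le_iso[OF _ L lin_iso_sym[OF Y(2)]] by blast
  qed
  then show ?thesis using that by blast
qed

section \<open>Restriction of scalars\<close>

text \<open>
  The unit need not be preserved, so that inclusions of direct factors are covered. Restriction along
  \<open>i\<close> therefore keeps only the elements on which \<open>i 1\<close> acts as the identity.
\<close>

definition rng_hom :: "('r, 'c) ring_scheme \<Rightarrow> ('l, 'd) ring_scheme \<Rightarrow> ('r \<Rightarrow> 'l) set" where
  "rng_hom R L = {i \<in> carrier R \<rightarrow> carrier L.
     (\<forall>x\<in>carrier R. \<forall>y\<in>carrier R. i (x \<oplus>\<^bsub>R\<^esub> y) = i x \<oplus>\<^bsub>L\<^esub> i y \<and> i (x \<otimes>\<^bsub>R\<^esub> y) = i x \<otimes>\<^bsub>L\<^esub> i y)}"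

lemma rng_hom_closed: "i \<in> rng_hom R L \<Longrightarrow> x \<in> carrier R \<Longrightarrow> i x \<in> carrier L"
  and rng_hom_add: "i \<in> rng_hom R L \<Longrightarrow> x \<in> carrier R \<Longrightarrow> y \<in> carrier R \<Longrightarrow> i (x \<oplus>\<^bsub>R\<^esub> y) = i x \<oplus>\<^bsub>L\<^esub> i y"
  and rng_hom_mult: "i \<in> rng_hom R L \<Longrightarrow> x \<in> carrier R \<Longrightarrow> y \<in> carrier R \<Longrightarrow> i (x \<otimes>\<^bsub>R\<^esub> y) = i x \<otimes>\<^bsub>L\<^esub> i y"
  by (auto simp: rng_hom_def)

definition restrict_scalars ::
  "('r, 'c) ring_scheme \<Rightarrow> ('r \<Rightarrow> 'l) \<Rightarrow> ('l, 'b, 'd) module_scheme \<Rightarrow> ('r, 'b) module" where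
  "restrict_scalars R i X =
     \<lparr>carrier = {x \<in> carrier X. i \<one>\<^bsub>R\<^esub> \<odot>\<^bsub>X\<^esub> x = x}, mult = (\<lambda>x y. x), one = \<zero>\<^bsub>X\<^esub>,
      ring.zero = \<zero>\<^bsub>X\<^esub>, add = add X, smult = (\<lambda>r x. i r \<odot>\<^bsub>X\<^esub> x)\<rparr>"

lemma restrict_scalars_simps [simp]:
  "carrier (restrict_scalars R i X) = {x \<in> carrier X. i \<one>\<^bsub>R\<^esub> \<odot>\<^bsub>X\<^esub> x = x}"
  "add (restrict_scalars R i X) = add X"
  "\<zero>\<^bsub>restrict_scalars R i X\<^esub> = \<zero>\<^bsub>X\<^esub>"
  "smult (restrict_scalars R i X) = (\<lambda>r x. i r \<odot>\<^bsub>X\<^esub> x)"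
  by (auto simp: restrict_scalars_def)

lemma left_module_restrict:
  assumes R: "ring R" and i: "i \<in> rng_hom R L" and X: "left_module L X"
  shows "left_module R (restrict_scalars R i X)"
proof -
  interpret R: ring R by fact
  interpret X: left_module L X by fact
  note ic = rng_hom_closed[OF i]
  have i1: "i r \<otimes>\<^bsub>L\<^esub> i \<one>\<^bsub>R\<^esub> = i r" "i \<one>\<^bsub>R\<^esub> \<otimes>\<^bsub>L\<^esub> i r = i r" if "r \<in> carrier R" for r
    using rng_hom_mult[OF i that R.one_closed] rng_hom_mult[OF i R.one_closed that] that by auto
  have inv: "\<exists>y\<in>carrier (restrict_scalars R i X). y \<oplus>\<^bsub>X\<^esub> x = \<zero>\<^bsub>X\<^esub>"
    if "x \<in> carrier (restrict_scalars R i X)" for x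
    using that by (auto simp: X.M.l_neg X.smult_minus ic intro!: bexI[of _ "\<ominus>\<^bsub>X\<^esub> x"])
  have cl: "i \<one>\<^bsub>R\<^esub> \<odot>\<^bsub>X\<^esub> (i r \<odot>\<^bsub>X\<^esub> x) = i r \<odot>\<^bsub>X\<^esub> x" if "r \<in> carrier R" "x \<in> carrier X" for r x
    using X.smult_assoc[of "i \<one>\<^bsub>R\<^esub>" "i r" x] that ic i1 by simp
  show ?thesis
    by (rule left_moduleI[OF R])
      (use inv in \<open>auto simp: ic cl rng_hom_add[OF i] rng_hom_mult[OF i] X.M.a_ac X.smult_l_distr
        X.smult_r_distr X.smult_assoc\<close>)
qed

lemma lin_hom_restrict:
  assumes R: "ring R" and i: "i \<in> rng_hom R L" and f: "f \<in> lin_hom L X Y"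
  shows "f \<in> lin_hom R (restrict_scalars R i X) (restrict_scalars R i Y)"
proof -
  have i1: "i \<one>\<^bsub>R\<^esub> \<in> carrier L" by (rule rng_hom_closed[OF i]) (rule ring.ring_simprules(6)[OF R])
  show ?thesis
    by (rule lin_homI)
      (auto simp: lin_hom_closed[OF f] lin_hom_add[OF f] lin_hom_smult[OF f rng_hom_closed[OF i]]
        lin_hom_smult[OF f i1, symmetric])
qed

lemma surj_restrict:
  assumes R: "ring R" and i: "i \<in> rng_hom R L" and X: "left_module L X"
    and f: "f \<in> lin_hom L X Y" "f ` carrier X = carrier Y"
  shows "f ` carrier (restrict_scalars R i X) = carrier (restrict_scalars R i Y)"
proof (rule surjI)
  interpret R: ring R by fact
  interpret X: left_module L X by fact
  have i1: "i \<one>\<^bsub>R\<^esub> \<in> carrier L" by (rule rng_hom_closed[OF i R.one_closed])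
  have e: "i \<one>\<^bsub>R\<^esub> \<otimes>\<^bsub>L\<^esub> i \<one>\<^bsub>R\<^esub> = i \<one>\<^bsub>R\<^esub>" using rng_hom_mult[OF i R.one_closed R.one_closed] by simp
  fix y assume "y \<in> carrier (restrict_scalars R i Y)"
  then have y: "y \<in> carrier Y" "i \<one>\<^bsub>R\<^esub> \<odot>\<^bsub>Y\<^esub> y = y" by auto
  obtain x where x: "x \<in> carrier X" "f x = y" using surjE[OF f(2) y(1)] by blast
  \<comment> \<open>Multiplying by the idempotent \<open>i \<one>\<close> moves a preimage into the
    restricted carrier. This makes restriction exact.\<close>
  have "f (i \<one>\<^bsub>R\<^esub> \<odot>\<^bsub>X\<^esub> x) = y" using lin_hom_smult[OF f(1) i1 x(1)] x y by simp
  moreover have "i \<one>\<^bsub>R\<^esub> \<odot>\<^bsub>X\<^esub> (i \<one>\<^bsub>R\<^esub> \<odot>\<^bsub>X\<^esub> x) = i \<one>\<^bsub>R\<^esub> \<odot>\<^bsub>X\<^esub> x"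
    using X.smult_assoc[OF i1 i1 x(1)] e by simp
  ultimately show "\<exists>x\<in>carrier (restrict_scalars R i X). f x = y"
    using i1 x(1) by (intro bexI[of _ "i \<one>\<^bsub>R\<^esub> \<odot>\<^bsub>X\<^esub> x"]) auto
qed (rule lin_hom_closed[OF lin_hom_restrict[OF R i f(1)]])

lemma ker_restrict:
  "ker_module (restrict_scalars R i X) (restrict_scalars R i Y) f = restrict_scalars R i (ker_module X Y f)"
  by (auto simp: ker_module_def lin_ker_def restrict_scalars_def)

lemma retract_restrict:
  assumes "ring R" "i \<in> rng_hom R L" "retract_of L X Y"
  shows "retract_of R (restrict_scalars R i X) (restrict_scalars R i Y)"
proof -
  obtain j q where "j \<in> lin_hom L X Y" "q \<in> lin_hom L Y X" "\<forall>x\<in>carrier X. q (j x) = x"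
    using assms(3) by (auto simp: retract_of_def)
  then show ?thesis unfolding retract_of_def
    by (intro bexI[OF _ lin_hom_restrict[OF assms(1,2)]] ballI) auto
qed

section \<open>Projective dimension under restriction of scalars\<close>

lemma ker_snd_block:
  assumes "ring R" shows "ker_module (free_module R (a + b)) (free_module R b) (snd_block a) = free_module R a"
proof -
  interpret ring R by fact
  have "lin_ker (free_module R (a + b)) (free_module R b) (snd_block a) = carrier (free_module R a)"
  proof (rule subset_antisym; rule subsetI)
    fix z assume z: "z \<in> lin_ker (free_module R (a + b)) (free_module R b) (snd_block a)"
    have "z i = \<zero>\<^bsub>R\<^esub>" if "i \<ge> a" for i
    proof -
      have "snd_block a z = (\<lambda>i. \<zero>\<^bsub>R\<^esub>)" using z by (simp add: lin_ker_def free_module_simps)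
      then have "snd_block a z (i - a) = \<zero>\<^bsub>R\<^esub>" by simp
      then show ?thesis using that by (simp add: snd_block_def)
    qed
    then show "z \<in> carrier (free_module R a)" using z by (auto simp: lin_ker_def free_module_simps)
  qed (auto simp: lin_ker_def snd_block_def free_module_simps)
  then show ?thesis by (simp add: ker_module_def) (simp add: free_module_def)
qed

lemma left_module_regular: assumes "ring L" shows "left_module L (regular_module L)"
proof -
  interpret ring L by fact
  show ?thesis
    by (rule left_moduleI[OF assms])
      (auto simp: regular_module_def a_ac l_distr r_distr m_assoc intro: a_inv_closed l_neg bexI[of _ "\<ominus>\<^bsub>L\<^esub> _"])
qed

lemma regular_module_simps [simp]:
  "carrier (regular_module L) = carrier L" "add (regular_module L) = add L"
  "\<zero>\<^bsub>regular_module L\<^esub> = \<zero>\<^bsub>L\<^esub>" "smult (regular_module L) = mult L"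
  by (auto simp: regular_module_def)

lemma lin_iso_regular:
  assumes "ring L"
  shows "lin_iso L (regular_module L) (free_module L (Suc 0)) (\<lambda>a j. if j = 0 then a else \<zero>\<^bsub>L\<^esub>) (\<lambda>x. x 0)"
proof -
  interpret ring L by fact
  show ?thesis by (auto simp: lin_iso_def free_module_simps fun_eq_iff intro!: lin_homI)
qed

lemma pd_le_regular: "ring L \<Longrightarrow> pd_le L 0 (regular_module L)"
  using pd_le_iso[OF pd_le_0_free left_module_regular lin_iso_sym[OF lin_iso_regular]] by blast

lemma lin_iso_restrict:
  "ring R \<Longrightarrow> i \<in> rng_hom R L \<Longrightarrow> lin_iso L X Y f g \<Longrightarrow>
    lin_iso R (restrict_scalars R i X) (restrict_scalars R i Y) f g"
  unfolding lin_iso_def by (auto intro: lin_hom_restrict)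

text \<open>Restriction is exact, so splitting off one coordinate at a time leaves rank one, which
  is the regular module of the hypothesis.\<close>

lemma pd_le_restrict_free:
  assumes R: "ring R" and L: "ring L" and i: "i \<in> rng_hom R L"
    and proj: "pd_le R 0 (restrict_scalars R i (regular_module L))"
  shows "pd_le R 0 (restrict_scalars R i (free_module L k))"
proof (induction k)
  case 0
  interpret R: ring R by fact
  interpret L: ring L by fact
  interpret X: left_module R "restrict_scalars R i (free_module L 0)"
    by (rule left_module_restrict[OF R i left_module_free[OF L]])
  have 1: "carrier (restrict_scalars R i (free_module L 0)) = {\<lambda>_. \<zero>\<^bsub>L\<^esub>}"
    by (auto simp: free_module_simps rng_hom_closed[OF i])
  have 2: "carrier (free_module R 0) = {\<lambda>_. \<zero>\<^bsub>R\<^esub>}" by (auto simp: free_module_simps)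
  have "lin_iso R (free_module R 0) (restrict_scalars R i (free_module L 0)) (\<lambda>x i. \<zero>\<^bsub>L\<^esub>) (\<lambda>x i. \<zero>\<^bsub>R\<^esub>)"
    unfolding lin_iso_def lin_hom_def 1 2 by (auto simp: free_module_simps rng_hom_closed[OF i])
  then show ?case by (rule pd_le_iso[OF pd_le_0_free[OF R] X.left_module_axioms])
next
  case (Suc k)
  let ?r = "restrict_scalars R i"
  have snd: "snd_block k \<in> lin_hom L (free_module L (k + Suc 0)) (free_module L (Suc 0))"
    by (rule block_hom(2)[OF L])
  have "snd_block k ` carrier (free_module L (k + Suc 0)) = carrier (free_module L (Suc 0))"
  proof (rule surjI)
    fix y assume "y \<in> carrier (free_module L (Suc 0))"
    then show "\<exists>x\<in>carrier (free_module L (k + Suc 0)). snd_block k x = y"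
      using block_simps(4)[OF L] lin_hom_closed[OF block_hom(4)[OF L]] by metis
  qed (rule lin_hom_closed[OF snd])
  note s = surj_restrict[OF R i left_module_free[OF L] snd this]
  have 1: "pd_le R 0 (?r (free_module L (Suc 0)))"
    by (rule pd_le_iso[OF proj left_module_restrict[OF R i left_module_free[OF L]]
          lin_iso_restrict[OF R i lin_iso_regular[OF L]]])
  have "pd_le R 0 (?r (free_module L (k + Suc 0)))"
    by (rule pd_le_ext[OF left_module_restrict[OF R i left_module_free[OF L]]
          lin_hom_restrict[OF R i snd] s 1]) (simp only: ker_restrict ker_snd_block[OF L] Suc)
  then show ?case by simp
qed

context
  fixes R :: "('r, 'c) ring_scheme" and L :: "('l, 'd) ring_scheme" and i
  assumes R: "ring R" and L: "ring L" and i: "i \<in> rng_hom R L"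
    and proj: "pd_le R 0 (restrict_scalars R i (regular_module L))"
begin

lemma pd_le_restrict_0:
  assumes "pd_le L 0 X" shows "pd_le R 0 (restrict_scalars R i X)"
proof -
  obtain r where "retract_of L X (free_module L r)" using assms by (auto simp: pd_le_0)
  from retract_restrict[OF R i this] show ?thesis
    by (rule pd_le_0_retract[OF pd_le_restrict_free[OF R L i proj]
          left_module_restrict[OF R i pd_le_left_module[OF assms]]])
qed

lemma pd_le_restrict_Suc:
  assumes X: "left_module L X" and p: "free_cover L r X p"
    and IH: "pd_le R n (restrict_scalars R i (ker_module (free_module L r) X p))"
  shows "pd_le R (Suc n) (restrict_scalars R i X)"
proof -
  have ph: "p \<in> lin_hom L (free_module L r) X" and ps: "p ` carrier (free_module L r) = carrier X"
    using p by (auto simp: free_cover_def)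
  show ?thesis
    by (rule pd_le_Suc_if_ker[OF pd_le_restrict_free[OF R L i proj] left_module_restrict[OF R i X]
          lin_hom_restrict[OF R i ph] surj_restrict[OF R i left_module_free[OF L] ph ps]])
      (simp add: ker_restrict IH)
qed

lemma pd_le_restrict_submodule:
  fixes X :: "('l, nat \<Rightarrow> 'l) module"
  shows "pd_le L n X \<Longrightarrow> pd_le R n (restrict_scalars R i X)"
proof (induction n arbitrary: X)
  case 0 then show ?case by (rule pd_le_restrict_0)
next
  case (Suc n)
  then obtain r p where p: "free_cover L r X p" "pd_le L n (ker_module (free_module L r) X p)"
    by (auto simp: pd_le_Suc)
  show ?case by (rule pd_le_restrict_Suc[OF pd_le_left_module[OF Suc.prems] p(1) Suc.IH[OF p(2)]])
qed

text \<open>An exact functor that sends free modules to projective ones cannot raise projective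
  dimension; \<open>proj\<close> supplies the second property.\<close>

lemma pd_le_restrict: assumes X: "pd_le L n X" shows "pd_le R n (restrict_scalars R i X)"
proof (cases n)
  case 0 then show ?thesis using X pd_le_restrict_0 by blast
next
  case (Suc m)
  then obtain r p where p: "free_cover L r X p" "pd_le L m (ker_module (free_module L r) X p)"
    using X by (auto simp: pd_le_Suc)
  show ?thesis unfolding Suc
    by (rule pd_le_restrict_Suc[OF pd_le_left_module[OF X] p(1) pd_le_restrict_submodule[OF p(2)]])
qed

end

text \<open>Since \<open>j\<close> preserves the unit, the inner restriction discards no elements.
  Neither does the outer one, because \<open>j (i \<one>) = \<one>\<close>.\<close>

lemma lin_iso_restrict_restrict:
  assumes X: "left_module R X"
    and ji: "\<And>r. r \<in> carrier R \<Longrightarrow> j (i r) = r" and j1: "j \<one>\<^bsub>L\<^esub> = \<one>\<^bsub>R\<^esub>"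
  shows "lin_iso R (restrict_scalars R i (restrict_scalars L j X)) X (\<lambda>x. x) (\<lambda>x. x)"
proof -
  interpret X: left_module R X by fact
  show ?thesis by (auto simp: lin_iso_def ji j1 intro!: lin_homI)
qed

section \<open>Products of rings\<close>

text \<open>The last two conditions make \<open>i \<one>\<close> a central idempotent
  \<open>e\<close> of \<open>S\<close>; \<open>i\<close> identifies \<open>T\<close> with the factor
  \<open>e S\<close>, and \<open>\<pi>\<close> is multiplication by \<open>e\<close> read in
  \<open>T\<close>.\<close>

locale ring_factor = S: ring S + T: ring T for S :: "('s, 'c) ring_scheme" and T :: "('t, 'd) ring_scheme" +
  fixes i :: "'t \<Rightarrow> 's" and \<pi> :: "'s \<Rightarrow> 't"
  assumes incl: "i \<in> rng_hom T S" and proj: "\<pi> \<in> rng_hom S T" and proj_one: "\<pi> \<one>\<^bsub>S\<^esub> = \<one>\<^bsub>T\<^esub>"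
    and proj_incl: "t \<in> carrier T \<Longrightarrow> \<pi> (i t) = t"
    and incl_proj: "s \<in> carrier S \<Longrightarrow> i (\<pi> s) = i \<one>\<^bsub>T\<^esub> \<otimes>\<^bsub>S\<^esub> s"
    and incl_proj': "s \<in> carrier S \<Longrightarrow> i (\<pi> s) = s \<otimes>\<^bsub>S\<^esub> i \<one>\<^bsub>T\<^esub>"
begin

text \<open>Restricting the regular module of \<open>S\<close> to \<open>T\<close> leaves the part
  fixed by \<open>i \<one>\<close>, which is \<open>T\<close> itself and so is free.\<close>

lemma pd_le_incl: assumes "pd_le S n X" shows "pd_le T n (restrict_scalars T i X)"
proof (rule pd_le_restrict[OF T.ring_axioms S.ring_axioms incl _ assms])
  have i1: "i \<one>\<^bsub>T\<^esub> \<otimes>\<^bsub>S\<^esub> i t = i t" if "t \<in> carrier T" for t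
    using rng_hom_mult[OF incl T.one_closed that] that by simp
  have "lin_iso T (regular_module T) (restrict_scalars T i (regular_module S)) i \<pi>"
    unfolding lin_iso_def
    by (intro conjI lin_homI ballI)
      (auto simp: i1 rng_hom_closed[OF incl] rng_hom_closed[OF proj] rng_hom_add[OF incl] rng_hom_add[OF proj]
        rng_hom_mult[OF incl] rng_hom_mult[OF proj] proj_incl incl_proj)
  then show "pd_le T 0 (restrict_scalars T i (regular_module S))"
    by (rule pd_le_iso[OF pd_le_regular[OF T.ring_axioms]
          left_module_restrict[OF T.ring_axioms incl left_module_regular[OF S.ring_axioms]]])
qed

text \<open>Over \<open>S\<close> the factor \<open>T\<close> is a direct summand of the regular
  module: \<open>i\<close> is S-linear by centrality of \<open>i \<one>\<close>, and
  \<open>\<pi>\<close> retracts it.\<close>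

lemma pd_le_proj: assumes "pd_le T n X" shows "pd_le S n (restrict_scalars S \<pi> X)"
proof (rule pd_le_restrict[OF S.ring_axioms T.ring_axioms proj _ assms])
  have "i (\<pi> s \<otimes>\<^bsub>T\<^esub> t) = s \<otimes>\<^bsub>S\<^esub> i t" if s: "s \<in> carrier S" and t: "t \<in> carrier T" for s t
  proof -
    have "i (\<pi> s \<otimes>\<^bsub>T\<^esub> t) = s \<otimes>\<^bsub>S\<^esub> i \<one>\<^bsub>T\<^esub> \<otimes>\<^bsub>S\<^esub> i t"
      using s t by (simp add: rng_hom_mult[OF incl] rng_hom_closed[OF proj] incl_proj')
    also have "\<dots> = s \<otimes>\<^bsub>S\<^esub> (i \<one>\<^bsub>T\<^esub> \<otimes>\<^bsub>S\<^esub> i t)"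
      using s t by (simp add: S.m_assoc rng_hom_closed[OF incl])
    finally show ?thesis using rng_hom_mult[OF incl T.one_closed t] t by simp
  qed
  then have 1: "i \<in> lin_hom S (restrict_scalars S \<pi> (regular_module T)) (regular_module S)"
    by (intro lin_homI) (auto simp: rng_hom_closed[OF incl] rng_hom_add[OF incl])
  have 2: "\<pi> \<in> lin_hom S (regular_module S) (restrict_scalars S \<pi> (regular_module T))"
    by (intro lin_homI) (auto simp: rng_hom_closed[OF proj] rng_hom_add[OF proj] rng_hom_mult[OF proj] proj_one)
  have "retract_of S (restrict_scalars S \<pi> (regular_module T)) (regular_module S)"
    unfolding retract_of_def by (intro bexI[OF _ 1] bexI[OF _ 2] ballI) (simp add: proj_incl)
  then show "pd_le S 0 (restrict_scalars S \<pi> (regular_module T))"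
    by (rule pd_le_0_retract[OF pd_le_regular[OF S.ring_axioms]
          left_module_restrict[OF S.ring_axioms proj left_module_regular[OF T.ring_axioms]]])
qed

lemma special_GLIT_factor: assumes "special_GLIT S" shows "special_GLIT T"
proof -
  obtain d where d: "\<And>n (X :: ('s, (nat \<Rightarrow> 't) set) module). pd_le S n X \<Longrightarrow> pd_le S d X"
    using special_GLIT_bound[OF assms] by metis
  have "pd_le T d X" if X: "pd_le T n X" for n and X :: "'t std_module"
  proof -
    have "pd_le T d (restrict_scalars T i (restrict_scalars S \<pi> X))"
      by (rule pd_le_incl[OF d[OF pd_le_proj[OF X]]])
    then show ?thesis
      by (rule pd_le_iso[OF _ pd_le_left_module[OF X]
            lin_iso_restrict_restrict[OF pd_le_left_module[OF X] proj_incl proj_one]])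
  qed
  then show ?thesis by (auto simp: special_GLIT_iff)
qed

end

lemma RDirProd_simps [simp]:
  "carrier (RDirProd R S) = carrier R \<times> carrier S"
  "add (RDirProd R S) = (\<lambda>(r, s) (r', s'). (r \<oplus>\<^bsub>R\<^esub> r', s \<oplus>\<^bsub>S\<^esub> s'))"
  "mult (RDirProd R S) = (\<lambda>(r, s) (r', s'). (r \<otimes>\<^bsub>R\<^esub> r', s \<otimes>\<^bsub>S\<^esub> s'))"
  "\<zero>\<^bsub>RDirProd R S\<^esub> = (\<zero>\<^bsub>R\<^esub>, \<zero>\<^bsub>S\<^esub>)" "\<one>\<^bsub>RDirProd R S\<^esub> = (\<one>\<^bsub>R\<^esub>, \<one>\<^bsub>S\<^esub>)"
  by (auto simp: RDirProd_def DirProd_def monoid.defs)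

lemma ring_factor_fst:
  assumes "ring T" "ring U" shows "ring_factor (RDirProd T U) T (\<lambda>t. (t, \<zero>\<^bsub>U\<^esub>)) fst"
proof -
  interpret T: ring T by fact
  interpret U: ring U by fact
  show ?thesis
    by (intro ring_factor.intro RDirProd_ring ring_factor_axioms.intro T.ring_axioms U.ring_axioms)
      (auto simp: rng_hom_def)
qed

lemma ring_factor_snd:
  assumes "ring T" "ring U" shows "ring_factor (RDirProd T U) U (\<lambda>u. (\<zero>\<^bsub>T\<^esub>, u)) snd"
proof -
  interpret T: ring T by fact
  interpret U: ring U by fact
  show ?thesis
    by (intro ring_factor.intro RDirProd_ring ring_factor_axioms.intro T.ring_axioms U.ring_axioms)
      (auto simp: rng_hom_def)
qed

text \<open>The idempotents \<open>e\<close> and \<open>f\<close> of the factors give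
  \<open>X = e X \<oplus> f X\<close>. Multiplication by \<open>f\<close> is a surjection onto
  \<open>f X\<close> with kernel \<open>e X\<close>, so the extension lemma applies.\<close>

lemma pd_le_RDirProd:
  assumes T: "ring T" and U: "ring U" and X: "left_module (RDirProd T U) X"
    and XT: "pd_le T n (restrict_scalars T (\<lambda>t. (t, \<zero>\<^bsub>U\<^esub>)) X)"
    and XU: "pd_le U n (restrict_scalars U (\<lambda>u. (\<zero>\<^bsub>T\<^esub>, u)) X)"
  shows "pd_le (RDirProd T U) n X"
proof -
  interpret T: ring T by fact
  interpret U: ring U by fact
  let ?S = "RDirProd T U"
  interpret FT: ring_factor ?S T "\<lambda>t. (t, \<zero>\<^bsub>U\<^esub>)" fst by (rule ring_factor_fst[OF T U])
  interpret FU: ring_factor ?S U "\<lambda>u. (\<zero>\<^bsub>T\<^esub>, u)" snd by (rule ring_factor_snd[OF T U])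
  interpret X: left_module ?S X by fact
  \<comment> \<open>\<open>A\<close> and \<open>C\<close> are \<open>e X\<close> and
    \<open>f X\<close>, made modules over the product again through its projections.\<close>
  define A where "A = restrict_scalars ?S fst (restrict_scalars T (\<lambda>t. (t, \<zero>\<^bsub>U\<^esub>)) X)"
  define C where "C = restrict_scalars ?S snd (restrict_scalars U (\<lambda>u. (\<zero>\<^bsub>T\<^esub>, u)) X)"
  have A: "pd_le ?S n A" unfolding A_def by (rule FT.pd_le_proj[OF XT])
  have C: "pd_le ?S n C" unfolding C_def by (rule FU.pd_le_proj[OF XU])
  define e where "e = (\<one>\<^bsub>T\<^esub>, \<zero>\<^bsub>U\<^esub>)"
  define f where "f = (\<zero>\<^bsub>T\<^esub>, \<one>\<^bsub>U\<^esub>)"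
  have ef: "e \<in> carrier ?S" "f \<in> carrier ?S" by (auto simp: e_def f_def)
  have sum: "x = e \<odot>\<^bsub>X\<^esub> x \<oplus>\<^bsub>X\<^esub> f \<odot>\<^bsub>X\<^esub> x" if "x \<in> carrier X" for x
    using X.smult_l_distr[OF ef that] X.smult_one[OF that] by (simp add: e_def f_def)
  have mult: "a \<odot>\<^bsub>X\<^esub> (b \<odot>\<^bsub>X\<^esub> x) = (a \<otimes>\<^bsub>?S\<^esub> b) \<odot>\<^bsub>X\<^esub> x"
    if "a \<in> carrier ?S" "b \<in> carrier ?S" "x \<in> carrier X" for a b x using X.smult_assoc[OF that] by simp
  have cA: "x \<in> carrier A \<longleftrightarrow> x \<in> carrier X \<and> e \<odot>\<^bsub>X\<^esub> x = x" for x
    by (auto simp: A_def e_def)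
  have cC: "x \<in> carrier C \<longleftrightarrow> x \<in> carrier X \<and> f \<odot>\<^bsub>X\<^esub> x = x" for x
    by (auto simp: C_def f_def)
  have oC: "add C = add X" "\<zero>\<^bsub>C\<^esub> = \<zero>\<^bsub>X\<^esub>" "smult C = (\<lambda>s x. (\<zero>\<^bsub>T\<^esub>, snd s) \<odot>\<^bsub>X\<^esub> x)" by (auto simp: C_def)
  have oA: "add A = add X" "\<zero>\<^bsub>A\<^esub> = \<zero>\<^bsub>X\<^esub>" "smult A = (\<lambda>s x. (fst s, \<zero>\<^bsub>U\<^esub>) \<odot>\<^bsub>X\<^esub> x)" by (auto simp: A_def)
  have fC: "(\<lambda>x. f \<odot>\<^bsub>X\<^esub> x) \<in> lin_hom ?S X C"
  proof (rule lin_homI)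
    fix x assume x: "x \<in> carrier X"
    show "f \<odot>\<^bsub>X\<^esub> x \<in> carrier C" using mult[OF ef(2) ef(2) x] x ef by (simp add: cC) (simp add: f_def)
    show "f \<odot>\<^bsub>X\<^esub> (x \<oplus>\<^bsub>X\<^esub> y) = f \<odot>\<^bsub>X\<^esub> x \<oplus>\<^bsub>C\<^esub> f \<odot>\<^bsub>X\<^esub> y" if "y \<in> carrier X" for y
      using X.smult_r_distr[OF ef(2) x that] by (simp add: oC)
    show "f \<odot>\<^bsub>X\<^esub> (s \<odot>\<^bsub>X\<^esub> x) = s \<odot>\<^bsub>C\<^esub> (f \<odot>\<^bsub>X\<^esub> x)" if s: "s \<in> carrier ?S" for s
    proof -
      have s': "(\<zero>\<^bsub>T\<^esub>, snd s) \<in> carrier ?S" using s by auto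
      show ?thesis using mult[OF ef(2) s x] mult[OF s' ef(2) x] s
        by (auto simp: oC f_def)
    qed
  qed
  have "(\<lambda>x. f \<odot>\<^bsub>X\<^esub> x) ` carrier X = carrier C"
    by (rule surjI[OF lin_hom_closed[OF fC]]) (auto simp: cC)
  moreover have "pd_le ?S n (ker_module X C (\<lambda>x. f \<odot>\<^bsub>X\<^esub> x))"
  proof (rule pd_le_iso[OF A left_module_ker[OF X.left_module_axioms pd_le_left_module[OF C] fC]])
    have 1: "x \<in> carrier A \<longleftrightarrow> x \<in> carrier X \<and> f \<odot>\<^bsub>X\<^esub> x = \<zero>\<^bsub>X\<^esub>" for x
    proof
      assume "x \<in> carrier A"
      then have x: "x \<in> carrier X" "e \<odot>\<^bsub>X\<^esub> x = x" by (auto simp: cA)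
      have "f \<odot>\<^bsub>X\<^esub> (e \<odot>\<^bsub>X\<^esub> x) = \<zero>\<^bsub>X\<^esub>"
        using mult[OF ef(2,1) x(1)] X.smult_zero_left[OF x(1)] by (simp add: e_def f_def)
      then show "x \<in> carrier X \<and> f \<odot>\<^bsub>X\<^esub> x = \<zero>\<^bsub>X\<^esub>" using x by simp
    next
      assume x: "x \<in> carrier X \<and> f \<odot>\<^bsub>X\<^esub> x = \<zero>\<^bsub>X\<^esub>"
      then show "x \<in> carrier A" using sum[of x] ef by (simp add: cA)
    qed
    have 2: "(fst s, \<zero>\<^bsub>U\<^esub>) \<odot>\<^bsub>X\<^esub> x = s \<odot>\<^bsub>X\<^esub> x" if s: "s \<in> carrier ?S" and x: "x \<in> carrier A" for s x
    proof -
      have x': "x \<in> carrier X" "e \<odot>\<^bsub>X\<^esub> x = x" using x by (auto simp: cA)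
      have "s \<odot>\<^bsub>X\<^esub> x = (s \<otimes>\<^bsub>?S\<^esub> e) \<odot>\<^bsub>X\<^esub> x" using mult[OF s ef(1) x'(1)] x'(2) by simp
      also have "s \<otimes>\<^bsub>?S\<^esub> e = (fst s, \<zero>\<^bsub>U\<^esub>)" using s by (auto simp: e_def)
      finally show ?thesis by simp
    qed
    show "lin_iso ?S A (ker_module X C (\<lambda>x. f \<odot>\<^bsub>X\<^esub> x)) (\<lambda>x. x) (\<lambda>x. x)"
      unfolding lin_iso_def
      by (intro conjI lin_homI ballI) (use 1 2 in \<open>simp_all add: oA oC\<close>)
  qed
  ultimately show ?thesis by (rule pd_le_ext[OF X.left_module_axioms fC _ C])
qed

lemma special_GLIT_RDirProd:
  fixes T :: "('t, 'c) ring_scheme" and U :: "('u, 'd) ring_scheme"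
  assumes T: "ring T" and U: "ring U"
  shows "special_GLIT (RDirProd T U) \<longleftrightarrow> special_GLIT T \<and> special_GLIT U"
proof
  assume "special_GLIT (RDirProd T U)"
  then show "special_GLIT T \<and> special_GLIT U"
    using ring_factor.special_GLIT_factor[OF ring_factor_fst[OF T U]]
      ring_factor.special_GLIT_factor[OF ring_factor_snd[OF T U]] by blast
next
  assume G: "special_GLIT T \<and> special_GLIT U"
  obtain d1 where d1: "\<And>n (X :: ('t, (nat \<Rightarrow> 't \<times> 'u) set) module). pd_le T n X \<Longrightarrow> pd_le T d1 X"
    using special_GLIT_bound[of T] G by metis
  obtain d2 where d2: "\<And>n (X :: ('u, (nat \<Rightarrow> 't \<times> 'u) set) module). pd_le U n X \<Longrightarrow> pd_le U d2 X"
    using special_GLIT_bound[of U] G by metis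
  have "pd_le (RDirProd T U) (max d1 d2) X" if X: "pd_le (RDirProd T U) n X"
    for n and X :: "('t \<times> 'u) std_module"
  proof (rule pd_le_RDirProd[OF T U pd_le_left_module[OF X]])
    show "pd_le T (max d1 d2) (restrict_scalars T (\<lambda>t. (t, \<zero>\<^bsub>U\<^esub>)) X)"
      by (rule pd_le_mono[OF d1[OF ring_factor.pd_le_incl[OF ring_factor_fst[OF T U] X]]]) simp
    show "pd_le U (max d1 d2) (restrict_scalars U (\<lambda>u. (\<zero>\<^bsub>T\<^esub>, u)) X)"
      by (rule pd_le_mono[OF d2[OF ring_factor.pd_le_incl[OF ring_factor_snd[OF T U] X]]]) simp
  qed
  then show "special_GLIT (RDirProd T U)" unfolding special_GLIT_iff by blast
qed

section \<open>Split extensions\<close>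

declare restrict_scalars_simps(1) [simp del]

text \<open>
  \<open>L = h S \<oplus> J\<close> with \<open>J = ker \<sigma>\<close>. The rule \<open>kernel_induct\<close> says that \<open>J\<close> is generated additively
  by products \<open>a s\<close> with \<open>a \<in> J\<close> and \<open>s J = 0\<close>; it replaces the conditions that \<open>J\<close> is projective
  as a right \<open>S\<close>-module and \<open>J \<otimes>\<^sub>S J = 0\<close>, the \<open>a s\<close> coming from a dual basis.
\<close>

locale split_extension = S: ring S + L: ring L
  for S :: "('s, 'c) ring_scheme" and L :: "('l, 'd) ring_scheme" +
  fixes h :: "'s \<Rightarrow> 'l" and \<sigma> :: "'l \<Rightarrow> 's"
  assumes h: "h \<in> rng_hom S L" and h_one: "h \<one>\<^bsub>S\<^esub> = \<one>\<^bsub>L\<^esub>"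
    and \<sigma>: "\<sigma> \<in> rng_hom L S" and \<sigma>_one: "\<sigma> \<one>\<^bsub>L\<^esub> = \<one>\<^bsub>S\<^esub>"
    and \<sigma>_h: "s \<in> carrier S \<Longrightarrow> \<sigma> (h s) = s"
    and projective: "pd_le S 0 (restrict_scalars S h (regular_module L))"
    and kernel_induct: "\<lbrakk>j \<in> carrier L; \<sigma> j = \<zero>\<^bsub>S\<^esub>;
        \<And>a s. \<lbrakk>a \<in> carrier L; \<sigma> a = \<zero>\<^bsub>S\<^esub>; s \<in> carrier S;
          \<And>k. k \<in> carrier L \<Longrightarrow> \<sigma> k = \<zero>\<^bsub>S\<^esub> \<Longrightarrow> h s \<otimes>\<^bsub>L\<^esub> k = \<zero>\<^bsub>L\<^esub>\<rbrakk> \<Longrightarrow> P (a \<otimes>\<^bsub>L\<^esub> h s);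
        P \<zero>\<^bsub>L\<^esub>;
        \<And>x y. \<lbrakk>x \<in> carrier L; y \<in> carrier L; P x; P y\<rbrakk> \<Longrightarrow> P (x \<oplus>\<^bsub>L\<^esub> y)\<rbrakk> \<Longrightarrow> P j"
begin

lemmas h_closed = rng_hom_closed[OF h] and \<sigma>_closed = rng_hom_closed[OF \<sigma>]

abbreviation res :: "('l, 'b, 'e) module_scheme \<Rightarrow> ('s, 'b) module" where
  "res X \<equiv> restrict_scalars S h X"

lemma carrier_res: "left_module L X \<Longrightarrow> carrier (res X) = carrier X"
  by (auto simp: restrict_scalars_simps(1) h_one left_module.smult_one)

lemma left_module_res: "left_module L X \<Longrightarrow> left_module S (res X)"
  by (rule left_module_restrict[OF S.ring_axioms h])

lemma lin_hom_res: "f \<in> lin_hom L X Y \<Longrightarrow> f \<in> lin_hom S (res X) (res Y)"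
  by (rule lin_hom_restrict[OF S.ring_axioms h])

lemma kernel_smult_eq_zero:
  assumes Y: "left_module L Y" and y: "y \<in> carrier Y"
    and ann: "\<And>s. \<lbrakk>s \<in> carrier S; \<And>k. k \<in> carrier L \<Longrightarrow> \<sigma> k = \<zero>\<^bsub>S\<^esub> \<Longrightarrow> h s \<otimes>\<^bsub>L\<^esub> k = \<zero>\<^bsub>L\<^esub>\<rbrakk> \<Longrightarrow>
      h s \<odot>\<^bsub>Y\<^esub> y = \<zero>\<^bsub>Y\<^esub>"
    and j: "j \<in> carrier L" "\<sigma> j = \<zero>\<^bsub>S\<^esub>"
  shows "j \<odot>\<^bsub>Y\<^esub> y = \<zero>\<^bsub>Y\<^esub>"
proof -
  interpret Y: left_module L Y by fact
  show ?thesis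
  proof (rule kernel_induct[OF j, where P = "\<lambda>x. x \<odot>\<^bsub>Y\<^esub> y = \<zero>\<^bsub>Y\<^esub>"])
    fix a s assume "a \<in> carrier L" and s: "s \<in> carrier S"
      and k: "\<And>k. k \<in> carrier L \<Longrightarrow> \<sigma> k = \<zero>\<^bsub>S\<^esub> \<Longrightarrow> h s \<otimes>\<^bsub>L\<^esub> k = \<zero>\<^bsub>L\<^esub>"
    then show "(a \<otimes>\<^bsub>L\<^esub> h s) \<odot>\<^bsub>Y\<^esub> y = \<zero>\<^bsub>Y\<^esub>"
      using y ann[OF s k] by (simp add: Y.smult_assoc h_closed)
  qed (use y in \<open>auto simp: Y.smult_l_distr\<close>)
qed

text \<open>\<open>a\<close> and \<open>h (\<sigma> a)\<close> differ by an element of the kernel of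
  \<open>\<sigma>\<close>, and the annihilators of that kernel kill \<open>y\<close>; hence so does
  the kernel.\<close>

lemma smult_via_\<sigma>:
  assumes Y: "left_module L Y" and y: "y \<in> carrier Y"
    and ann: "\<And>s. \<lbrakk>s \<in> carrier S; \<And>k. k \<in> carrier L \<Longrightarrow> \<sigma> k = \<zero>\<^bsub>S\<^esub> \<Longrightarrow> h s \<otimes>\<^bsub>L\<^esub> k = \<zero>\<^bsub>L\<^esub>\<rbrakk> \<Longrightarrow>
      h s \<odot>\<^bsub>Y\<^esub> y = \<zero>\<^bsub>Y\<^esub>"
    and a: "a \<in> carrier L"
  shows "a \<odot>\<^bsub>Y\<^esub> y = h (\<sigma> a) \<odot>\<^bsub>Y\<^esub> y"
proof -
  interpret Y: left_module L Y by fact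
  define b where "b = h (\<sigma> a)"
  define j where "j = a \<ominus>\<^bsub>L\<^esub> b"
  have b: "b \<in> carrier L" using a by (simp add: b_def h_closed \<sigma>_closed)
  have j: "j \<in> carrier L" using a b by (simp add: j_def)
  have aj: "a = j \<oplus>\<^bsub>L\<^esub> b" using a b by (simp add: j_def L.minus_eq L.a_assoc L.l_neg)
  have "\<sigma> j \<oplus>\<^bsub>S\<^esub> \<sigma> a = \<sigma> a"
    using rng_hom_add[OF \<sigma> j b] aj[symmetric] a by (simp add: b_def \<sigma>_h \<sigma>_closed)
  then have \<sigma>j: "\<sigma> j = \<zero>\<^bsub>S\<^esub>" using \<sigma>_closed[OF j] \<sigma>_closed[OF a] by simp
  have "j \<odot>\<^bsub>Y\<^esub> y = \<zero>\<^bsub>Y\<^esub>" by (rule kernel_smult_eq_zero[OF Y y ann j \<sigma>j])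
  then show ?thesis using Y.smult_l_distr[OF j b y] aj[symmetric] b y by (simp flip: b_def)
qed

text \<open>With the free L-module viewed as the scalar extension of the free S-module,
  \<open>ext\<close> is the unit \<open>x \<mapsto> 1 \<otimes> x\<close>; \<open>cut\<close> is
  reduction modulo the kernel of \<open>\<sigma>\<close>.\<close>

definition ext :: "(nat \<Rightarrow> 's) \<Rightarrow> nat \<Rightarrow> 'l" where "ext x = (\<lambda>i. h (x i))"

definition cut :: "(nat \<Rightarrow> 'l) \<Rightarrow> nat \<Rightarrow> 's" where "cut c = (\<lambda>i. \<sigma> (c i))"

lemma h_zero: "h \<zero>\<^bsub>S\<^esub> = \<zero>\<^bsub>L\<^esub>"
proof -
  have "h \<zero>\<^bsub>S\<^esub> \<oplus>\<^bsub>L\<^esub> h \<zero>\<^bsub>S\<^esub> = h \<zero>\<^bsub>S\<^esub>"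
    using rng_hom_add[OF h S.zero_closed S.zero_closed] by simp
  then show ?thesis using h_closed[OF S.zero_closed] by simp
qed

lemma \<sigma>_zero: "\<sigma> \<zero>\<^bsub>L\<^esub> = \<zero>\<^bsub>S\<^esub>"
  using \<sigma>_h[OF S.zero_closed] by (simp add: h_zero)

lemma ext_hom: "ext \<in> lin_hom S (free_module S r) (res (free_module L r))"
  by (rule lin_homI)
    (auto simp: ext_def carrier_res[OF left_module_free[OF L.ring_axioms]] free_module_simps h_closed h_zero
      rng_hom_add[OF h] rng_hom_mult[OF h] h_one fun_eq_iff)

lemma cut_hom: "cut \<in> lin_hom S (res (free_module L r)) (free_module S r)"
  by (rule lin_homI)
    (auto simp: cut_def carrier_res[OF left_module_free[OF L.ring_axioms]] free_module_simps h_closed \<sigma>_zero \<sigma>_closed \<sigma>_h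
      rng_hom_add[OF \<sigma>] rng_hom_mult[OF \<sigma>] fun_eq_iff)

lemma cut_smult:
  "a \<in> carrier L \<Longrightarrow> c \<in> carrier (free_module L r) \<Longrightarrow>
    cut (a \<odot>\<^bsub>free_module L r\<^esub> c) = \<sigma> a \<odot>\<^bsub>free_module S r\<^esub> cut c"
  by (auto simp: cut_def free_module_simps rng_hom_mult[OF \<sigma>] fun_eq_iff)

lemma cut_ext: "x \<in> carrier (free_module S r) \<Longrightarrow> cut (ext x) = x"
  by (auto simp: cut_def ext_def free_module_simps \<sigma>_h fun_eq_iff)

lemma lin_comb_res: "lin_comb (res W) r x v = lin_comb W r (ext x) v"
  by (induction r) (auto simp: ext_def)

text \<open>The adjunction between extension and restriction of scalars: an S-linear map on the free
  S-module extends along \<open>ext\<close>, with the same values on the basis.\<close>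

lemma extend_hom:
  assumes W: "left_module L W" and p: "p \<in> lin_hom S (free_module S r) (res W)"
  defines "P \<equiv> \<lambda>c. lin_comb W r c (\<lambda>i. p (unit_vec S i))"
  shows "P \<in> lin_hom L (free_module L r) W" "x \<in> carrier (free_module S r) \<Longrightarrow> P (ext x) = p x"
proof -
  interpret W: left_module L W by fact
  show "P \<in> lin_hom L (free_module L r) W" unfolding P_def
    by (rule W.lin_comb_lin_hom)
      (use lin_hom_closed[OF p unit_vec_closed[OF S.ring_axioms]] carrier_res[OF W] in auto)
  show "P (ext x) = p x" if "x \<in> carrier (free_module S r)" for x
    using free_module_hom_eq[OF left_module_res[OF W] p that] by (simp add: P_def lin_comb_res)
qed

lemma cover_extend:
  assumes W: "left_module L W" and p: "free_cover S r (res W) p"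
  obtains P where "free_cover L r W P" "\<And>x. x \<in> carrier (free_module S r) \<Longrightarrow> P (ext x) = p x"
proof -
  have ph: "p \<in> lin_hom S (free_module S r) (res W)" and ps: "p ` carrier (free_module S r) = carrier W"
    using p unfolding free_cover_def carrier_res[OF W] by auto
  define P where "P c = lin_comb W r c (\<lambda>i. p (unit_vec S i))" for c
  have P: "P \<in> lin_hom L (free_module L r) W" "\<And>x. x \<in> carrier (free_module S r) \<Longrightarrow> P (ext x) = p x"
    using extend_hom[OF W ph] unfolding P_def by auto
  have "P ` carrier (free_module L r) = carrier W"
  proof (rule surjI)
    fix w assume "w \<in> carrier W"
    then obtain x where x: "x \<in> carrier (free_module S r)" "p x = w" using surjE[OF ps] by blast
    then show "\<exists>c\<in>carrier (free_module L r). P c = w"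
      using P(2)[OF x(1)] lin_hom_closed[OF ext_hom x(1)] carrier_res[OF left_module_free[OF L.ring_axioms]] by (intro bexI[of _ "ext x"]) auto
  qed (rule lin_hom_closed[OF P(1)])
  then show ?thesis using that P by (auto simp: free_cover_def)
qed

text \<open>\<open>L\<close> acts on \<open>H\<close> through \<open>\<sigma>\<close>, so a
  splitting over \<open>S\<close> can be carried over: \<open>p\<close> after \<open>cut\<close> is
  L-linear for this reason, and \<open>ext\<close> after \<open>t\<close> because its values are
  killed by the kernel of \<open>\<sigma>\<close> as well.\<close>

lemma pd_le_0_if_annihilated:
  assumes H: "left_module L H" and H0: "pd_le S 0 (res H)"
    and ann: "\<And>s x. \<lbrakk>s \<in> carrier S; \<And>k. k \<in> carrier L \<Longrightarrow> \<sigma> k = \<zero>\<^bsub>S\<^esub> \<Longrightarrow> h s \<otimes>\<^bsub>L\<^esub> k = \<zero>\<^bsub>L\<^esub>;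
      x \<in> carrier H\<rbrakk> \<Longrightarrow> h s \<odot>\<^bsub>H\<^esub> x = \<zero>\<^bsub>H\<^esub>"
  shows "pd_le L 0 H"
proof -
  interpret H: left_module L H by fact
  obtain k t p where t: "t \<in> lin_hom S (res H) (free_module S k)"
      and p: "p \<in> lin_hom S (free_module S k) (res H)" and pt: "\<forall>x\<in>carrier (res H). p (t x) = x"
    using H0 by (auto simp: pd_le_0 retract_of_def)
  let ?F = "free_module L k"
  have F: "left_module L ?F" by (rule left_module_free[OF L.ring_axioms])
  note cH = carrier_res[OF H] and cF = carrier_res[OF F]
  have sH: "a \<odot>\<^bsub>H\<^esub> x = \<sigma> a \<odot>\<^bsub>res H\<^esub> x" if "a \<in> carrier L" "x \<in> carrier H" for a x
    using smult_via_\<sigma>[OF H that(2) ann that(1)] that(2) by simp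
  have p': "p y \<in> carrier H" if "y \<in> carrier (free_module S k)" for y
    using lin_hom_closed[OF p that] cH by blast
  have cut': "cut c \<in> carrier (free_module S k)" if "c \<in> carrier ?F" for c
    using lin_hom_closed[OF cut_hom[of k]] that cF by blast
  have ext': "ext y \<in> carrier ?F" if "y \<in> carrier (free_module S k)" for y
    using lin_hom_closed[OF ext_hom that] cF by blast
  have t': "t x \<in> carrier (free_module S k)" if "x \<in> carrier H" for x
    using lin_hom_closed[OF t] that cH by blast
  have 1: "(\<lambda>c. p (cut c)) \<in> lin_hom L ?F H"
  proof (rule lin_homI)
    fix c assume c: "c \<in> carrier ?F"
    show "p (cut c) \<in> carrier H" by (rule p'[OF cut'[OF c]])
    show "p (cut (c \<oplus>\<^bsub>?F\<^esub> d)) = p (cut c) \<oplus>\<^bsub>H\<^esub> p (cut d)" if d: "d \<in> carrier ?F" for d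
      using lin_hom_add[OF cut_hom[of k], of c d] lin_hom_add[OF p cut'[OF c] cut'[OF d]] c d cF by simp
    show "p (cut (a \<odot>\<^bsub>?F\<^esub> c)) = a \<odot>\<^bsub>H\<^esub> p (cut c)" if a: "a \<in> carrier L" for a
      using lin_hom_smult[OF p \<sigma>_closed[OF a] cut'[OF c]] sH[OF a p'[OF cut'[OF c]]]
      by (simp only: cut_smult[OF a c])
  qed
  \<comment> \<open>An annihilator \<open>s\<close> kills \<open>x\<close>, hence also
    \<open>ext (t x)\<close> by S-linearity; so \<open>smult_via_\<sigma>\<close> applies inside the
    free module.\<close>
  have sE: "a \<odot>\<^bsub>?F\<^esub> ext (t x) = h (\<sigma> a) \<odot>\<^bsub>?F\<^esub> ext (t x)"
    if a: "a \<in> carrier L" and x: "x \<in> carrier H" for a x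
  proof (rule smult_via_\<sigma>[OF F ext'[OF t'[OF x]] _ a])
    fix s assume s: "s \<in> carrier S" and k: "\<And>k. k \<in> carrier L \<Longrightarrow> \<sigma> k = \<zero>\<^bsub>S\<^esub> \<Longrightarrow> h s \<otimes>\<^bsub>L\<^esub> k = \<zero>\<^bsub>L\<^esub>"
    have x': "x \<in> carrier (res H)" using x cH by blast
    have "h s \<odot>\<^bsub>?F\<^esub> ext (t x) = ext (t (s \<odot>\<^bsub>res H\<^esub> x))"
      using lin_hom_smult[OF ext_hom s t'[OF x]] lin_hom_smult[OF t s x'] by simp
    also have "s \<odot>\<^bsub>res H\<^esub> x = \<zero>\<^bsub>res H\<^esub>" using ann[OF s k x] by simp
    also have "ext (t \<zero>\<^bsub>res H\<^esub>) = \<zero>\<^bsub>?F\<^esub>"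
      using lin_hom_zero[OF left_module_res[OF H] left_module_free[OF S.ring_axioms] t]
        lin_hom_zero[OF left_module_free[OF S.ring_axioms] left_module_res[OF F] ext_hom] by simp
    finally show "h s \<odot>\<^bsub>?F\<^esub> ext (t x) = \<zero>\<^bsub>?F\<^esub>" .
  qed
  have 2: "(\<lambda>x. ext (t x)) \<in> lin_hom L H ?F"
  proof (rule lin_homI)
    fix x assume x: "x \<in> carrier H"
    then have x': "x \<in> carrier (res H)" using cH by blast
    show "ext (t x) \<in> carrier ?F" by (rule ext'[OF t'[OF x]])
    show "ext (t (x \<oplus>\<^bsub>H\<^esub> y)) = ext (t x) \<oplus>\<^bsub>?F\<^esub> ext (t y)" if y: "y \<in> carrier H" for y
      using lin_hom_add[OF t x', of y] y cH lin_hom_add[OF ext_hom t'[OF x] t'[OF y]] by simp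
    show "ext (t (a \<odot>\<^bsub>H\<^esub> x)) = a \<odot>\<^bsub>?F\<^esub> ext (t x)" if a: "a \<in> carrier L" for a
      using lin_hom_smult[OF t \<sigma>_closed[OF a] x'] lin_hom_smult[OF ext_hom \<sigma>_closed[OF a] t'[OF x]]
      by (simp only: sH[OF a x] sE[OF a x]) simp
  qed
  have "retract_of L H ?F" unfolding retract_of_def
    by (intro bexI[OF _ 2] bexI[OF _ 1] ballI) (use cut_ext[OF t'] pt cH in auto)
  then show ?thesis using H by (auto simp: pd_le_0)
qed

text \<open>The image of \<open>E\<close> is \<open>L \<otimes>\<^sub>S W\<close>, and
  \<open>P\<close> restricts to the multiplication from it onto \<open>W\<close>. The kernel
  \<open>K\<close> of the free cover \<open>P\<close> is an extension of \<open>H\<close>, the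
  kernel of that multiplication, by the kernel of \<open>E\<close>, a summand of the free module. It
  remains to see that \<open>H\<close> is projective.\<close>

lemma pd_le_extend_0:
  assumes W: "left_module L W" and W0: "pd_le S 0 (res W)"
  shows "pd_le L (Suc 0) W"
proof -
  interpret W: left_module L W by fact
  interpret rW: left_module S "res W" by (rule left_module_res[OF W])
  obtain r t p where t: "t \<in> lin_hom S (res W) (free_module S r)"
      and p: "p \<in> lin_hom S (free_module S r) (res W)" and pt: "\<forall>x\<in>carrier (res W). p (t x) = x"
    using W0 by (auto simp: pd_le_0 retract_of_def)
  let ?F = "free_module L r" and ?FS = "free_module S r"
  have F: "left_module L ?F" by (rule left_module_free[OF L.ring_axioms])
  have FS: "left_module S ?FS" by (rule left_module_free[OF S.ring_axioms])
  have rF: "left_module S (res ?F)" by (rule left_module_res[OF F])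
  interpret F: left_module L ?F by fact
  interpret FS: left_module S ?FS by fact
  interpret rF: left_module S "res ?F" by fact
  note cW = carrier_res[OF W] and cF = carrier_res[OF F]
  have "p ` carrier ?FS = carrier (res W)"
  proof (rule surjI[OF lin_hom_closed[OF p]])
    fix y assume y: "y \<in> carrier (res W)"
    show "\<exists>x\<in>carrier ?FS. p x = y" by (rule bexI[where x = "t y"]) (rule bspec[OF pt y] lin_hom_closed[OF t y])+
  qed
  then have cov: "free_cover S r (res W) p" using p by (simp add: free_cover_def)
  define v where "v i = p (unit_vec S i)" for i
  have v: "v i \<in> carrier (res W)" if "i < r" for i
    unfolding v_def by (rule lin_hom_closed[OF p unit_vec_closed[OF S.ring_axioms that]])
  define P where "P c = lin_comb W r c v" for c
  have P: "P \<in> lin_hom L ?F W" and Pe: "\<And>x. x \<in> carrier ?FS \<Longrightarrow> P (ext x) = p x"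
    using extend_hom[OF W p] unfolding P_def v_def by auto
  \<comment> \<open>An S-linear section of \<open>P\<close>: it sends \<open>w\<close> to
    \<open>1 \<otimes> w\<close>.\<close>
  define et where "et = (\<lambda>w. ext (t w))"
  have et: "et \<in> lin_hom S (res W) (res ?F)" unfolding et_def by (rule lin_hom_comp[OF t ext_hom])
  have Pet: "P (et w) = w" if "w \<in> carrier (res W)" for w
    using Pe[OF lin_hom_closed[OF t that]] pt that by (simp add: et_def)
  \<comment> \<open>\<open>E\<close> is the scalar extension of the idempotent \<open>t p\<close>
    whose image is a copy of \<open>W\<close>.\<close>
  define E where "E c = lin_comb ?F r c (\<lambda>i. et (v i))" for c
  have etp: "(\<lambda>x. et (p x)) \<in> lin_hom S ?FS (res ?F)" by (rule lin_hom_comp[OF p et])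
  have E: "E \<in> lin_hom L ?F ?F" and Ee: "\<And>x. x \<in> carrier ?FS \<Longrightarrow> E (ext x) = et (p x)"
    using extend_hom[OF F etp] unfolding E_def v_def by auto
  have Eet: "E (et w) = et w" if "w \<in> carrier (res W)" for w
    using Ee[OF lin_hom_closed[OF t that]] pt that by (simp add: et_def)
  have etF: "et w \<in> carrier ?F" if "w \<in> carrier (res W)" for w
    using lin_hom_closed[OF et that] cF by blast
  have PE: "P (E c) = P c" if c: "c \<in> carrier ?F" for c
  proof -
    have "P (E c) = lin_comb W r c (\<lambda>i. P (et (v i)))" unfolding E_def
      by (rule F.lin_comb_hom[OF W P]) (use c v etF in \<open>auto simp: free_module_simps\<close>)
    also have "\<dots> = P c" unfolding P_def[of c] by (rule lin_comb_cong) (use Pet v in auto)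
    finally show ?thesis .
  qed
  have EE: "E (E c) = E c" if c: "c \<in> carrier ?F" for c
  proof -
    have "E (E c) = lin_comb ?F r c (\<lambda>i. E (et (v i)))" unfolding E_def[of c]
      by (rule F.lin_comb_hom[OF F E]) (use c v etF in \<open>auto simp: free_module_simps\<close>)
    also have "\<dots> = E c" unfolding E_def[of c] by (rule lin_comb_cong) (use Eet v in auto)
    finally show ?thesis .
  qed
  define D where "D c = c \<ominus>\<^bsub>?F\<^esub> E c" for c
  have D: "D \<in> lin_hom L ?F ?F" unfolding D_def by (rule lin_hom_diff[OF F lin_hom_id E])
  define K where "K = ker_module ?F W P"
  define H where "H = ker_module K ?F D"
  have K: "left_module L K" unfolding K_def by (rule left_module_ker[OF F W P])
  have H: "left_module L H" unfolding H_def
    by (rule left_module_ker[OF K F]) (simp add: K_def lin_hom_from_ker[OF D])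
  have Ec: "E c \<in> carrier ?F" if "c \<in> carrier ?F" for c using lin_hom_closed[OF E that] .
  have D0: "D c = \<zero>\<^bsub>?F\<^esub> \<longleftrightarrow> E c = c" if "c \<in> carrier ?F" for c
    using F.minus_eq_zero_iff[OF that Ec[OF that]] by (auto simp: D_def)
  have cH: "c \<in> carrier H \<longleftrightarrow> c \<in> carrier ?F \<and> P c = \<zero>\<^bsub>W\<^esub> \<and> E c = c" for c
    using D0 by (auto simp: H_def K_def)
  have EH: "E \<in> lin_hom L K H" unfolding H_def
  proof (rule lin_hom_into_ker)
    show "E \<in> lin_hom L K K" unfolding K_def
      by (rule lin_hom_into_ker[OF lin_hom_from_ker[OF E]]) (simp add: PE)
    show "D (E c) = \<zero>\<^bsub>?F\<^esub>" if "c \<in> carrier K" for c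
      using that D0[OF Ec] EE by (auto simp: K_def)
  qed
  have EHs: "E ` carrier K = carrier H"
    by (rule surjI[OF lin_hom_closed[OF EH]]) (auto simp: cH K_def)
  \<comment> \<open>\<open>D = 1 - E\<close> projects onto the kernel of \<open>E\<close>, which
    lies in \<open>K\<close> because \<open>P E = P\<close>.\<close>
  have kerE: "pd_le L 0 (ker_module K H E)"
  proof (rule pd_le_0_retract[OF pd_le_0_free[OF L.ring_axioms]])
    show "left_module L (ker_module K H E)" by (rule left_module_ker[OF K H EH])
    have 1: "(\<lambda>c. c) \<in> lin_hom L (ker_module K H E) ?F" unfolding K_def
      by (rule lin_hom_from_ker[OF lin_hom_from_ker[OF lin_hom_id]])
    have PD: "P (D c) = \<zero>\<^bsub>W\<^esub>" "E (D c) = \<zero>\<^bsub>?F\<^esub>" if c: "c \<in> carrier ?F" for c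
      using lin_hom_minus[OF F W P c Ec[OF c]] lin_hom_minus[OF F F E c Ec[OF c]]
      by (simp_all add: D_def PE[OF c] EE[OF c] W.minus_eq_zero_iff F.minus_eq_zero_iff lin_hom_closed[OF P c] Ec[OF c])
    have z: "\<zero>\<^bsub>H\<^esub> = \<zero>\<^bsub>?F\<^esub>" by (simp add: H_def K_def)
    have 2: "D \<in> lin_hom L ?F (ker_module K H E)" unfolding K_def
      by (intro lin_hom_into_ker D) (simp_all add: PD z)
    show "retract_of L (ker_module K H E) ?F" unfolding retract_of_def
      by (intro bexI[OF _ 1] bexI[OF _ 2] ballI)
        (auto simp: K_def D_def z F.M.minus_eq)
  qed
  let ?m = "a_minus (res ?F)"
  note EF = lin_hom_res[OF E] and PF = lin_hom_res[OF P]
  \<comment> \<open>The S-linear projection along \<open>ext\<close> onto vectors with entries in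
    the kernel of \<open>\<sigma>\<close>.\<close>
  define J where "J c = ?m c (ext (cut c))" for c
  have J: "J \<in> lin_hom S (res ?F) (res ?F)" unfolding J_def
    by (rule lin_hom_diff[OF rF lin_hom_id lin_hom_comp[OF cut_hom ext_hom]])
  \<comment> \<open>For \<open>y = E (J c)\<close> this is \<open>y - 1 \<otimes> \<mu>(y)\<close>,
    with \<open>\<mu>\<close> the multiplication onto \<open>W\<close>; the correction is forced by
    \<open>P (E (J c)) = P (J c)\<close>, which need not vanish. It makes \<open>H\<close> an
    S-summand of the free L-module.\<close>
  define \<rho> where "\<rho> c = ?m (E (J c)) (et (P (J c)))" for c
  have \<rho>: "\<rho> \<in> lin_hom S (res ?F) (res ?F)" unfolding \<rho>_def
    by (rule lin_hom_diff[OF rF lin_hom_comp[OF J EF] lin_hom_comp[OF lin_hom_comp[OF J PF] et]])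
  have \<rho>H: "\<rho> c \<in> carrier H" if c: "c \<in> carrier (res ?F)" for c
  proof -
    note j = lin_hom_closed[OF J c]
    have jF: "J c \<in> carrier ?F" using j cF by blast
    note Ej = lin_hom_closed[OF EF j] and Pj = lin_hom_closed[OF PF j]
    note ej = lin_hom_closed[OF et Pj]
    have "P (\<rho> c) = \<zero>\<^bsub>res W\<^esub>"
      unfolding \<rho>_def lin_hom_minus[OF rF rW.left_module_axioms PF Ej ej] PE[OF jF] Pet[OF Pj]
      using Pj by (simp only: rW.minus_eq_zero_iff)
    moreover have "E (\<rho> c) = \<rho> c"
      unfolding \<rho>_def lin_hom_minus[OF rF rF EF Ej ej] EE[OF jF] Eet[OF Pj] ..
    ultimately show ?thesis unfolding cH using lin_hom_closed[OF \<rho> c] cF by auto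
  qed
  have \<rho>_id: "\<rho> x = x" if x: "x \<in> carrier H" for x
  proof -
    have x': "x \<in> carrier (res ?F)" "P x = \<zero>\<^bsub>res W\<^esub>" "E x = x" using x cF by (auto simp: cH)
    note cx = lin_hom_closed[OF cut_hom x'(1)]
    note ec = lin_hom_closed[OF ext_hom cx] and pc = lin_hom_closed[OF p cx]
    define y where "y = et (p (cut x))"
    have y: "y \<in> carrier (res ?F)" unfolding y_def by (rule lin_hom_closed[OF et pc])
    have 1: "E (J x) = ?m x y"
      unfolding J_def lin_hom_minus[OF rF rF EF x'(1) ec] Ee[OF cx] x'(3) y_def ..
    have "P (J x) = a_minus (res W) \<zero>\<^bsub>res W\<^esub> (p (cut x))"
      unfolding J_def lin_hom_minus[OF rF rW.left_module_axioms PF x'(1) ec] Pe[OF cx] x'(2) ..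
    then have 2: "et (P (J x)) = ?m \<zero>\<^bsub>res ?F\<^esub> y"
      using lin_hom_minus[OF rW.left_module_axioms rF et rW.M.zero_closed pc]
        lin_hom_zero[OF rW.left_module_axioms rF et] by (simp only: y_def)
    have "?m (?m x y) (?m \<zero>\<^bsub>res ?F\<^esub> y) = x"
      using x'(1) y
      by (simp only: rF.M.minus_eq rF.M.l_zero rF.M.a_inv_closed rF.M.minus_minus rF.M.a_assoc rF.M.l_neg rF.M.r_zero)
    then show ?thesis by (simp only: \<rho>_def 1 2)
  qed
  have "retract_of S (res H) (res ?F)" unfolding retract_of_def
  proof (intro bexI ballI)
    have "(\<lambda>c. c) \<in> lin_hom L H ?F" unfolding H_def K_def
      by (rule lin_hom_from_ker[OF lin_hom_from_ker[OF lin_hom_id]])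
    then show "(\<lambda>c. c) \<in> lin_hom S (res H) (res ?F)" by (rule lin_hom_res)
    have ops: "add (res H) = add (res ?F)" "smult (res H) = smult (res ?F)" by (simp_all add: H_def K_def)
    show "\<rho> \<in> lin_hom S (res ?F) (res H)"
      by (rule lin_homI)
        (simp_all only: carrier_res[OF H] \<rho>H ops lin_hom_add[OF \<rho>] lin_hom_smult[OF \<rho>])
    show "\<rho> x = x" if "x \<in> carrier (res H)" for x using that \<rho>_id carrier_res[OF H] by blast
  qed
  then have "pd_le S 0 (res H)"
    by (rule pd_le_0_retract[OF pd_le_restrict_free[OF S.ring_axioms L.ring_axioms h projective] left_module_res[OF H]])
  then have "pd_le L 0 H"
  proof (rule pd_le_0_if_annihilated[OF H])
    fix s x assume s: "s \<in> carrier S" and k: "\<And>k. k \<in> carrier L \<Longrightarrow> \<sigma> k = \<zero>\<^bsub>S\<^esub> \<Longrightarrow> h s \<otimes>\<^bsub>L\<^esub> k = \<zero>\<^bsub>L\<^esub>"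
      and x: "x \<in> carrier H"
    have x': "x \<in> carrier (res ?F)" using x cF by (simp add: cH)
    note j = lin_hom_closed[OF J x']
    have jF: "J x \<in> carrier ?F" using j cF by blast
    note cx = lin_hom_closed[OF cut_hom x']
    \<comment> \<open>The entries of \<open>J x\<close> lie in the kernel of \<open>\<sigma>\<close>
      and are killed by \<open>s\<close>. As \<open>\<rho>\<close> fixes \<open>x\<close>, is
      S-linear and depends only on \<open>J x\<close>, \<open>s\<close> kills \<open>x\<close>
      too.\<close>
    have "cut (J x) = \<zero>\<^bsub>?FS\<^esub>"
      unfolding J_def lin_hom_minus[OF rF FS cut_hom x' lin_hom_closed[OF ext_hom cx]] cut_ext[OF cx]
      using cx by (simp only: FS.minus_eq_zero_iff)
    then have "\<sigma> (J x i) = \<zero>\<^bsub>S\<^esub>" for i by (auto simp: cut_def free_module_simps dest: fun_cong)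
    then have "s \<odot>\<^bsub>res ?F\<^esub> J x = \<zero>\<^bsub>res ?F\<^esub>"
      using jF k by (auto simp: free_module_simps fun_eq_iff)
    then have J0: "J (s \<odot>\<^bsub>res ?F\<^esub> x) = \<zero>\<^bsub>res ?F\<^esub>" using lin_hom_smult[OF J s x'] by (simp only:)
    have "s \<odot>\<^bsub>res ?F\<^esub> \<rho> x = \<rho> (s \<odot>\<^bsub>res ?F\<^esub> x)" using lin_hom_smult[OF \<rho> s x'] by (simp only:)
    also have "\<dots> = ?m \<zero>\<^bsub>res ?F\<^esub> \<zero>\<^bsub>res ?F\<^esub>"
      unfolding \<rho>_def J0 lin_hom_zero[OF rF rF EF] lin_hom_zero[OF rF rW.left_module_axioms PF]
        lin_hom_zero[OF rW.left_module_axioms rF et] ..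
    also have "\<dots> = \<zero>\<^bsub>res ?F\<^esub>" by (simp only: rF.minus_eq_zero_iff rF.M.zero_closed)
    finally have "s \<odot>\<^bsub>res ?F\<^esub> x = \<zero>\<^bsub>res ?F\<^esub>" by (simp only: \<rho>_id[OF x])
    then show "h s \<odot>\<^bsub>H\<^esub> x = \<zero>\<^bsub>H\<^esub>" by (simp add: H_def K_def)
  qed
  then have "pd_le L 0 K" by (rule pd_le_ext[OF K EH EHs _ kerE])
  moreover have "free_cover L r W P"
  proof -
    have "P ` carrier ?F = carrier W"
    proof (rule surjI[OF lin_hom_closed[OF P]])
      fix y assume "y \<in> carrier W"
      then have y: "y \<in> carrier (res W)" by (simp only: cW)
      show "\<exists>x\<in>carrier ?F. P x = y" by (rule bexI[where x = "et y"]) (rule Pet[OF y] etF[OF y])+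
    qed
    then show ?thesis using P by (simp add: free_cover_def)
  qed
  ultimately show ?thesis unfolding pd_le_Suc using W by (auto simp: K_def)
qed

text \<open>One L-cover serves over both rings: restricted to \<open>S\<close> its source stays
  projective, so the kernel has bound \<open>n\<close> over \<open>S\<close>. The S-cover only shows
  that an L-cover exists.\<close>

lemma pd_le_extend_Suc:
  assumes IH: "\<And>K :: ('l, nat \<Rightarrow> 'l) module. left_module L K \<Longrightarrow> pd_le S n (res K) \<Longrightarrow> pd_le L (Suc n) K"
    and W: "left_module L W" and n: "pd_le S (Suc n) (res W)"
  shows "pd_le L (Suc (Suc n)) W"
proof -
  obtain r p where p: "free_cover S r (res W) p" using pd_le_cover[OF n] by blast
  obtain P where P: "free_cover L r W P" using cover_extend[OF W p] by blast
  let ?F = "free_module L r"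
  have Ph: "P \<in> lin_hom L ?F W" and Ps: "P ` carrier ?F = carrier W" using P by (auto simp: free_cover_def)
  have F: "left_module L ?F" by (rule left_module_free[OF L.ring_axioms])
  have "pd_le S n (ker_module (res ?F) (res W) P)"
    by (rule pd_le_ker_if_Suc[OF pd_le_restrict_free[OF S.ring_axioms L.ring_axioms h projective]
          lin_hom_res[OF Ph] surj_restrict[OF S.ring_axioms h F Ph Ps] n])
  then have "pd_le L (Suc n) (ker_module ?F W P)"
    by (intro IH left_module_ker[OF F W Ph]) (simp add: ker_restrict)
  then show ?thesis unfolding pd_le_Suc[of L "Suc n"] using W P by blast
qed

lemma pd_le_extend_submodule:
  fixes W :: "('l, nat \<Rightarrow> 'l) module"
  shows "left_module L W \<Longrightarrow> pd_le S n (res W) \<Longrightarrow> pd_le L (Suc n) W"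
proof (induction n arbitrary: W)
  case 0 then show ?case by (rule pd_le_extend_0)
next
  case (Suc n) show ?case by (rule pd_le_extend_Suc[OF Suc.IH Suc.prems])
qed

lemma pd_le_extend:
  assumes "left_module L W" "pd_le S n (res W)" shows "pd_le L (Suc n) W"
proof (cases n)
  case 0 then show ?thesis using assms pd_le_extend_0 by blast
next
  case (Suc m) show ?thesis unfolding Suc
    by (rule pd_le_extend_Suc[OF pd_le_extend_submodule assms(1)]) (use assms(2) Suc in auto)
qed

lemma special_GLIT_split: "special_GLIT L \<longleftrightarrow> special_GLIT S"
proof
  assume "special_GLIT L"
  then obtain d where d: "\<And>n (X :: ('l, (nat \<Rightarrow> 's) set) module). pd_le L n X \<Longrightarrow> pd_le L d X"
    using special_GLIT_bound by metis
  have "pd_le S d X" if X: "pd_le S n X" for n and X :: "'s std_module"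
  proof -
    have LX: "left_module S X" using X by (rule pd_le_left_module)
    have Y: "left_module L (restrict_scalars L \<sigma> X)" by (rule left_module_restrict[OF L.ring_axioms \<sigma> LX])
    have iso: "lin_iso S (res (restrict_scalars L \<sigma> X)) X (\<lambda>x. x) (\<lambda>x. x)"
      by (rule lin_iso_restrict_restrict[OF LX \<sigma>_h \<sigma>_one])
    have "pd_le S n (res (restrict_scalars L \<sigma> X))"
      by (rule pd_le_iso[OF X left_module_res[OF Y] lin_iso_sym[OF iso]])
    \<comment> \<open>The bound for \<open>L\<close> applies only to finite projective dimension,
      which \<open>pd_le_extend\<close> guarantees. Restriction back to \<open>S\<close> costs
      nothing.\<close>
    then have "pd_le L d (restrict_scalars L \<sigma> X)" using d pd_le_extend[OF Y] by blast
    then have "pd_le S d (res (restrict_scalars L \<sigma> X))"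
      by (rule pd_le_restrict[OF S.ring_axioms L.ring_axioms h projective])
    then show ?thesis by (rule pd_le_iso[OF _ LX iso])
  qed
  then show "special_GLIT S" unfolding special_GLIT_iff by blast
next
  assume "special_GLIT S"
  then obtain d where d: "\<And>n (X :: ('s, (nat \<Rightarrow> 'l) set) module). pd_le S n X \<Longrightarrow> pd_le S d X"
    using special_GLIT_bound by metis
  have "pd_le L (Suc d) X" if X: "pd_le L n X" for n and X :: "'l std_module"
    by (rule pd_le_extend[OF pd_le_left_module[OF X]
          d[OF pd_le_restrict[OF S.ring_axioms L.ring_axioms h projective X]]])
  then show "special_GLIT L" unfolding special_GLIT_iff by blast
qed

end

section \<open>Morita rings with vanishing tensor products\<close>

text \<open>The homomorphism induced on the free abelian group kills the defining relations, hence
  \<open>tensor_kernel\<close>. A trivial quotient means that this kernel contains every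
  generator.\<close>

lemma balanced_map_eq_one:
  assumes triv: "trivial_group (tensor_product R M N)" and G: "comm_group G"
    and closed: "\<And>x y. x \<in> carrier M \<Longrightarrow> y \<in> carrier N \<Longrightarrow> f x y \<in> carrier G"
    and add_left: "\<And>x x' y. x \<in> carrier M \<Longrightarrow> x' \<in> carrier M \<Longrightarrow> y \<in> carrier N \<Longrightarrow>
      x \<oplus>\<^bsub>M\<^esub> x' \<in> carrier M \<and> f (x \<oplus>\<^bsub>M\<^esub> x') y = f x y \<otimes>\<^bsub>G\<^esub> f x' y"
    and add_right: "\<And>x y y'. x \<in> carrier M \<Longrightarrow> y \<in> carrier N \<Longrightarrow> y' \<in> carrier N \<Longrightarrow>
      y \<oplus>\<^bsub>N\<^esub> y' \<in> carrier N \<and> f x (y \<oplus>\<^bsub>N\<^esub> y') = f x y \<otimes>\<^bsub>G\<^esub> f x y'"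
    and balanced: "\<And>x r y. x \<in> carrier M \<Longrightarrow> r \<in> carrier R \<Longrightarrow> y \<in> carrier N \<Longrightarrow>
      x \<odot>\<^sub>r\<^bsub>M\<^esub> r \<in> carrier M \<and> r \<odot>\<^bsub>N\<^esub> y \<in> carrier N \<and> f (x \<odot>\<^sub>r\<^bsub>M\<^esub> r) y = f x (r \<odot>\<^bsub>N\<^esub> y)"
    and x: "x \<in> carrier M" and y: "y \<in> carrier N"
  shows "f x y = \<one>\<^bsub>G\<^esub>"
proof -
  interpret G: comm_group G by fact
  define B where "B = carrier M \<times> carrier N"
  let ?F = "free_Abelian_group B"
  have "(\<lambda>(x, y). f x y) ` B \<subseteq> carrier G" using closed by (auto simp: B_def)
  then obtain \<phi> where \<phi>: "\<phi> \<in> hom ?F G" and \<phi>f: "\<And>b. b \<in> B \<Longrightarrow> \<phi> (frag_of b) = (\<lambda>(x, y). f x y) b"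
    using G.free_Abelian_group_universal[of "\<lambda>(x, y). f x y" B] by blast
  interpret \<phi>: group_hom ?F G \<phi>
    by (intro group_hom.intro group_hom_axioms.intro \<phi> group_free_Abelian_group G.is_group)
  have cl: "Poly_Mapping.keys a \<subseteq> B \<Longrightarrow> \<phi> a \<in> carrier G" for a using \<phi>.hom_closed by simp
  have fr: "b \<in> B \<Longrightarrow> Poly_Mapping.keys (frag_of b) \<subseteq> B" for b by simp
  \<comment> \<open>Turns the equation \<open>\<phi> a = \<phi> b \<otimes> c\<close> into
    \<open>\<phi> (a - b) = c\<close>, so each relation is checked without inverses in
    \<open>G\<close>.\<close>
  have diff: "Poly_Mapping.keys (a - b) \<subseteq> B \<and> (\<phi> a = \<phi> b \<otimes>\<^bsub>G\<^esub> c \<and> c \<in> carrier G \<longrightarrow> \<phi> (a - b) = c)"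
    if a: "Poly_Mapping.keys a \<subseteq> B" and b: "Poly_Mapping.keys b \<subseteq> B" for a b c
  proof -
    have ab: "Poly_Mapping.keys (a - b) \<subseteq> B" using keys_diff[of a b] a b by blast
    have "\<phi> (b + (a - b)) = \<phi> b \<otimes>\<^bsub>G\<^esub> \<phi> (a - b)" using \<phi>.hom_mult[of b "a - b"] b ab by simp
    then show ?thesis using ab cl[OF b] cl[OF ab] G.Units_l_cancel[of "\<phi> b" "\<phi> (a - b)" c] G.Units_eq by auto
  qed
  have "tensor_relations R M N \<subseteq> kernel ?F G \<phi>"
  proof
    fix z assume "z \<in> tensor_relations R M N"
    then consider (l) x x' y where "z = frag_of (x \<oplus>\<^bsub>M\<^esub> x', y) - frag_of (x, y) - frag_of (x', y)"
        "x \<in> carrier M" "x' \<in> carrier M" "y \<in> carrier N"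
      | (r) x y y' where "z = frag_of (x, y \<oplus>\<^bsub>N\<^esub> y') - frag_of (x, y) - frag_of (x, y')"
        "x \<in> carrier M" "y \<in> carrier N" "y' \<in> carrier N"
      | (b) x r y where "z = frag_of (x \<odot>\<^sub>r\<^bsub>M\<^esub> r, y) - frag_of (x, r \<odot>\<^bsub>N\<^esub> y)"
        "x \<in> carrier M" "r \<in> carrier R" "y \<in> carrier N"
      unfolding tensor_relations_def by blast
    then show "z \<in> kernel ?F G \<phi>"
    proof cases
      case l
      have B: "(x \<oplus>\<^bsub>M\<^esub> x', y) \<in> B" "(x, y) \<in> B" "(x', y) \<in> B" using l add_left by (auto simp: B_def)
      have 1: "Poly_Mapping.keys (frag_of (x \<oplus>\<^bsub>M\<^esub> x', y) - frag_of (x, y)) \<subseteq> B"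
        "\<phi> (frag_of (x \<oplus>\<^bsub>M\<^esub> x', y) - frag_of (x, y)) = f x' y"
        using diff[OF fr[OF B(1)] fr[OF B(2)], of "f x' y"] l add_left closed \<phi>f B by auto
      show ?thesis using diff[OF 1(1) fr[OF B(3)], of "\<one>\<^bsub>G\<^esub>"] 1 l closed \<phi>f B by (auto simp: kernel_def)
    next
      case r
      have B: "(x, y \<oplus>\<^bsub>N\<^esub> y') \<in> B" "(x, y) \<in> B" "(x, y') \<in> B" using r add_right by (auto simp: B_def)
      have 1: "Poly_Mapping.keys (frag_of (x, y \<oplus>\<^bsub>N\<^esub> y') - frag_of (x, y)) \<subseteq> B"
        "\<phi> (frag_of (x, y \<oplus>\<^bsub>N\<^esub> y') - frag_of (x, y)) = f x y'"
        using diff[OF fr[OF B(1)] fr[OF B(2)], of "f x y'"] r add_right closed \<phi>f B by auto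
      show ?thesis using diff[OF 1(1) fr[OF B(3)], of "\<one>\<^bsub>G\<^esub>"] 1 r closed \<phi>f B by (auto simp: kernel_def)
    next
      case b
      have B: "(x \<odot>\<^sub>r\<^bsub>M\<^esub> r, y) \<in> B" "(x, r \<odot>\<^bsub>N\<^esub> y) \<in> B" using b balanced by (auto simp: B_def)
      show ?thesis using diff[OF fr[OF B(1)] fr[OF B(2)], of "\<one>\<^bsub>G\<^esub>"] b balanced closed \<phi>f B by (auto simp: kernel_def)
    qed
  qed
  then have K: "tensor_kernel R M N \<subseteq> kernel ?F G \<phi>"
    unfolding tensor_kernel_def B_def[symmetric]
    by (rule \<phi>.G.generate_subgroup_incl[OF _ \<phi>.subgroup_kernel])
  have xy: "(x, y) \<in> B" using x y by (simp add: B_def)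
  have "tensor_kernel R M N #>\<^bsub>?F\<^esub> frag_of (x, y) \<in> carrier (tensor_product R M N)"
    using xy unfolding tensor_product_def B_def[symmetric] carrier_FactGroup by (intro imageI) simp
  moreover have "carrier (tensor_product R M N) = {tensor_kernel R M N}"
    using triv unfolding trivial_group_def tensor_product_def by simp
  \<comment> \<open>The coset of a generator contains the generator; by triviality that coset is the
    kernel itself.\<close>
  moreover have "frag_of (x, y) \<in> tensor_kernel R M N #>\<^bsub>?F\<^esub> frag_of (x, y)"
  proof -
    have "0 \<in> tensor_kernel R M N"
      using generate.one[of ?F] unfolding tensor_kernel_def B_def[symmetric] by simp
    then show ?thesis unfolding r_coset_def by force
  qed
  ultimately have "frag_of (x, y) \<in> kernel ?F G \<phi>" using K by auto
  then show ?thesis using \<phi>f[OF xy] by (simp add: kernel_def)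
qed

lemma tensor_hom_eq_zero:
  assumes triv: "trivial_group (tensor_product R M N)" and L: "ring L"
    and f: "f \<in> hom (tensor_product R M N) (add_monoid L)"
    and x: "x \<in> carrier M" and y: "y \<in> carrier N"
  shows "f (pure_tensor R M N x y) = \<zero>\<^bsub>L\<^esub>"
proof -
  interpret ring L by fact
  have "pure_tensor R M N x y \<in> carrier (tensor_product R M N)"
    unfolding pure_tensor_def tensor_product_def carrier_FactGroup using x y by (intro imageI) simp
  then have 1: "pure_tensor R M N x y = \<one>\<^bsub>tensor_product R M N\<^esub>"
    using triv by (simp add: trivial_group_def)
  have "group (tensor_product R M N)" using triv by (simp add: trivial_group_def)
  then have "f \<one>\<^bsub>tensor_product R M N\<^esub> = \<one>\<^bsub>add_monoid L\<^esub>"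
    using hom_one[OF f _ add.is_group] by blast
  then show ?thesis by (simp add: 1)
qed

section \<open>Finite generation and dual bases\<close>

lemma lin_comb_additive:
  assumes X: "left_module R X" and p0: "p \<zero>\<^bsub>X\<^esub> = \<zero>\<^bsub>Y\<^esub>"
    and add: "\<And>x y. x \<in> carrier X \<Longrightarrow> y \<in> carrier X \<Longrightarrow> p (x \<oplus>\<^bsub>X\<^esub> y) = p x \<oplus>\<^bsub>Y\<^esub> p y"
    and smult: "\<And>c x. c \<in> carrier R \<Longrightarrow> x \<in> carrier X \<Longrightarrow> p (c \<odot>\<^bsub>X\<^esub> x) = \<gamma> c \<odot>\<^bsub>Y\<^esub> p x"
  shows "(\<And>i. i < r \<Longrightarrow> c i \<in> carrier R) \<Longrightarrow> (\<And>i. i < r \<Longrightarrow> v i \<in> carrier X) \<Longrightarrow>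
    p (lin_comb X r c v) = lin_comb Y r (\<lambda>i. \<gamma> (c i)) (\<lambda>i. p (v i))"
proof (induction r)
  case 0 then show ?case by (simp add: p0)
next
  case (Suc r)
  interpret X: left_module R X by fact
  show ?case using Suc by (simp add: add smult X.lin_comb_closed)
qed

text \<open>\<open>A\<close> is finitely spanned over a central subring, and \<open>p\<close>
  converts its scalars \<open>c\<close> into \<open>\<gamma> c\<close>, so the images of the
  spanning elements generate \<open>X\<close>. The rule is asked of central \<open>c\<close> only:
  in a matrix product with non-diagonal \<open>c\<close>, an off-diagonal entry can receive a second
  summand.\<close>

lemma artin_algebra_fin_gen:
  assumes A: "artin_algebra A" and X: "left_module R X"
    and p: "\<And>x. x \<in> carrier A \<Longrightarrow> p x \<in> carrier X" "\<And>y. y \<in> carrier X \<Longrightarrow> \<exists>x\<in>carrier A. p x = y"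
    and p0: "p \<zero>\<^bsub>A\<^esub> = \<zero>\<^bsub>X\<^esub>"
    and add: "\<And>x y. x \<in> carrier A \<Longrightarrow> y \<in> carrier A \<Longrightarrow> p (x \<oplus>\<^bsub>A\<^esub> y) = p x \<oplus>\<^bsub>X\<^esub> p y"
    and smult: "\<And>c x. c \<in> carrier A \<Longrightarrow> (\<And>a. a \<in> carrier A \<Longrightarrow> c \<otimes>\<^bsub>A\<^esub> a = a \<otimes>\<^bsub>A\<^esub> c) \<Longrightarrow> x \<in> carrier A \<Longrightarrow>
       \<gamma> c \<in> carrier R \<and> p (c \<otimes>\<^bsub>A\<^esub> x) = \<gamma> c \<odot>\<^bsub>X\<^esub> p x"
  shows "fin_gen R X"
proof -
  interpret X: left_module R X by fact
  obtain C where A': "ring A" and C: "subcring C A" "\<forall>c\<in>C. \<forall>a\<in>carrier A. c \<otimes>\<^bsub>A\<^esub> a = a \<otimes>\<^bsub>A\<^esub> c"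
    "artinian_cring (A\<lparr>carrier := C\<rparr>)" "fin_gen (A\<lparr>carrier := C\<rparr>) (regular_module A)"
    using A unfolding artin_algebra_def by blast
  interpret A: ring A by fact
  let ?C = "A\<lparr>carrier := C\<rparr>"
  interpret C: cring ?C using C(3) by (simp add: artinian_cring_def)
  have sub: "C \<subseteq> carrier A" using subcring.axioms(1)[OF C(1)] subring.axioms(1) subgroup.subset by fastforce
  have regA: "left_module ?C (regular_module A)"
    by (rule left_moduleI[OF C.ring_axioms])
      (use sub in \<open>auto simp: A.a_ac A.l_distr A.r_distr A.m_assoc subset_iff
         intro: A.a_inv_closed A.l_neg bexI[of _ "\<ominus>\<^bsub>A\<^esub> _"]\<close>)
  obtain r q where q: "free_cover ?C r (regular_module A) q"
    using fin_gen_imp_free_cover[OF regA C(4)] by blast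
  have qh: "q \<in> lin_hom ?C (free_module ?C r) (regular_module A)"
    and qs: "q ` carrier (free_module ?C r) = carrier A" using q by (auto simp: free_cover_def)
  define v where "v = (\<lambda>i. q (unit_vec ?C i))"
  have v: "v i \<in> carrier A" if "i < r" for i
    using lin_hom_closed[OF qh unit_vec_closed[OF C.ring_axioms that]] by (simp add: v_def)
  have central: "c \<otimes>\<^bsub>A\<^esub> a = a \<otimes>\<^bsub>A\<^esub> c" if "c \<in> C" "a \<in> carrier A" for c a using C(2) that by blast
  have sm: "\<gamma> c \<in> carrier R" "x \<in> carrier A \<Longrightarrow> p (c \<otimes>\<^bsub>A\<^esub> x) = \<gamma> c \<odot>\<^bsub>X\<^esub> p x" if c: "c \<in> C" for c x
    using smult[OF _ central[OF c]] A.zero_closed sub c by blast+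
  have "\<exists>c\<in>carrier (free_module R r). lin_comb X r c (\<lambda>i. p (v i)) = y" if y: "y \<in> carrier X" for y
  proof -
    obtain x where x: "x \<in> carrier A" "p x = y" using p(2)[OF y] by blast
    obtain c where c: "c \<in> carrier (free_module ?C r)" "q c = x" using surjE[OF qs x(1)] by blast
    have cC: "c i \<in> C" for i using c(1) by (simp add: free_module_simps)
    have "x = lin_comb (regular_module A) r c v"
      using free_module_hom_eq[OF regA qh c(1)] c(2) by (simp add: v_def)
    then have "y = lin_comb X r (\<lambda>i. \<gamma> (c i)) (\<lambda>i. p (v i))"
      using lin_comb_additive[OF regA, of p X \<gamma> r c v] p0 add sm cC v x(2) by simp
    \<comment> \<open>A coefficient vector must vanish from \<open>r\<close> on, while
      \<open>\<gamma>\<close> is not known to send zero to zero.\<close>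
    also have "\<dots> = lin_comb X r (\<lambda>i. if i < r then \<gamma> (c i) else \<zero>\<^bsub>R\<^esub>) (\<lambda>i. p (v i))"
      by (rule lin_comb_cong) auto
    finally show ?thesis
      using sm(1)[OF cC] by (intro bexI[of _ "\<lambda>i. if i < r then \<gamma> (c i) else \<zero>\<^bsub>R\<^esub>"]) (auto simp: free_module_simps)
  qed
  then have "free_cover R r X (\<lambda>c. lin_comb X r c (\<lambda>i. p (v i)))"
    unfolding free_cover_def using p(1) v
    by (intro conjI X.lin_comb_lin_hom surjI lin_hom_closed[OF X.lin_comb_lin_hom]) auto
  then show ?thesis by (rule free_cover_imp_fin_gen[OF X])
qed

lemma op_ring_simps [simp]:
  "carrier (op_ring R) = carrier R" "add (op_ring R) = add R" "\<zero>\<^bsub>op_ring R\<^esub> = \<zero>\<^bsub>R\<^esub>"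
  "\<one>\<^bsub>op_ring R\<^esub> = \<one>\<^bsub>R\<^esub>" "mult (op_ring R) = (\<lambda>a b. b \<otimes>\<^bsub>R\<^esub> a)"
  by (simp_all add: op_ring_def)

lemma right_part_simps [simp]:
  "carrier (right_part M) = carrier M" "add (right_part M) = add M" "\<zero>\<^bsub>right_part M\<^esub> = \<zero>\<^bsub>M\<^esub>"
  "smult (right_part M) = (\<lambda>b x. x \<odot>\<^sub>r\<^bsub>M\<^esub> b)"
  by (simp_all add: right_part_def)

text \<open>The forms are the coordinates of an inclusion into a free module, and the vectors are
  the images of the unit vectors under its retraction.\<close>

lemma dual_basis:
  assumes P: "pd_le (op_ring R) 0 (right_part M)"
  obtains r a \<phi> where "\<And>i. i < r \<Longrightarrow> a i \<in> carrier M"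
    "\<And>i x. x \<in> carrier M \<Longrightarrow> \<phi> i x \<in> carrier R"
    "\<And>i x y. x \<in> carrier M \<Longrightarrow> y \<in> carrier M \<Longrightarrow> \<phi> i (x \<oplus>\<^bsub>M\<^esub> y) = \<phi> i x \<oplus>\<^bsub>R\<^esub> \<phi> i y"
    "\<And>i x s. x \<in> carrier M \<Longrightarrow> s \<in> carrier R \<Longrightarrow> \<phi> i (x \<odot>\<^sub>r\<^bsub>M\<^esub> s) = \<phi> i x \<otimes>\<^bsub>R\<^esub> s"
    "\<And>x. x \<in> carrier M \<Longrightarrow> x = lin_comb (right_part M) r (\<lambda>i. \<phi> i x) a"
proof -
  have L: "left_module (op_ring R) (right_part M)" using P by (rule pd_le_left_module)
  have R: "ring (op_ring R)" using L by (rule left_module_ring)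
  obtain r f q where f: "f \<in> lin_hom (op_ring R) (right_part M) (free_module (op_ring R) r)"
      and q: "q \<in> lin_hom (op_ring R) (free_module (op_ring R) r) (right_part M)"
      and qf: "\<forall>x\<in>carrier M. q (f x) = x"
    using P by (auto simp: pd_le_0 retract_of_def)
  show ?thesis
  proof (rule that)
    show "q (unit_vec (op_ring R) i) \<in> carrier M" if "i < r" for i
      using lin_hom_closed[OF q unit_vec_closed[OF R that]] by simp
    show "f x i \<in> carrier R" if "x \<in> carrier M" for i x
      using lin_hom_closed[OF f, of x] that by (simp add: free_module_simps)
    show "f (x \<oplus>\<^bsub>M\<^esub> y) i = f x i \<oplus>\<^bsub>R\<^esub> f y i" if "x \<in> carrier M" "y \<in> carrier M" for i x y
      using lin_hom_add[OF f, of x y] that by (simp add: free_module_simps)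
    show "f (x \<odot>\<^sub>r\<^bsub>M\<^esub> s) i = f x i \<otimes>\<^bsub>R\<^esub> s" if "x \<in> carrier M" "s \<in> carrier R" for i x s
      using lin_hom_smult[OF f, of s x] that by (simp add: free_module_simps)
    show "x = lin_comb (right_part M) r (\<lambda>i. f x i) (\<lambda>i. q (unit_vec (op_ring R) i))" if "x \<in> carrier M" for x
      using free_module_hom_eq[OF L q lin_hom_closed[OF f, of x]] that qf by simp
  qed
qed

text \<open>The map \<open>x \<otimes> y \<mapsto> \<phi> x y\<close> is defined on the zero group.\<close>

lemma right_linear_form_annihilates:
  assumes triv: "trivial_group (tensor_product R M N)"
    and M: "left_module (op_ring R) (right_part M)" and N: "left_module R N"
    and \<phi>: "\<And>x. x \<in> carrier M \<Longrightarrow> \<phi> x \<in> carrier R"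
      "\<And>x y. x \<in> carrier M \<Longrightarrow> y \<in> carrier M \<Longrightarrow> \<phi> (x \<oplus>\<^bsub>M\<^esub> y) = \<phi> x \<oplus>\<^bsub>R\<^esub> \<phi> y"
      "\<And>x s. x \<in> carrier M \<Longrightarrow> s \<in> carrier R \<Longrightarrow> \<phi> (x \<odot>\<^sub>r\<^bsub>M\<^esub> s) = \<phi> x \<otimes>\<^bsub>R\<^esub> s"
    and x: "x \<in> carrier M" and y: "y \<in> carrier N"
  shows "\<phi> x \<odot>\<^bsub>N\<^esub> y = \<zero>\<^bsub>N\<^esub>"
proof -
  interpret M: left_module "op_ring R" "right_part M" by fact
  interpret N: left_module R N by fact
  have "\<phi> x \<odot>\<^bsub>N\<^esub> y = \<one>\<^bsub>add_monoid N\<^esub>"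
  proof (rule balanced_map_eq_one[OF triv N.M.a_comm_group, where f = "\<lambda>x y. \<phi> x \<odot>\<^bsub>N\<^esub> y"])
    fix x x' y assume "x \<in> carrier M" "x' \<in> carrier M" "y \<in> carrier N"
    then show "x \<oplus>\<^bsub>M\<^esub> x' \<in> carrier M \<and> \<phi> (x \<oplus>\<^bsub>M\<^esub> x') \<odot>\<^bsub>N\<^esub> y = (\<phi> x \<odot>\<^bsub>N\<^esub> y) \<otimes>\<^bsub>add_monoid N\<^esub> (\<phi> x' \<odot>\<^bsub>N\<^esub> y)"
      using M.M.a_closed[of x x'] by (simp add: \<phi> N.smult_l_distr)
  next
    fix x s y assume "x \<in> carrier M" "s \<in> carrier R" "y \<in> carrier N"
    then show "x \<odot>\<^sub>r\<^bsub>M\<^esub> s \<in> carrier M \<and> s \<odot>\<^bsub>N\<^esub> y \<in> carrier N \<and> \<phi> (x \<odot>\<^sub>r\<^bsub>M\<^esub> s) \<odot>\<^bsub>N\<^esub> y = \<phi> x \<odot>\<^bsub>N\<^esub> (s \<odot>\<^bsub>N\<^esub> y)"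
      using M.smult_closed[of s x] by (simp add: \<phi> N.smult_assoc)
  qed (use x y in \<open>auto simp: \<phi> N.smult_r_distr\<close>)
  then show ?thesis by simp
qed

section \<open>The Morita ring as a split extension\<close>

locale morita_zero_tensor = morita_context T N M U \<alpha> \<beta>
  for T :: "('t, 'c) ring_scheme" and N :: "('t, 'n, 'u) bimodule" and M :: "('u, 'm, 't) bimodule"
    and U :: "('u, 'd) ring_scheme" and \<alpha> \<beta> +
  assumes artin: "artin_algebra (morita_ring T N M U \<alpha> \<beta>)"
    and proj_M: "projective_module U M" "projective_module (op_ring T) (right_part M)"
    and proj_N: "projective_module T N" "projective_module (op_ring U) (right_part N)"
    and tensor_zero: "trivial_group (tensor_product T M N)" "trivial_group (tensor_product U N M)"
begin

abbreviation "\<Lambda> \<equiv> morita_ring T N M U \<alpha> \<beta>"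

sublocale T: ring T using artin_T by (simp add: artin_algebra_def)
sublocale U: ring U using artin_U by (simp add: artin_algebra_def)
sublocale L: ring \<Lambda> using artin by (simp add: artin_algebra_def)
sublocale N: left_module T N using bimodule_N by (simp add: bimodule_def)
sublocale M: left_module U M using bimodule_M by (simp add: bimodule_def)
sublocale rN: left_module "op_ring U" "right_part N" using bimodule_N by (simp add: bimodule_def)
sublocale rM: left_module "op_ring T" "right_part M" using bimodule_M by (simp add: bimodule_def)

lemmas right_N = rN.smult_closed[simplified] rN.smult_zero_left[simplified] rN.smult_zero_right[simplified]
  rN.smult_one[simplified]
lemmas right_M = rM.smult_closed[simplified] rM.smult_zero_left[simplified] rM.smult_zero_right[simplified]
  rM.smult_one[simplified]

lemma \<beta>_zero: "n \<in> carrier N \<Longrightarrow> m \<in> carrier M \<Longrightarrow> \<beta> (pure_tensor U N M n m) = \<zero>\<^bsub>T\<^esub>"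
  using beta tensor_hom_eq_zero[OF tensor_zero(2) T.ring_axioms] by (simp add: tensor_bimodule_hom_def)

lemma \<alpha>_zero: "m \<in> carrier M \<Longrightarrow> n \<in> carrier N \<Longrightarrow> \<alpha> (pure_tensor T M N m n) = \<zero>\<^bsub>U\<^esub>"
  using alpha tensor_hom_eq_zero[OF tensor_zero(1) U.ring_axioms] by (simp add: tensor_bimodule_hom_def)

lemma carrier_L: "carrier \<Lambda> = carrier T \<times> carrier N \<times> carrier M \<times> carrier U"
  and zero_L: "\<zero>\<^bsub>\<Lambda>\<^esub> = (\<zero>\<^bsub>T\<^esub>, \<zero>\<^bsub>N\<^esub>, \<zero>\<^bsub>M\<^esub>, \<zero>\<^bsub>U\<^esub>)"
  and one_L: "\<one>\<^bsub>\<Lambda>\<^esub> = (\<one>\<^bsub>T\<^esub>, \<zero>\<^bsub>N\<^esub>, \<zero>\<^bsub>M\<^esub>, \<one>\<^bsub>U\<^esub>)"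
  and add_L: "(t, n, m, u) \<oplus>\<^bsub>\<Lambda>\<^esub> (t', n', m', u') =
    (t \<oplus>\<^bsub>T\<^esub> t', n \<oplus>\<^bsub>N\<^esub> n', m \<oplus>\<^bsub>M\<^esub> m', u \<oplus>\<^bsub>U\<^esub> u')"
  by (simp_all add: morita_ring_def)

lemma mult_L:
  assumes "t \<in> carrier T" "n \<in> carrier N" "m \<in> carrier M" "u \<in> carrier U"
    "t' \<in> carrier T" "n' \<in> carrier N" "m' \<in> carrier M" "u' \<in> carrier U"
  shows "(t, n, m, u) \<otimes>\<^bsub>\<Lambda>\<^esub> (t', n', m', u') =
    (t \<otimes>\<^bsub>T\<^esub> t', t \<odot>\<^bsub>N\<^esub> n' \<oplus>\<^bsub>N\<^esub> n \<odot>\<^sub>r\<^bsub>N\<^esub> u', m \<odot>\<^sub>r\<^bsub>M\<^esub> t' \<oplus>\<^bsub>M\<^esub> u \<odot>\<^bsub>M\<^esub> m', u \<otimes>\<^bsub>U\<^esub> u')"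
  using assms by (simp add: morita_ring_def \<beta>_zero \<alpha>_zero)

text \<open>Commuting with the idempotent that has the unit of \<open>T\<close> as its only nonzero
  entry kills both off-diagonal entries.\<close>

lemma central_diagonal:
  assumes c: "(t, n, m, u) \<in> carrier \<Lambda>"
    and central: "\<And>a. a \<in> carrier \<Lambda> \<Longrightarrow> (t, n, m, u) \<otimes>\<^bsub>\<Lambda>\<^esub> a = a \<otimes>\<^bsub>\<Lambda>\<^esub> (t, n, m, u)"
  shows "n = \<zero>\<^bsub>N\<^esub>" "m = \<zero>\<^bsub>M\<^esub>"
  using central[of "(\<one>\<^bsub>T\<^esub>, \<zero>\<^bsub>N\<^esub>, \<zero>\<^bsub>M\<^esub>, \<zero>\<^bsub>U\<^esub>)"] c
  by (auto simp: carrier_L mult_L right_N right_M)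

text \<open>\<open>N\<close> is the image of \<open>\<Lambda>\<close> under an entry map, and a
  central element, being diagonal, acts on that entry through its component in
  \<open>T\<close>.\<close>

lemma fin_gen_N: "fin_gen T N"
proof (rule artin_algebra_fin_gen[OF artin N.left_module_axioms,
      where p = "\<lambda>(t, n, m, u). n" and \<gamma> = "\<lambda>(t, n, m, u). t"])
  fix c x assume c: "c \<in> carrier \<Lambda>" "\<And>a. a \<in> carrier \<Lambda> \<Longrightarrow> c \<otimes>\<^bsub>\<Lambda>\<^esub> a = a \<otimes>\<^bsub>\<Lambda>\<^esub> c" and x: "x \<in> carrier \<Lambda>"
  obtain t n m u where c': "c = (t, n, m, u)" by (cases c)
  have "n = \<zero>\<^bsub>N\<^esub>" "m = \<zero>\<^bsub>M\<^esub>" using central_diagonal c unfolding c' by blast+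
  then show "(case c of (t, n, m, u) \<Rightarrow> t) \<in> carrier T \<and>
      (case c \<otimes>\<^bsub>\<Lambda>\<^esub> x of (t, n, m, u) \<Rightarrow> n) = (case c of (t, n, m, u) \<Rightarrow> t) \<odot>\<^bsub>N\<^esub> (case x of (t, n, m, u) \<Rightarrow> n)"
    using c(1) x by (auto simp: c' carrier_L mult_L right_N)
qed (auto simp: carrier_L zero_L add_L)

lemma fin_gen_M: "fin_gen U M"
proof (rule artin_algebra_fin_gen[OF artin M.left_module_axioms,
      where p = "\<lambda>(t, n, m, u). m" and \<gamma> = "\<lambda>(t, n, m, u). u"])
  fix c x assume c: "c \<in> carrier \<Lambda>" "\<And>a. a \<in> carrier \<Lambda> \<Longrightarrow> c \<otimes>\<^bsub>\<Lambda>\<^esub> a = a \<otimes>\<^bsub>\<Lambda>\<^esub> c" and x: "x \<in> carrier \<Lambda>"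
  obtain t n m u where c': "c = (t, n, m, u)" by (cases c)
  have "n = \<zero>\<^bsub>N\<^esub>" "m = \<zero>\<^bsub>M\<^esub>" using central_diagonal c unfolding c' by blast+
  then show "(case c of (t, n, m, u) \<Rightarrow> u) \<in> carrier U \<and>
      (case c \<otimes>\<^bsub>\<Lambda>\<^esub> x of (t, n, m, u) \<Rightarrow> m) = (case c of (t, n, m, u) \<Rightarrow> u) \<odot>\<^bsub>M\<^esub> (case x of (t, n, m, u) \<Rightarrow> m)"
    using c(1) x by (auto simp: c' carrier_L mult_L right_M)
qed (auto simp: carrier_L zero_L add_L)

lemma fin_gen_right_N: "fin_gen (op_ring U) (right_part N)"
proof (rule artin_algebra_fin_gen[OF artin rN.left_module_axioms,
      where p = "\<lambda>(t, n, m, u). n" and \<gamma> = "\<lambda>(t, n, m, u). u"])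
  fix c x assume c: "c \<in> carrier \<Lambda>" "\<And>a. a \<in> carrier \<Lambda> \<Longrightarrow> c \<otimes>\<^bsub>\<Lambda>\<^esub> a = a \<otimes>\<^bsub>\<Lambda>\<^esub> c" and x: "x \<in> carrier \<Lambda>"
  obtain t n m u where c': "c = (t, n, m, u)" by (cases c)
  have "n = \<zero>\<^bsub>N\<^esub>" "m = \<zero>\<^bsub>M\<^esub>" using central_diagonal c unfolding c' by blast+
  then show "(case c of (t, n, m, u) \<Rightarrow> u) \<in> carrier (op_ring U) \<and>
      (case c \<otimes>\<^bsub>\<Lambda>\<^esub> x of (t, n, m, u) \<Rightarrow> n) =
      (case c of (t, n, m, u) \<Rightarrow> u) \<odot>\<^bsub>right_part N\<^esub> (case x of (t, n, m, u) \<Rightarrow> n)"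
    \<comment> \<open>Centrality rewrites \<open>c x\<close> as \<open>x c\<close>, where the
      component of \<open>c\<close> in \<open>U\<close> acts from the right.\<close>
    unfolding c(2)[OF x] using c(1) x by (auto simp: c' carrier_L mult_L right_N)
qed (auto simp: carrier_L zero_L add_L)

lemma fin_gen_right_M: "fin_gen (op_ring T) (right_part M)"
proof (rule artin_algebra_fin_gen[OF artin rM.left_module_axioms,
      where p = "\<lambda>(t, n, m, u). m" and \<gamma> = "\<lambda>(t, n, m, u). t"])
  fix c x assume c: "c \<in> carrier \<Lambda>" "\<And>a. a \<in> carrier \<Lambda> \<Longrightarrow> c \<otimes>\<^bsub>\<Lambda>\<^esub> a = a \<otimes>\<^bsub>\<Lambda>\<^esub> c" and x: "x \<in> carrier \<Lambda>"
  obtain t n m u where c': "c = (t, n, m, u)" by (cases c)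
  have "n = \<zero>\<^bsub>N\<^esub>" "m = \<zero>\<^bsub>M\<^esub>" using central_diagonal c unfolding c' by blast+
  then show "(case c of (t, n, m, u) \<Rightarrow> t) \<in> carrier (op_ring T) \<and>
      (case c \<otimes>\<^bsub>\<Lambda>\<^esub> x of (t, n, m, u) \<Rightarrow> m) =
      (case c of (t, n, m, u) \<Rightarrow> t) \<odot>\<^bsub>right_part M\<^esub> (case x of (t, n, m, u) \<Rightarrow> m)"
    unfolding c(2)[OF x] using c(1) x by (auto simp: c' carrier_L mult_L right_M)
qed (auto simp: carrier_L zero_L add_L)

lemmas pd_le_N = projective_fg_imp_pd_le_0[OF proj_N(1) fin_gen_N]
  and pd_le_M = projective_fg_imp_pd_le_0[OF proj_M(1) fin_gen_M]
  and pd_le_right_N = projective_fg_imp_pd_le_0[OF proj_N(2) fin_gen_right_N]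
  and pd_le_right_M = projective_fg_imp_pd_le_0[OF proj_M(2) fin_gen_right_M]

definition diag :: "'t \<times> 'u \<Rightarrow> 't \<times> 'n \<times> 'm \<times> 'u" where
  "diag = (\<lambda>(t, u). (t, \<zero>\<^bsub>N\<^esub>, \<zero>\<^bsub>M\<^esub>, u))"

definition diag_part :: "'t \<times> 'n \<times> 'm \<times> 'u \<Rightarrow> 't \<times> 'u" where
  "diag_part = (\<lambda>(t, n, m, u). (t, u))"

lemma diag_hom: "diag \<in> rng_hom (RDirProd T U) \<Lambda>"
  by (auto simp: rng_hom_def diag_def carrier_L add_L mult_L right_N right_M)

lemma diag_part_hom: "diag_part \<in> rng_hom \<Lambda> (RDirProd T U)"
  by (auto simp: rng_hom_def diag_part_def carrier_L add_L mult_L)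

text \<open>As a left module over \<open>T \<times> U\<close> the ring is
  \<open>(T \<times> U) \<oplus> N \<oplus> M\<close>, with \<open>N\<close> a module through the
  first factor and \<open>M\<close> through the second. The three projective pieces are assembled by
  two extensions.\<close>

lemma pd_le_L: "pd_le (RDirProd T U) 0 (restrict_scalars (RDirProd T U) diag (regular_module \<Lambda>))"
proof -
  let ?S = "RDirProd T U"
  have S: "ring ?S" by (rule RDirProd_ring[OF T.ring_axioms U.ring_axioms])
  define X where "X = restrict_scalars ?S diag (regular_module \<Lambda>)"
  have X: "left_module ?S X" unfolding X_def
    by (rule left_module_restrict[OF S diag_hom left_module_regular[OF L.ring_axioms]])
  have cX: "carrier X = carrier T \<times> carrier N \<times> carrier M \<times> carrier U"
    by (auto simp: X_def restrict_scalars_simps(1) diag_def carrier_L mult_L right_N right_M)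
  have oX: "add X = add \<Lambda>" "smult X = (\<lambda>s x. diag s \<otimes>\<^bsub>\<Lambda>\<^esub> x)" "\<zero>\<^bsub>X\<^esub> = \<zero>\<^bsub>\<Lambda>\<^esub>"
    by (simp_all add: X_def)
  have f: "diag_part \<in> lin_hom ?S X (regular_module ?S)"
    by (rule lin_homI) (auto simp: cX oX diag_part_def diag_def add_L mult_L)
  have fs: "diag_part ` carrier X = carrier (regular_module ?S)"
    by (rule surjI[OF lin_hom_closed[OF f]]) (auto simp: cX diag_part_def)
  define K where "K = ker_module X (regular_module ?S) diag_part"
  have K: "left_module ?S K" unfolding K_def by (rule left_module_ker[OF X left_module_regular[OF S] f])
  have cK: "carrier K = {\<zero>\<^bsub>T\<^esub>} \<times> carrier N \<times> carrier M \<times> {\<zero>\<^bsub>U\<^esub>}"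
    by (auto simp: K_def cX diag_part_def)
  have oK: "add K = add \<Lambda>" "smult K = (\<lambda>s x. diag s \<otimes>\<^bsub>\<Lambda>\<^esub> x)" "\<zero>\<^bsub>K\<^esub> = \<zero>\<^bsub>\<Lambda>\<^esub>"
    by (simp_all add: K_def oX)
  define N' where "N' = restrict_scalars ?S fst N"
  define M' where "M' = restrict_scalars ?S snd M"
  have N': "pd_le ?S 0 N'" unfolding N'_def
    by (rule ring_factor.pd_le_proj[OF ring_factor_fst[OF T.ring_axioms U.ring_axioms] pd_le_N])
  have M': "pd_le ?S 0 M'" unfolding M'_def
    by (rule ring_factor.pd_le_proj[OF ring_factor_snd[OF T.ring_axioms U.ring_axioms] pd_le_M])
  have cN: "carrier N' = carrier N" and cM: "carrier M' = carrier M"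
    by (auto simp: N'_def M'_def restrict_scalars_simps(1))
  have oN: "add N' = add N" "smult N' = (\<lambda>s x. fst s \<odot>\<^bsub>N\<^esub> x)" "\<zero>\<^bsub>N'\<^esub> = \<zero>\<^bsub>N\<^esub>"
    and oM: "add M' = add M" "smult M' = (\<lambda>s x. snd s \<odot>\<^bsub>M\<^esub> x)" by (simp_all add: N'_def M'_def)
  define g where "g = (\<lambda>(t :: 't, n :: 'n, m :: 'm, u :: 'u). n)"
  have g: "g \<in> lin_hom ?S K N'"
    by (rule lin_homI) (auto simp: cK oK cN oN g_def diag_def add_L mult_L right_N)
  have gs: "g ` carrier K = carrier N'"
    by (rule surjI[OF lin_hom_closed[OF g]]) (auto simp: cK cN g_def)
  define i where "i = (\<lambda>m :: 'm. (\<zero>\<^bsub>T\<^esub>, \<zero>\<^bsub>N\<^esub>, m, \<zero>\<^bsub>U\<^esub>))"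
  define q where "q = (\<lambda>(t :: 't, n :: 'n, m :: 'm, u :: 'u). m)"
  have "lin_iso ?S M' (ker_module K N' g) i q" unfolding lin_iso_def
    by (intro conjI ballI lin_homI)
      (auto simp: cK oK cM oM oN g_def i_def q_def diag_def add_L mult_L right_N right_M)
  then have "pd_le ?S 0 (ker_module K N' g)"
    by (rule pd_le_iso[OF M' left_module_ker[OF K pd_le_left_module[OF N'] g]])
  then have "pd_le ?S 0 K" by (rule pd_le_ext[OF K g gs N'])
  then show ?thesis unfolding K_def X_def[symmetric] by (rule pd_le_ext[OF X f fs pd_le_regular[OF S]])
qed

text \<open>In \<open>n = \<Sum> a\<^sub>i \<phi>\<^sub>i(n)\<close> each
  \<open>\<phi>\<^sub>i(n)\<close> kills \<open>M\<close> from the left because the tensor product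
  of \<open>N\<close> and \<open>M\<close> over \<open>U\<close> vanishes. The diagonal element with
  entries zero and \<open>\<phi>\<^sub>i(n)\<close> therefore kills the whole off-diagonal ideal.
  The same holds for \<open>m\<close> with the roles of \<open>T\<close> and \<open>U\<close>
  exchanged.\<close>

lemma off_diagonal_induct:
  assumes j: "j \<in> carrier \<Lambda>" "diag_part j = \<zero>\<^bsub>RDirProd T U\<^esub>"
    and gen: "\<And>a s. \<lbrakk>a \<in> carrier \<Lambda>; diag_part a = \<zero>\<^bsub>RDirProd T U\<^esub>; s \<in> carrier (RDirProd T U);
      \<And>k. k \<in> carrier \<Lambda> \<Longrightarrow> diag_part k = \<zero>\<^bsub>RDirProd T U\<^esub> \<Longrightarrow> diag s \<otimes>\<^bsub>\<Lambda>\<^esub> k = \<zero>\<^bsub>\<Lambda>\<^esub>\<rbrakk> \<Longrightarrow>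
      P (a \<otimes>\<^bsub>\<Lambda>\<^esub> diag s)"
    and zero: "P \<zero>\<^bsub>\<Lambda>\<^esub>"
    and add: "\<And>x y. \<lbrakk>x \<in> carrier \<Lambda>; y \<in> carrier \<Lambda>; P x; P y\<rbrakk> \<Longrightarrow> P (x \<oplus>\<^bsub>\<Lambda>\<^esub> y)"
  shows "P j"
proof -
  obtain n m where jnm: "j = (\<zero>\<^bsub>T\<^esub>, n, m, \<zero>\<^bsub>U\<^esub>)" and n: "n \<in> carrier N" and m: "m \<in> carrier M"
    using j by (cases j) (auto simp: carrier_L diag_part_def)
  have Pn: "P (\<zero>\<^bsub>T\<^esub>, n, \<zero>\<^bsub>M\<^esub>, \<zero>\<^bsub>U\<^esub>)"
  proof (rule dual_basis[OF pd_le_right_N])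
    fix r a \<phi> assume a: "\<And>i. i < r \<Longrightarrow> a i \<in> carrier N"
      and \<phi>: "\<And>i x. x \<in> carrier N \<Longrightarrow> \<phi> i x \<in> carrier U"
        "\<And>i x y. x \<in> carrier N \<Longrightarrow> y \<in> carrier N \<Longrightarrow> \<phi> i (x \<oplus>\<^bsub>N\<^esub> y) = \<phi> i x \<oplus>\<^bsub>U\<^esub> \<phi> i y"
        "\<And>i x s. x \<in> carrier N \<Longrightarrow> s \<in> carrier U \<Longrightarrow> \<phi> i (x \<odot>\<^sub>r\<^bsub>N\<^esub> s) = \<phi> i x \<otimes>\<^bsub>U\<^esub> s"
      and \<phi>n: "\<And>x. x \<in> carrier N \<Longrightarrow> x = lin_comb (right_part N) r (\<lambda>i. \<phi> i x) a"
    have \<phi>0: "\<phi> i n \<odot>\<^bsub>M\<^esub> m' = \<zero>\<^bsub>M\<^esub>" if "m' \<in> carrier M" for i m'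
      by (rule right_linear_form_annihilates[OF tensor_zero(2) rN.left_module_axioms M.left_module_axioms
            \<phi>[where i = i] n that])
    \<comment> \<open>Induction over the partial sums of the dual basis expansion, each new term
      being a product supplied by \<open>gen\<close>.\<close>
    have "P (\<zero>\<^bsub>T\<^esub>, lin_comb (right_part N) k (\<lambda>i. \<phi> i n) a, \<zero>\<^bsub>M\<^esub>, \<zero>\<^bsub>U\<^esub>)" if "k \<le> r" for k
      using that
    proof (induction k)
      case (Suc k)
      define y where "y = lin_comb (right_part N) k (\<lambda>i. \<phi> i n) a"
      have y: "y \<in> carrier N" unfolding y_def
        using rN.lin_comb_closed[of k "\<lambda>i. \<phi> i n" a] \<phi>(1)[OF n] a Suc.prems by simp
      have ak: "a k \<in> carrier N" "\<phi> k n \<in> carrier U" using a \<phi>(1)[OF n] Suc.prems by auto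
      have "P ((\<zero>\<^bsub>T\<^esub>, a k, \<zero>\<^bsub>M\<^esub>, \<zero>\<^bsub>U\<^esub>) \<otimes>\<^bsub>\<Lambda>\<^esub> diag (\<zero>\<^bsub>T\<^esub>, \<phi> k n))"
        by (rule gen) (use ak in \<open>auto simp: carrier_L diag_part_def diag_def mult_L zero_L \<phi>0 right_N right_M\<close>)
      then have "P (\<zero>\<^bsub>T\<^esub>, a k \<odot>\<^sub>r\<^bsub>N\<^esub> \<phi> k n, \<zero>\<^bsub>M\<^esub>, \<zero>\<^bsub>U\<^esub>)"
        using ak by (simp add: diag_def mult_L right_N right_M)
      then have "P ((\<zero>\<^bsub>T\<^esub>, y, \<zero>\<^bsub>M\<^esub>, \<zero>\<^bsub>U\<^esub>) \<oplus>\<^bsub>\<Lambda>\<^esub> (\<zero>\<^bsub>T\<^esub>, a k \<odot>\<^sub>r\<^bsub>N\<^esub> \<phi> k n, \<zero>\<^bsub>M\<^esub>, \<zero>\<^bsub>U\<^esub>))"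
        using Suc y ak by (intro add) (auto simp: carrier_L y_def right_N)
      then show ?case by (simp add: add_L y_def)
    qed (use zero in \<open>simp add: zero_L\<close>)
    from this[of r] show "P (\<zero>\<^bsub>T\<^esub>, n, \<zero>\<^bsub>M\<^esub>, \<zero>\<^bsub>U\<^esub>)" using \<phi>n[OF n] by simp
  qed
  have Pm: "P (\<zero>\<^bsub>T\<^esub>, \<zero>\<^bsub>N\<^esub>, m, \<zero>\<^bsub>U\<^esub>)"
  proof (rule dual_basis[OF pd_le_right_M])
    fix r a \<phi> assume a: "\<And>i. i < r \<Longrightarrow> a i \<in> carrier M"
      and \<phi>: "\<And>i x. x \<in> carrier M \<Longrightarrow> \<phi> i x \<in> carrier T"
        "\<And>i x y. x \<in> carrier M \<Longrightarrow> y \<in> carrier M \<Longrightarrow> \<phi> i (x \<oplus>\<^bsub>M\<^esub> y) = \<phi> i x \<oplus>\<^bsub>T\<^esub> \<phi> i y"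
        "\<And>i x s. x \<in> carrier M \<Longrightarrow> s \<in> carrier T \<Longrightarrow> \<phi> i (x \<odot>\<^sub>r\<^bsub>M\<^esub> s) = \<phi> i x \<otimes>\<^bsub>T\<^esub> s"
      and \<phi>m: "\<And>x. x \<in> carrier M \<Longrightarrow> x = lin_comb (right_part M) r (\<lambda>i. \<phi> i x) a"
    have \<phi>0: "\<phi> i m \<odot>\<^bsub>N\<^esub> n' = \<zero>\<^bsub>N\<^esub>" if "n' \<in> carrier N" for i n'
      by (rule right_linear_form_annihilates[OF tensor_zero(1) rM.left_module_axioms N.left_module_axioms
            \<phi>[where i = i] m that])
    have "P (\<zero>\<^bsub>T\<^esub>, \<zero>\<^bsub>N\<^esub>, lin_comb (right_part M) k (\<lambda>i. \<phi> i m) a, \<zero>\<^bsub>U\<^esub>)" if "k \<le> r" for k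
      using that
    proof (induction k)
      case (Suc k)
      define y where "y = lin_comb (right_part M) k (\<lambda>i. \<phi> i m) a"
      have y: "y \<in> carrier M" unfolding y_def
        using rM.lin_comb_closed[of k "\<lambda>i. \<phi> i m" a] \<phi>(1)[OF m] a Suc.prems by simp
      have ak: "a k \<in> carrier M" "\<phi> k m \<in> carrier T" using a \<phi>(1)[OF m] Suc.prems by auto
      have "P ((\<zero>\<^bsub>T\<^esub>, \<zero>\<^bsub>N\<^esub>, a k, \<zero>\<^bsub>U\<^esub>) \<otimes>\<^bsub>\<Lambda>\<^esub> diag (\<phi> k m, \<zero>\<^bsub>U\<^esub>))"
        by (rule gen) (use ak in \<open>auto simp: carrier_L diag_part_def diag_def mult_L zero_L \<phi>0 right_N right_M\<close>)
      then have "P (\<zero>\<^bsub>T\<^esub>, \<zero>\<^bsub>N\<^esub>, a k \<odot>\<^sub>r\<^bsub>M\<^esub> \<phi> k m, \<zero>\<^bsub>U\<^esub>)"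
        using ak by (simp add: diag_def mult_L right_N right_M)
      then have "P ((\<zero>\<^bsub>T\<^esub>, \<zero>\<^bsub>N\<^esub>, y, \<zero>\<^bsub>U\<^esub>) \<oplus>\<^bsub>\<Lambda>\<^esub> (\<zero>\<^bsub>T\<^esub>, \<zero>\<^bsub>N\<^esub>, a k \<odot>\<^sub>r\<^bsub>M\<^esub> \<phi> k m, \<zero>\<^bsub>U\<^esub>))"
        using Suc y ak by (intro add) (auto simp: carrier_L y_def right_M)
      then show ?case by (simp add: add_L y_def)
    qed (use zero in \<open>simp add: zero_L\<close>)
    from this[of r] show "P (\<zero>\<^bsub>T\<^esub>, \<zero>\<^bsub>N\<^esub>, m, \<zero>\<^bsub>U\<^esub>)" using \<phi>m[OF m] by simp
  qed
  have "P ((\<zero>\<^bsub>T\<^esub>, n, \<zero>\<^bsub>M\<^esub>, \<zero>\<^bsub>U\<^esub>) \<oplus>\<^bsub>\<Lambda>\<^esub> (\<zero>\<^bsub>T\<^esub>, \<zero>\<^bsub>N\<^esub>, m, \<zero>\<^bsub>U\<^esub>))"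
    using Pn Pm n m by (intro add) (auto simp: carrier_L)
  then show ?thesis using n m by (simp add: jnm add_L)
qed

lemma split_extension_diag: "split_extension (RDirProd T U) \<Lambda> diag diag_part"
proof (intro split_extension.intro split_extension_axioms.intro)
  show "ring (RDirProd T U)" by (rule RDirProd_ring[OF T.ring_axioms U.ring_axioms])
  show "ring \<Lambda>" by (rule L.ring_axioms)
  show "diag \<one>\<^bsub>RDirProd T U\<^esub> = \<one>\<^bsub>\<Lambda>\<^esub>" "diag_part \<one>\<^bsub>\<Lambda>\<^esub> = \<one>\<^bsub>RDirProd T U\<^esub>"
    by (simp_all add: diag_def diag_part_def one_L)
  show "diag_part (diag s) = s" if "s \<in> carrier (RDirProd T U)" for s
    by (simp add: diag_def diag_part_def split: prod.split)
qed (fact diag_hom diag_part_hom pd_le_L off_diagonal_induct)+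

lemma special_GLIT_morita_ring: "special_GLIT \<Lambda> \<longleftrightarrow> special_GLIT T \<and> special_GLIT U"
  using split_extension.special_GLIT_split[OF split_extension_diag]
    special_GLIT_RDirProd[OF T.ring_axioms U.ring_axioms] by simp

end

theorem theorem4p14:
  fixes T :: "'t ring" and U :: "'u ring"
    and N :: "('t, 'n, 'u) bimodule" and M :: "('u, 'm, 't) bimodule"
    and \<alpha> :: "(('m \<times> 'n) \<Rightarrow>\<^sub>0 int) set \<Rightarrow> 'u"
    and \<beta> :: "(('n \<times> 'm) \<Rightarrow>\<^sub>0 int) set \<Rightarrow> 't"
  assumes "morita_context T N M U \<alpha> \<beta>"
    and "artin_algebra (morita_ring T N M U \<alpha> \<beta>)"
    and "projective_module U M"
    and "projective_module (op_ring T) (right_part M)"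
    and "projective_module T N"
    and "projective_module (op_ring U) (right_part N)"
    and "trivial_group (tensor_product T M N)"
    and "trivial_group (tensor_product U N M)"
  shows "special_GLIT (morita_ring T N M U \<alpha> \<beta>) \<longleftrightarrow> special_GLIT T \<and> special_GLIT U"
  by (rule morita_zero_tensor.special_GLIT_morita_ring
      [OF morita_zero_tensor.intro[OF assms(1) morita_zero_tensor_axioms.intro[OF assms(2-8)]]])

end
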